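(* Let $\langle\omega_1,\omega_2,\omega_3,\omega_4\rangle$ be a Samuelson web on a two-dimensional manifold $M$, written in its canonical normalization in local coordinates $(x,y)$ by means of smooth functions $f,g$, so that $\omega_1=-f_x\,dx$, $\omega_2=-f_y\,dy$, $\omega_3=df$, $\omega_4=f_x\,dx+b f_y\,dy$ with $b=\dfrac{f_xg_y}{f_yg_x}$. Let $\partial_1,\partial_2,H,K,\delta_2\delta_1\log b,\delta,T_0,T_1,T_2,T_3$ and the rank of the web be as defined in the context. Then the Samuelson web has the maximum rank six if and only if the following conditions hold: $$ K=-\delta_2\delta_1\log b,\qquad \delta\Bigl(\frac{T_2}{T_3}\Bigr)=\delta\Bigl(\frac{T_1}{T_3}\Bigr)=\delta\Bigl(\frac{T_0}{T_3}\Bigr)=0 . $$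
   Context: Everything is smooth and local. A planar $4$-web $\langle\omega_1,\omega_2,\omega_3,\omega_4\rangle$ on a two-dimensional manifold $M$ is given by four differential $1$-forms (each defined up to a nonvanishing factor, its foliation being the kernel of the form) with $\omega_i\wedge\omega_j\ne 0$ at every point for $i\neq j$. It is a Samuelson web if the forms satisfy $\omega_3\wedge\omega_1+\omega_4\wedge\omega_2=0$. Canonical normalization: the forms of a Samuelson web can be rescaled so that $\omega_1+\omega_2+\omega_3=0$ and $\omega_4+\omega_1+b\,\omega_2=0$ for a function $b$. Choose local coordinates $(x,y)$ and functions $f,g$ such that $\omega_3=df$, $\omega_1\wedge dx=0$, $\omega_2\wedge dy=0$, $\omega_4\wedge dg=0$. Then $\omega_1=-f_x\,dx$, $\omega_2=-f_y\,dy$, $\omega_4=f_x\,dx+bf_y\,dy$ and $b=\dfrac{f_xg_y}{f_yg_x}$. The functions $f_x,f_y,g_x,g_y$ do not vanish, and $b\neq 0$, $b\ne 1$, because of general position of the web. Notation. Put $\partial_1=-\frac1{f_x}\partial_x$ and $\partial_2=-\frac1{f_y}\partial_y$ (the frame dual to $\omega_1,\omega_2$). For a function $p$ write $p_i=\partial_i(p)$ and $p_{ij}=\partial_i\partial_j(p)$; for the indexed functions $\sigma_1,\sigma_2$ below write $\sigma_{i,j}=\partial_j(\sigma_i)$. Let $$H=\frac{f_{xy}}{f_xf_y},\qquad K=-\frac{1}{f_xf_y}\Bigl(\log\frac{f_x}{f_y}\Bigr)_{xy}=H_1-H_2 .$$ ($K$ is the scalar curvature of the $3$-web $\langle\omega_1,\omega_2,\omega_3\rangle$.)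 Put $\delta=\partial_1-\partial_2$. Here $\delta_2\delta_1\log b$ denotes the iterated covariant derivative with respect to the Chern connection of the $3$-web $\langle\omega_1,\omega_2,\omega_3\rangle$, that is, $$\delta_2\delta_1\log b=\partial_2\partial_1\log|b|-H\,\partial_1\log|b| .$$ Samuelson's equations. One looks for positive functions $s_1,s_2,t_1,t_2$ with $d(s_1\omega_1)=d(s_2\omega_2)=d(t_1\omega_3)=d(t_2\omega_4)=0$ and $s_1t_1=s_2t_2$. Writing $\sigma_i=\log s_i$ and $\tau_i=\log t_i$, one has $\tau_1=w(f)$ for a function $w$ of one variable and $\tau_2=\sigma_1+\tau_1-\sigma_2$, and the equations become the following system for $(\sigma_1,\sigma_2,w)$: $$\sigma_{1,2}=H,\qquad \sigma_{2,1}=H,\qquad b\,\sigma_{1,1}+\sigma_{2,2}=B,\qquad B=2bH-b_1+(b-1)\,w'(f). \tag{S}$$ Put $$r=H-\frac{b_1}{b},\qquad R=\frac{B_1-H_2+H^2-HB}{b}.$$ The integrability conditions of (S), viewed as a system for $(\sigma_1,\sigma_2)$ with $w$ given, are $$R_2+rH_1-rH^2-H_{11}+3HH_1-H^3-2HR=0, \tag{I}$$ $$r_2+H^2-H_1-rH=0. \tag{II}$$ Since $\partial_1 f=\partial_2 f=-1$, condition (I) can be written as $$T_3\,w'''(f)+T_2\,w''(f)+T_1\,w'(f)+T_0=0,$$ where the functions $T_i$ do not depend on $w$. Explicitly, with $$c=\frac{b-1}{b},\qquad e=\frac{b_1-(b-1)H}{b},\qquad B^0=2bH-b_1,\qquad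 R^0=\frac{\partial_1(B^0)-H_2+H^2-HB^0}{b},$$ one has $$T_3=c,\qquad T_2=2Hc-e-\partial_2(c),\qquad T_1=\partial_2(e)-2He,$$ $$T_0=\partial_2(R^0)-2HR^0+rH_1-rH^2-H_{11}+3HH_1-H^3 .$$ Rank. The rank of the Samuelson web is the dimension of the (affine) space of local solutions $(\sigma_1,\sigma_2,w)$ of the system consisting of (S) together with the integrability conditions (I) and (II). For given $w$ the space of pairs $(\sigma_1,\sigma_2)$ has dimension at most three, and it is three-dimensional when (I) and (II) hold; the space of admissible $w$ has dimension at most three. The maximum rank is six. "The web has rank six" means that the space of germs of solutions at every point of the coordinate domain has dimension six. *)

theory Defs
  imports "HOL-Analysis.Analysis"
begin

section \<open>Smooth functions, partial derivatives, 1-forms\<close>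

primrec Ck_on :: "nat \<Rightarrow> 'a::real_normed_vector set \<Rightarrow> ('a \<Rightarrow> 'b::real_normed_vector) \<Rightarrow> bool" where
  "Ck_on 0 U h \<longleftrightarrow> continuous_on U h"
| "Ck_on (Suc k) U h \<longleftrightarrow>
     (\<forall>p\<in>U. h differentiable (at p)) \<and> (\<forall>v. Ck_on k U (\<lambda>p. frechet_derivative h (at p) v))"

text \<open>Only used on open sets \<open>U\<close>.\<close>
definition smooth_on :: "'a::real_normed_vector set \<Rightarrow> ('a \<Rightarrow> 'b::real_normed_vector) \<Rightarrow> bool" where
  "smooth_on U h \<longleftrightarrow> (\<forall>k. Ck_on k U h)"

type_synonym pt = "real \<times> real"
type_synonym fn = "pt \<Rightarrow> real"

definition px :: "fn \<Rightarrow> fn" where "px h p = frechet_derivative h (at p) (1, 0)"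
definition py :: "fn \<Rightarrow> fn" where "py h p = frechet_derivative h (at p) (0, 1)"

text \<open>The 1-form \<open>u dx + v dy\<close> is represented by the map \<open>p \<mapsto> (u p, v p)\<close>, and a 2-form
  by its coefficient with respect to \<open>dx \<and> dy\<close>.\<close>
type_synonym form1 = "pt \<Rightarrow> real \<times> real"

definition wedge :: "form1 \<Rightarrow> form1 \<Rightarrow> fn" where
  "wedge \<alpha> \<beta> p = fst (\<alpha> p) * snd (\<beta> p) - snd (\<alpha> p) * fst (\<beta> p)"


section \<open>Samuelson webs and their canonical normalization\<close>

definition planar_4_web :: "pt set \<Rightarrow> (nat \<Rightarrow> form1) \<Rightarrow> bool" where
  "planar_4_web U \<omega> \<longleftrightarrow>
     (\<forall>i\<in>{1..4}. smooth_on U (\<omega> i)) \<and>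
     (\<forall>i\<in>{1..4}. \<forall>j\<in>{1..4}. i \<noteq> j \<longrightarrow> (\<forall>p\<in>U. wedge (\<omega> i) (\<omega> j) p \<noteq> 0))"

definition samuelson_web :: "pt set \<Rightarrow> (nat \<Rightarrow> form1) \<Rightarrow> bool" where
  "samuelson_web U \<omega> \<longleftrightarrow> planar_4_web U \<omega> \<and>
     (\<forall>p\<in>U. wedge (\<omega> 3) (\<omega> 1) p + wedge (\<omega> 4) (\<omega> 2) p = 0)"

definition bfun :: "fn \<Rightarrow> fn \<Rightarrow> fn" where
  "bfun f g p = (px f p * py g p) / (py f p * px g p)"

definition canonical_normalization :: "pt set \<Rightarrow> (nat \<Rightarrow> form1) \<Rightarrow> fn \<Rightarrow> fn \<Rightarrow> bool" where
  "canonical_normalization U \<omega> f g \<longleftrightarrow>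
     smooth_on U f \<and> smooth_on U g \<and>
     (\<forall>p\<in>U. px f p \<noteq> 0 \<and> py f p \<noteq> 0 \<and> px g p \<noteq> 0 \<and> py g p \<noteq> 0 \<and>
        \<omega> 1 p = (- px f p, 0) \<and>
        \<omega> 2 p = (0, - py f p) \<and>
        \<omega> 3 p = (px f p, py f p) \<and>
        \<omega> 4 p = (px f p, bfun f g p * py f p))"

lemma canonical_normalization_relations:
  assumes "canonical_normalization U \<omega> f g" "p \<in> U"
  shows "\<omega> 1 p + \<omega> 2 p + \<omega> 3 p = 0"
    and "\<omega> 4 p + \<omega> 1 p + bfun f g p *\<^sub>R \<omega> 2 p = 0"
    and "wedge (\<omega> 4) (\<lambda>q. (px g q, py g q)) p = 0"
  using assms by (auto simp: canonical_normalization_def wedge_def bfun_def prod_eq_iff field_simps)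


section \<open>Invariants\<close>

definition d1 :: "fn \<Rightarrow> fn \<Rightarrow> fn" where "d1 f h p = - (1 / px f p) * px h p"
definition d2 :: "fn \<Rightarrow> fn \<Rightarrow> fn" where "d2 f h p = - (1 / py f p) * py h p"
definition delta :: "fn \<Rightarrow> fn \<Rightarrow> fn" where "delta f h p = d1 f h p - d2 f h p"

definition Hfun :: "fn \<Rightarrow> fn" where
  "Hfun f p = py (px f) p / (px f p * py f p)"

definition Kfun :: "fn \<Rightarrow> fn" where
  "Kfun f p = - (1 / (px f p * py f p)) * py (px (\<lambda>q. ln \<bar>px f q / py f q\<bar>)) p"

text \<open>The iterated covariant derivative \<open>\<delta>\<^sub>2 \<delta>\<^sub>1 log b\<close> for the Chern connection of the 3-web.\<close>
definition dd_log_b :: "fn \<Rightarrow> fn \<Rightarrow> fn" where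
  "dd_log_b f g p =
     d2 f (d1 f (\<lambda>q. ln \<bar>bfun f g q\<bar>)) p - Hfun f p * d1 f (\<lambda>q. ln \<bar>bfun f g q\<bar>) p"

definition rfun :: "fn \<Rightarrow> fn \<Rightarrow> fn" where
  "rfun f g p = Hfun f p - d1 f (bfun f g) p / bfun f g p"

definition B0fun :: "fn \<Rightarrow> fn \<Rightarrow> fn" where
  "B0fun f g p = 2 * bfun f g p * Hfun f p - d1 f (bfun f g) p"

definition Bfun :: "fn \<Rightarrow> fn \<Rightarrow> (real \<Rightarrow> real) \<Rightarrow> fn" where
  "Bfun f g w p = 2 * bfun f g p * Hfun f p - d1 f (bfun f g) p + (bfun f g p - 1) * deriv w (f p)"

text \<open>The expression \<open>(B\<^sub>1 - H\<^sub>2 + H\<^sup>2 - H B) / b\<close> in a function \<open>B\<close>; it gives \<open>R\<close> for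
  \<open>B = Bfun f g w\<close> and \<open>R\<^sup>0\<close> for \<open>B = B0fun f g\<close>.\<close>
definition Rof :: "fn \<Rightarrow> fn \<Rightarrow> fn \<Rightarrow> fn" where
  "Rof f g B p =
     (d1 f B p - d2 f (Hfun f) p + (Hfun f p)\<^sup>2 - Hfun f p * B p) / bfun f g p"

text \<open>The left-hand side of the first integrability condition in a function \<open>R\<close>.\<close>
definition integ1 :: "fn \<Rightarrow> fn \<Rightarrow> fn \<Rightarrow> fn" where
  "integ1 f g R p =
     d2 f R p + rfun f g p * d1 f (Hfun f) p - rfun f g p * (Hfun f p)\<^sup>2
     - d1 f (d1 f (Hfun f)) p + 3 * Hfun f p * d1 f (Hfun f) p - (Hfun f p) ^ 3
     - 2 * Hfun f p * R p"

definition integ2 :: "fn \<Rightarrow> fn \<Rightarrow> fn" where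
  "integ2 f g p =
     d2 f (rfun f g) p + (Hfun f p)\<^sup>2 - d1 f (Hfun f) p - rfun f g p * Hfun f p"

definition cfun :: "fn \<Rightarrow> fn \<Rightarrow> fn" where
  "cfun f g p = (bfun f g p - 1) / bfun f g p"

definition efun :: "fn \<Rightarrow> fn \<Rightarrow> fn" where
  "efun f g p = (d1 f (bfun f g) p - (bfun f g p - 1) * Hfun f p) / bfun f g p"

definition T3 :: "fn \<Rightarrow> fn \<Rightarrow> fn" where
  "T3 f g p = cfun f g p"

definition T2 :: "fn \<Rightarrow> fn \<Rightarrow> fn" where
  "T2 f g p = 2 * Hfun f p * cfun f g p - efun f g p - d2 f (cfun f g) p"

definition T1 :: "fn \<Rightarrow> fn \<Rightarrow> fn" where
  "T1 f g p = d2 f (efun f g) p - 2 * Hfun f p * efun f g p"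

definition T0 :: "fn \<Rightarrow> fn \<Rightarrow> fn" where
  "T0 f g p =
     d2 f (Rof f g (B0fun f g)) p - 2 * Hfun f p * Rof f g (B0fun f g) p
     + rfun f g p * d1 f (Hfun f) p - rfun f g p * (Hfun f p)\<^sup>2
     - d1 f (d1 f (Hfun f)) p + 3 * Hfun f p * d1 f (Hfun f) p - (Hfun f p) ^ 3"


section \<open>Germs\<close>

text \<open>Germs at the origin. The germ of \<open>h\<close> at another point \<open>p\<close> is obtained by translating
  \<open>p\<close> to the origin, so that germs at all points live in one real vector space.\<close>

quotient_type (overloaded) 'a germ =
  "'a::real_normed_vector \<Rightarrow> real" / "\<lambda>h k. \<forall>\<^sub>F v in nhds 0. h v = k v"
proof (rule equivpI)
  show "reflp (\<lambda>h k :: 'a \<Rightarrow> real. \<forall>\<^sub>F v in nhds 0. h v = k v)"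
    by (auto simp: reflp_def)
  show "symp (\<lambda>h k :: 'a \<Rightarrow> real. \<forall>\<^sub>F v in nhds 0. h v = k v)"
    by (auto simp: symp_def elim: eventually_mono)
  show "transp (\<lambda>h k :: 'a \<Rightarrow> real. \<forall>\<^sub>F v in nhds 0. h v = k v)"
    by (auto simp: transp_def elim: eventually_elim2)
qed

instantiation germ :: (real_normed_vector) real_vector
begin

lift_definition zero_germ :: "'a germ" is "\<lambda>_. 0" .
lift_definition plus_germ :: "'a germ \<Rightarrow> 'a germ \<Rightarrow> 'a germ" is "\<lambda>h k v. h v + k v"
  by (auto elim: eventually_elim2)
lift_definition minus_germ :: "'a germ \<Rightarrow> 'a germ \<Rightarrow> 'a germ" is "\<lambda>h k v. h v - k v"
  by (auto elim: eventually_elim2)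
lift_definition uminus_germ :: "'a germ \<Rightarrow> 'a germ" is "\<lambda>h v. - h v"
  by (auto elim: eventually_mono)
lift_definition scaleR_germ :: "real \<Rightarrow> 'a germ \<Rightarrow> 'a germ" is "\<lambda>c h v. c * h v"
  by (auto elim: eventually_mono)

instance
  by standard (transfer, simp add: algebra_simps)+

end

definition germ_at :: "'a::real_normed_vector \<Rightarrow> ('a \<Rightarrow> real) \<Rightarrow> 'a germ" where
  "germ_at p h = abs_germ (\<lambda>v. h (p + v))"

lemma germ_at_eq_iff: "germ_at p h = germ_at p k \<longleftrightarrow> (\<forall>\<^sub>F q in nhds p. h q = k q)"
proof -
  have *: "nhds p = filtermap (\<lambda>v. p + v) (nhds 0)"
    using filtermap_nhds_shift[of "- p" 0] by (simp add: add.commute)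
  show ?thesis
    unfolding germ_at_def germ.abs_eq_iff * eventually_filtermap ..
qed


section \<open>Solutions and rank\<close>

text \<open>Smooth solutions \<open>(\<sigma>\<^sub>1, \<sigma>\<^sub>2, w)\<close> on \<open>N\<close> of the Samuelson system together with its
  integrability conditions; \<open>w\<close> is a function on the open set \<open>J\<close> of values of \<open>f\<close>.\<close>
definition samuelson_solution ::
  "fn \<Rightarrow> fn \<Rightarrow> pt set \<Rightarrow> real set \<Rightarrow> fn \<Rightarrow> fn \<Rightarrow> (real \<Rightarrow> real) \<Rightarrow> bool" where
  "samuelson_solution f g N J \<sigma>\<^sub>1 \<sigma>\<^sub>2 w \<longleftrightarrow>
     open N \<and> open J \<and> f ` N \<subseteq> J \<and> smooth_on N \<sigma>\<^sub>1 \<and> smooth_on N \<sigma>\<^sub>2 \<and> smooth_on J w \<and>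
     (\<forall>q\<in>N.
        d2 f \<sigma>\<^sub>1 q = Hfun f q \<and>
        d1 f \<sigma>\<^sub>2 q = Hfun f q \<and>
        bfun f g q * d1 f \<sigma>\<^sub>1 q + d2 f \<sigma>\<^sub>2 q = Bfun f g w q \<and>
        integ1 f g (Rof f g (Bfun f g w)) q = 0 \<and>
        integ2 f g q = 0)"

definition solution_germs :: "pt set \<Rightarrow> fn \<Rightarrow> fn \<Rightarrow> pt \<Rightarrow> (pt germ \<times> pt germ \<times> real germ) set" where
  "solution_germs U f g p =
     {(germ_at p \<sigma>\<^sub>1, germ_at p \<sigma>\<^sub>2, germ_at (f p) w) | \<sigma>\<^sub>1 \<sigma>\<^sub>2 w.
        \<exists>N J. p \<in> N \<and> N \<subseteq> U \<and> samuelson_solution f g N J \<sigma>\<^sub>1 \<sigma>\<^sub>2 w}"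

text \<open>The library's \<open>aff_dim\<close> requires a Euclidean space. As there, the empty set has
  dimension \<open>-1\<close>. Note that \<open>dim\<close> is \<open>0\<close> for an infinite-dimensional set.\<close>
definition affine_dim :: "'a::real_vector set \<Rightarrow> int" where
  "affine_dim S = (if S = {} then - 1 else int (dim {s - t | s t. s \<in> S \<and> t \<in> S}))"

definition web_rank :: "pt set \<Rightarrow> fn \<Rightarrow> fn \<Rightarrow> pt \<Rightarrow> int" where
  "web_rank U f g p = affine_dim (solution_germs U f g p)"

end

theory Submission
  imports Defs
begin

text \<open>
  Near a point \<open>p\<close> a solution is determined by six numbers, its jet: the values at \<open>p\<close> of
  \<open>\<sigma>\<^sub>1\<close>, \<open>\<sigma>\<^sub>2\<close> and \<open>u = \<partial>\<^sub>1 \<sigma>\<^sub>1\<close>, and the values at \<open>f p\<close> of \<open>w\<close>, \<open>w'\<close>, \<open>w''\<close>. The reason is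
  that the system closes after one prolongation. By the commutation rule
  \<open>[\<partial>\<^sub>1, \<partial>\<^sub>2] = H (\<partial>\<^sub>2 - \<partial>\<^sub>1)\<close> (\<open>commutator\<close>), the three equations for
  \<open>\<sigma>\<^sub>1, \<sigma>\<^sub>2\<close> give both derivatives of \<open>u\<close> as affine functions of \<open>u\<close>
  (\<open>prolongation_homogeneous\<close>), while the first integrability condition is the third order
  equation \<open>T\<^sub>3 w''' + T\<^sub>2 w'' + T\<^sub>1 w' + T\<^sub>0 = 0\<close> along \<open>f\<close> (\<open>integ1_Bfun\<close>). A Gronwall
  estimate then shows that a homogeneous solution with vanishing jet vanishes near \<open>p\<close>
  (\<open>homogeneous_solution_zero_of_jet_zero\<close>). Hence the rank at \<open>p\<close> is six exactly when there
  is a solution near \<open>p\<close> and every vector of \<open>\<real>\<^sup>6\<close> is the jet of a homogeneous one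
  (\<open>web_rank_eq_6_iff\<close>).

  If the rank is six, the second integrability condition holds, and it says
  \<open>K = - \<delta>\<^sub>2 \<delta>\<^sub>1 log b\<close> (\<open>integ2_eq\<close>). Divide the equation for \<open>w\<close> by \<open>T\<^sub>3\<close> and apply \<open>\<delta>\<close>.
  Since \<open>\<delta>\<close> kills functions of \<open>f\<close>, what remains is
  \<open>\<delta>(T\<^sub>2/T\<^sub>3) w'' + \<delta>(T\<^sub>1/T\<^sub>3) w' + \<delta>(T\<^sub>0/T\<^sub>3) = 0\<close>, without the last term for a homogeneous
  solution (\<open>delta_ratio_relation\<close>). As \<open>w'\<close> and \<open>w''\<close> take arbitrary values at \<open>f p\<close>, all three
  coefficients vanish at \<open>p\<close>.

  Conversely, \<open>\<delta>(T\<^sub>i/T\<^sub>3) = 0\<close> makes each \<open>T\<^sub>i/T\<^sub>3\<close> locally a function of \<open>f\<close>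
  (\<open>level_coordinate\<close>), so that the equation for \<open>w\<close> is a linear ordinary differential equation
  with three free initial values (\<open>linear_third_order_ode\<close>). For each such \<open>w\<close> the system for
  \<open>\<sigma>\<^sub>1, \<sigma>\<^sub>2\<close> is solved by separation of variables (\<open>samuelson_system_solvable\<close>). The first two
  equations mean \<open>\<sigma>\<^sub>1 = - log |f\<^sub>x| + \<alpha>(x)\<close> and \<open>\<sigma>\<^sub>2 = - log |f\<^sub>y| + \<gamma>(y)\<close>, and the third becomes
  \<open>\<rho> \<alpha>'(x) + \<gamma>'(y) = m\<close> with \<open>\<rho> = g\<^sub>y/g\<^sub>x\<close> and a known function \<open>m\<close>. The integrability conditions
  say precisely that \<open>\<rho>\<^sub>x/\<rho>\<close> and \<open>m\<^sub>x/\<rho>\<close> depend on \<open>x\<close> only, which allows \<open>\<alpha>'\<close> and \<open>\<gamma>'\<close> to be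
  read off along a horizontal and a vertical line. This realises every jet.
\<close>

section \<open>Calculus of smooth functions\<close>

lemma frechet_derivative_cong_open:
  assumes "open U" "p \<in> U" "\<And>q. q \<in> U \<Longrightarrow> h q = k q"
  shows "frechet_derivative h (at p) = frechet_derivative k (at p)"
proof -
  have "(h has_derivative D) (at p) \<longleftrightarrow> (k has_derivative D) (at p)" for D
    using assms has_derivative_transform_within_open by metis
  then show ?thesis by (simp add: frechet_derivative_def)
qed

lemma has_derivative_imp_frechet:
  "(h has_derivative D) (at p) \<Longrightarrow> frechet_derivative h (at p) = D"
  using frechet_derivative_at by metis

lemma Ck_on_subset: "Ck_on k U h \<Longrightarrow> V \<subseteq> U \<Longrightarrow> Ck_on k V h"
  by (induction k arbitrary: h) (auto intro: continuous_on_subset)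

lemma Ck_on_cong:
  assumes "open U" "Ck_on k U h" "\<And>q. q \<in> U \<Longrightarrow> h q = h' q"
  shows "Ck_on k U h'"
  using assms(2,3)
proof (induction k arbitrary: h h')
  case 0
  then show ?case using continuous_on_cong[of U U h h'] by simp
next
  case (Suc k)
  have "h' differentiable (at p)" if p: "p \<in> U" for p
  proof -
    have "h differentiable (at p)" using Suc.prems(1) p by simp
    then obtain D where "(h has_derivative D) (at p)"
      unfolding differentiable_def by blast
    then have "(h' has_derivative D) (at p)"
      using has_derivative_transform_within_open[OF _ \<open>open U\<close> p] Suc.prems(2) by blast
    then show ?thesis by (rule differentiableI)
  qed
  moreover have "Ck_on k U (\<lambda>p. frechet_derivative h' (at p) v)" for v
  proof (rule Suc.IH)
    show "Ck_on k U (\<lambda>p. frechet_derivative h (at p) v)" using Suc.prems(1) by simp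
    show "frechet_derivative h (at q) v = frechet_derivative h' (at q) v" if "q \<in> U" for q
      using frechet_derivative_cong_open[OF \<open>open U\<close> that, of h h'] Suc.prems(2) by simp
  qed
  ultimately show ?case by simp
qed

lemma Ck_on_SucI:
  assumes "open U" "\<And>p. p \<in> U \<Longrightarrow> (h has_derivative D p) (at p)"
    and "\<And>v. Ck_on k U (\<lambda>p. D p v)"
  shows "Ck_on (Suc k) U h"
proof -
  have "Ck_on k U (\<lambda>p. frechet_derivative h (at p) v)" for v
    by (rule Ck_on_cong[OF assms(1) assms(3)[of v]])
      (simp add: assms(2)[THEN has_derivative_imp_frechet])
  moreover have "h differentiable (at p)" if "p \<in> U" for p
    using assms(2)[OF that] by (rule differentiableI)
  ultimately show ?thesis by simp
qed

lemma Ck_on_SucD: "Ck_on (Suc k) U h \<Longrightarrow> Ck_on k U h"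
proof (induction k arbitrary: h)
  case 0
  then show ?case
    by (auto simp: continuous_on_eq_continuous_within differentiable_imp_continuous_within
        intro: continuous_at_imp_continuous_at_within)
next
  case (Suc k)
  then show ?case using Ck_on.simps(2) by blast
qed

lemma Ck_on_const: "Ck_on k U (\<lambda>_. c)"
proof (induction k arbitrary: c)
  case (Suc k)
  have "frechet_derivative (\<lambda>_. c) (at p) = (\<lambda>_. 0)" for p :: 'a
    by (simp add: has_derivative_imp_frechet)
  then show ?case using Suc by simp
qed simp

lemma Ck_on_bounded_linear:
  assumes "open U" "bounded_linear L"
  shows "Ck_on k U L"
proof (cases k)
  case 0
  then show ?thesis using assms by (simp add: linear_continuous_on)
next
  case (Suc j)
  then show ?thesis
    using Ck_on_SucI[OF assms(1), of L "\<lambda>_. L"] assms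
    by (auto intro: bounded_linear_imp_has_derivative Ck_on_const)
qed

lemma Ck_on_add:
  assumes "open U" "Ck_on k U h" "Ck_on k U h'"
  shows "Ck_on k U (\<lambda>p. h p + h' p)"
  using assms(2,3)
proof (induction k arbitrary: h h')
  case 0
  then show ?case by (simp add: continuous_on_add)
next
  case (Suc k)
  show ?case
  proof (rule Ck_on_SucI[OF \<open>open U\<close>])
    show "((\<lambda>p. h p + h' p) has_derivative
        (\<lambda>v. frechet_derivative h (at p) v + frechet_derivative h' (at p) v)) (at p)"
      if "p \<in> U" for p
      using Suc.prems that by (intro has_derivative_add) (auto simp: frechet_derivative_works)
  qed (use Suc in auto)
qed

lemma Ck_on_mult:
  fixes h h' :: "'a::real_normed_vector \<Rightarrow> real"
  assumes "open U" "Ck_on k U h" "Ck_on k U h'"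
  shows "Ck_on k U (\<lambda>p. h p * h' p)"
  using assms(2,3)
proof (induction k arbitrary: h h')
  case 0
  then show ?case by (simp add: continuous_on_mult)
next
  case (Suc k)
  show ?case
  proof (rule Ck_on_SucI[OF \<open>open U\<close>])
    show "((\<lambda>p. h p * h' p) has_derivative
        (\<lambda>v. h p * frechet_derivative h' (at p) v + frechet_derivative h (at p) v * h' p)) (at p)"
      if "p \<in> U" for p
      using Suc.prems that by (intro has_derivative_mult) (auto simp: frechet_derivative_works)
    show "Ck_on k U (\<lambda>p. h p * frechet_derivative h' (at p) v + frechet_derivative h (at p) v * h' p)"
      for v
    proof (rule Ck_on_add[OF \<open>open U\<close>])
      show "Ck_on k U (\<lambda>p. h p * frechet_derivative h' (at p) v)"
        using Suc.prems(2) by (intro Suc.IH Ck_on_SucD[OF Suc.prems(1)]) simp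
      show "Ck_on k U (\<lambda>p. frechet_derivative h (at p) v * h' p)"
        using Suc.prems(1) by (intro Suc.IH Ck_on_SucD[OF Suc.prems(2)]) simp
    qed
  qed
qed

lemma Ck_on_sum:
  fixes h :: "'i \<Rightarrow> 'a::real_normed_vector \<Rightarrow> 'b::real_normed_vector"
  assumes "open U" "\<And>i. i \<in> I \<Longrightarrow> Ck_on k U (h i)"
  shows "Ck_on k U (\<lambda>p. \<Sum>i\<in>I. h i p)"
  using assms(2) by (induction I rule: infinite_finite_induct) (auto intro: Ck_on_const Ck_on_add[OF \<open>open U\<close>])

text \<open>The derivative of the composite evaluates that of \<open>k\<close> in the direction of the derivative of
  \<open>h\<close>, which moves with the point. Expanding this direction in the basis leaves only directional
  derivatives of \<open>k\<close> in fixed directions, to which the induction hypothesis applies.\<close>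
lemma Ck_on_compose:
  fixes h :: "'a::real_normed_vector \<Rightarrow> 'b::euclidean_space" and k :: "'b \<Rightarrow> real"
  assumes "open U" "open V" "h ` U \<subseteq> V" "Ck_on n V k"
    and "\<And>i. i \<in> Basis \<Longrightarrow> Ck_on n U (\<lambda>p. h p \<bullet> i)"
  shows "Ck_on n U (\<lambda>p. k (h p))"
  using assms(4,5)
proof (induction n arbitrary: k)
  case 0
  then have "continuous_on U h"
    by (subst continuous_on_componentwise) auto
  then show ?case using 0 assms(3) by (auto intro: continuous_on_compose2)
next
  case (Suc n)
  let ?h' = "\<lambda>p i. frechet_derivative (\<lambda>p. h p \<bullet> i) (at p)"
  let ?D = "\<lambda>p v. \<Sum>i\<in>Basis. ?h' p i v * frechet_derivative k (at (h p)) i"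
  show ?case
  proof (rule Ck_on_SucI[OF \<open>open U\<close>])
    show "((\<lambda>p. k (h p)) has_derivative ?D p) (at p)" if p: "p \<in> U" for p
    proof -
      let ?hd = "\<lambda>v. \<Sum>i\<in>Basis. ?h' p i v *\<^sub>R i"
      have "((\<lambda>p. \<Sum>i\<in>Basis. (h p \<bullet> i) *\<^sub>R i) has_derivative ?hd) (at p)"
        using Suc.prems(2) p
        by (intro has_derivative_sum has_derivative_scaleR_left) (auto simp: frechet_derivative_works)
      then have h: "(h has_derivative ?hd) (at p)"
        by (simp add: euclidean_representation)
      have k: "(k has_derivative frechet_derivative k (at (h p))) (at (h p))"
        using Suc.prems(1) p assms(3) by (auto simp: frechet_derivative_works)
      then have "linear (frechet_derivative k (at (h p)))"
        by (simp add: has_derivative_linear)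
      then have "frechet_derivative k (at (h p)) (?hd v) = ?D p v" for v
        by (simp add: linear_sum linear_cmul)
      then show ?thesis
        using has_derivative_compose[OF h k] by (simp add: o_def)
    qed
    show "Ck_on n U (\<lambda>p. ?D p v)" for v
    proof (intro Ck_on_sum Ck_on_mult \<open>open U\<close>)
      fix i :: 'b assume i: "i \<in> Basis"
      show "Ck_on n U (\<lambda>p. ?h' p i v)" using Suc.prems(2)[OF i] by simp
      show "Ck_on n U (\<lambda>p. frechet_derivative k (at (h p)) i)"
      proof (rule Suc.IH)
        show "Ck_on n V (\<lambda>q. frechet_derivative k (at q) i)" using Suc.prems(1) by simp
        show "Ck_on n U (\<lambda>p. h p \<bullet> j)" if "j \<in> Basis" for j
          using Suc.prems(2)[OF that] by (rule Ck_on_SucD)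
      qed
    qed
  qed
qed

text \<open>The form in which smoothness is obtained for functions known through a differential equation:
  a derivative that is as regular as the function itself yields one more order at a time.\<close>
lemma smooth_onI_bootstrap:
  assumes "open U" "continuous_on U h"
    and "\<And>p. p \<in> U \<Longrightarrow> (h has_derivative D p) (at p)"
    and "\<And>k v. Ck_on k U h \<Longrightarrow> Ck_on k U (\<lambda>p. D p v)"
  shows "smooth_on U h"
  unfolding smooth_on_def
proof
  show "Ck_on k U h" for k
  proof (induction k)
    case 0
    then show ?case using assms(2) by simp
  next
    case (Suc k)
    then show ?case by (intro Ck_on_SucI[OF assms(1,3)] assms(4))
  qed
qed

named_theorems smooth_intros

lemma smooth_on_const [smooth_intros]: "smooth_on U (\<lambda>_. c)"
  by (simp add: smooth_on_def Ck_on_const)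

lemma smooth_on_add [smooth_intros]:
  "open U \<Longrightarrow> smooth_on U h \<Longrightarrow> smooth_on U k \<Longrightarrow> smooth_on U (\<lambda>p. h p + k p)"
  by (simp add: smooth_on_def Ck_on_add)

lemma smooth_on_mult [smooth_intros]:
  fixes h k :: "'a::real_normed_vector \<Rightarrow> real"
  shows "open U \<Longrightarrow> smooth_on U h \<Longrightarrow> smooth_on U k \<Longrightarrow> smooth_on U (\<lambda>p. h p * k p)"
  by (simp add: smooth_on_def Ck_on_mult)

lemma smooth_on_minus [smooth_intros]:
  fixes h :: "'a::real_normed_vector \<Rightarrow> real"
  assumes "open U" "smooth_on U h"
  shows "smooth_on U (\<lambda>p. - h p)"
  using smooth_on_mult[OF assms(1) smooth_on_const assms(2), of "-1"] by simp

lemma smooth_on_diff [smooth_intros]: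
  fixes h k :: "'a::real_normed_vector \<Rightarrow> real"
  assumes "open U" "smooth_on U h" "smooth_on U k"
  shows "smooth_on U (\<lambda>p. h p - k p)"
  using smooth_on_add[OF assms(1,2) smooth_on_minus[OF assms(1,3)]] by simp

lemma smooth_on_power [smooth_intros]:
  fixes h :: "'a::real_normed_vector \<Rightarrow> real"
  assumes "open U" "smooth_on U h"
  shows "smooth_on U (\<lambda>p. h p ^ n)"
  by (induction n) (auto intro: smooth_on_const smooth_on_mult assms)

lemma smooth_on_subset: "smooth_on U h \<Longrightarrow> V \<subseteq> U \<Longrightarrow> smooth_on V h"
  by (auto simp: smooth_on_def intro: Ck_on_subset)

lemma smooth_on_cong:
  "open U \<Longrightarrow> smooth_on U h \<Longrightarrow> (\<And>q. q \<in> U \<Longrightarrow> h q = k q) \<Longrightarrow> smooth_on U k"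
  unfolding smooth_on_def using Ck_on_cong by blast

lemma smooth_on_imp_continuous_on: "smooth_on U h \<Longrightarrow> continuous_on U h"
  using Ck_on.simps(1) unfolding smooth_on_def by blast

lemma smooth_on_imp_differentiable: "smooth_on U h \<Longrightarrow> p \<in> U \<Longrightarrow> h differentiable (at p)"
  using Ck_on.simps(2) unfolding smooth_on_def by blast

lemma smooth_on_has_derivative:
  "smooth_on U h \<Longrightarrow> p \<in> U \<Longrightarrow> (h has_derivative frechet_derivative h (at p)) (at p)"
  using smooth_on_imp_differentiable frechet_derivative_works by blast

lemma smooth_on_frechet_derivative:
  "smooth_on U h \<Longrightarrow> smooth_on U (\<lambda>p. frechet_derivative h (at p) v)"
  using Ck_on.simps(2) unfolding smooth_on_def by blast

lemma smooth_on_compose_real: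
  fixes h :: "'a::real_normed_vector \<Rightarrow> real" and k :: "real \<Rightarrow> real"
  assumes "open U" "open V" "smooth_on V k" "h ` U \<subseteq> V" "smooth_on U h"
  shows "smooth_on U (\<lambda>p. k (h p))"
  using assms by (auto simp: smooth_on_def intro: Ck_on_compose)

lemma smooth_on_compose_pair:
  fixes h1 h2 :: "'a::real_normed_vector \<Rightarrow> real" and k :: "real \<times> real \<Rightarrow> real"
  assumes "open U" "open V" "smooth_on V k" "\<And>p. p \<in> U \<Longrightarrow> (h1 p, h2 p) \<in> V"
    and "smooth_on U h1" "smooth_on U h2"
  shows "smooth_on U (\<lambda>p. k (h1 p, h2 p))"
  using assms Ck_on_compose[OF assms(1,2), of "\<lambda>p. (h1 p, h2 p)"]
  by (force simp: smooth_on_def Basis_prod_def)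

lemma smooth_on_bounded_linear: "open U \<Longrightarrow> bounded_linear L \<Longrightarrow> smooth_on U L"
  by (simp add: smooth_on_def Ck_on_bounded_linear)

lemma smooth_on_inverse_real: "smooth_on (- {0::real}) inverse"
proof (rule smooth_onI_bootstrap)
  show "open (- {0::real})" by auto
  show "continuous_on (- {0::real}) inverse" by (auto intro: continuous_intros)
  show "(inverse has_derivative (\<lambda>v. - (inverse x * v * inverse x))) (at x)"
    if "x \<in> - {0}" for x :: real
    using that has_derivative_inverse'[of x] by auto
  show "Ck_on k (- {0}) (\<lambda>x::real. - (inverse x * v * inverse x))"
    if "Ck_on k (- {0}) (inverse :: real \<Rightarrow> real)" for k v
  proof -
    have "Ck_on k (- {0}) (\<lambda>x::real. - v * (inverse x * inverse x))"
      by (intro Ck_on_mult Ck_on_const that) auto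
    then show ?thesis by (simp add: mult_ac)
  qed
qed

lemma smooth_on_inverse [smooth_intros]:
  fixes h :: "'a::real_normed_vector \<Rightarrow> real"
  assumes "open U" "smooth_on U h" "\<And>p. p \<in> U \<Longrightarrow> h p \<noteq> 0"
  shows "smooth_on U (\<lambda>p. inverse (h p))"
  using assms by (intro smooth_on_compose_real[OF _ _ smooth_on_inverse_real]) auto

lemma smooth_on_divide [smooth_intros]:
  fixes h k :: "'a::real_normed_vector \<Rightarrow> real"
  assumes "open U" "smooth_on U h" "smooth_on U k" "\<And>p. p \<in> U \<Longrightarrow> k p \<noteq> 0"
  shows "smooth_on U (\<lambda>p. h p / k p)"
  unfolding divide_inverse using assms by (intro smooth_intros)

lemma has_derivative_ln_abs:
  fixes h :: "'a::real_normed_vector \<Rightarrow> real"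
  assumes "(h has_derivative D) (at p)" "h p \<noteq> 0"
  shows "((\<lambda>q. ln \<bar>h q\<bar>) has_derivative (\<lambda>v. D v / h p)) (at p)"
proof -
  have "((\<lambda>x. ln \<bar>x\<bar>) has_real_derivative 1 / h p) (at (h p))"
  proof -
    \<comment> \<open>The function \<open>ln (x\<^sup>2) / 2\<close> equals \<open>ln \<bar>x\<bar>\<close> and avoids a case split on the sign.\<close>
    have "((\<lambda>x. ln (x\<^sup>2) / 2) has_real_derivative 1 / h p) (at (h p))"
      using assms(2) by (auto intro!: derivative_eq_intros simp: power2_eq_square)
        (metis not_real_square_gt_zero)
    moreover have "ln (x\<^sup>2) / 2 = ln \<bar>x\<bar>" for x :: real
      using ln_realpow[of "\<bar>x\<bar>" 2] by (cases "x = 0") auto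
    ultimately show ?thesis by simp
  qed
  then have "((\<lambda>x. ln \<bar>x\<bar>) has_derivative (\<lambda>v. 1 / h p * v)) (at (h p))"
    unfolding has_field_derivative_def .
  from has_derivative_compose[OF assms(1) this] show ?thesis by simp
qed

lemma smooth_on_ln_abs [smooth_intros]:
  fixes h :: "'a::real_normed_vector \<Rightarrow> real"
  assumes "open U" "smooth_on U h" "\<And>p. p \<in> U \<Longrightarrow> h p \<noteq> 0"
  shows "smooth_on U (\<lambda>p. ln \<bar>h p\<bar>)"
proof (rule smooth_onI_bootstrap[OF \<open>open U\<close>])
  show "continuous_on U (\<lambda>p. ln \<bar>h p\<bar>)"
    using assms smooth_on_imp_continuous_on by (auto intro!: continuous_intros)
  show "((\<lambda>p. ln \<bar>h p\<bar>) has_derivative (\<lambda>v. frechet_derivative h (at p) v / h p)) (at p)"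
    if "p \<in> U" for p
    using that assms by (intro has_derivative_ln_abs smooth_on_has_derivative)
  show "Ck_on k U (\<lambda>p. frechet_derivative h (at p) v / h p)" for k v
    using smooth_on_divide[OF assms(1) smooth_on_frechet_derivative[OF assms(2)] assms(2,3)]
    by (simp add: smooth_on_def)
qed

subsection \<open>Functions of one real variable\<close>

lemma deriv_eq_frechet:
  fixes w :: "real \<Rightarrow> real"
  assumes "w differentiable (at t)"
  shows "deriv w t = frechet_derivative w (at t) 1"
proof -
  have "(w has_derivative (\<lambda>v. deriv w t * v)) (at t)"
    using assms DERIV_deriv_iff_real_differentiable has_field_derivative_def by blast
  then show ?thesis by (simp add: has_derivative_imp_frechet)
qed

lemma smooth_on_has_deriv:
  fixes w :: "real \<Rightarrow> real"
  assumes "smooth_on J w" "t \<in> J"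
  shows "(w has_real_derivative deriv w t) (at t)"
  using assms smooth_on_imp_differentiable DERIV_deriv_iff_real_differentiable by blast

lemma smooth_on_deriv [smooth_intros]:
  fixes w :: "real \<Rightarrow> real"
  assumes "open J" "smooth_on J w"
  shows "smooth_on J (deriv w)"
  using smooth_on_cong[OF assms(1) smooth_on_frechet_derivative[OF assms(2), of 1]]
    deriv_eq_frechet smooth_on_imp_differentiable[OF assms(2)] by force

lemma Ck_on_Suc_deriv:
  fixes w :: "real \<Rightarrow> real"
  assumes "open J" "\<And>t. t \<in> J \<Longrightarrow> (w has_real_derivative w' t) (at t)" "Ck_on k J w'"
  shows "Ck_on (Suc k) J w"
proof (rule Ck_on_SucI[OF assms(1)])
  show "(w has_derivative (\<lambda>v. v * w' t)) (at t)" if "t \<in> J" for t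
    using assms(2)[OF that] by (simp add: has_field_derivative_def mult_commute_abs)
  show "Ck_on k J (\<lambda>p. v * w' p)" for v
    using assms by (intro Ck_on_mult Ck_on_const) auto
qed

lemma smooth_onI_deriv:
  fixes w :: "real \<Rightarrow> real"
  assumes "open J" "\<And>t. t \<in> J \<Longrightarrow> (w has_real_derivative w' t) (at t)"
    and "\<And>k. Ck_on k J w \<Longrightarrow> Ck_on k J w'"
  shows "smooth_on J w"
  unfolding smooth_on_def
proof
  fix k
  show "Ck_on k J w"
  proof (induction k)
    case 0
    then show ?case
      using assms(2) by (auto intro: continuous_at_imp_continuous_on DERIV_isCont)
  next
    case (Suc k)
    then show ?case by (intro Ck_on_Suc_deriv[OF assms(1,2)] assms(3))
  qed
qed

subsection \<open>Partial derivatives in the plane\<close>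

lemma smooth_on_px [smooth_intros]: "smooth_on U h \<Longrightarrow> smooth_on U (px h)"
  unfolding px_def by (rule smooth_on_frechet_derivative)

lemma smooth_on_py [smooth_intros]: "smooth_on U h \<Longrightarrow> smooth_on U (py h)"
  unfolding py_def by (rule smooth_on_frechet_derivative)

lemma has_derivative_px_py:
  assumes "(h has_derivative D) (at p)"
  shows "px h p = D (1, 0)" "py h p = D (0, 1)"
  using has_derivative_imp_frechet[OF assms] by (auto simp: px_def py_def)

lemma smooth_on_has_derivative_px_py:
  assumes "smooth_on U h" "p \<in> U"
  shows "(h has_derivative (\<lambda>v. fst v * px h p + snd v * py h p)) (at p)"
proof -
  let ?D = "frechet_derivative h (at p)"
  have D: "(h has_derivative ?D) (at p)"
    using smooth_on_has_derivative assms by blast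
  interpret bounded_linear ?D using D by (rule has_derivative_bounded_linear)
  have "?D = (\<lambda>v. fst v * px h p + snd v * py h p)"
  proof
    fix v
    have "?D (fst v *\<^sub>R (1, 0) + snd v *\<^sub>R (0, 1)) = fst v * px h p + snd v * py h p"
      unfolding add scaleR px_def py_def by simp
    then show "?D v = fst v * px h p + snd v * py h p" by simp
  qed
  then show ?thesis using D by simp
qed

lemma smooth_on_DERIV_x:
  assumes "smooth_on U h" "(x, y) \<in> U"
  shows "((\<lambda>x. h (x, y)) has_real_derivative px h (x, y)) (at x)"
proof -
  have "((\<lambda>x. (x, y)) has_derivative (\<lambda>v. (v, 0))) (at x)"
    by (auto intro!: derivative_eq_intros)
  from has_derivative_compose[OF this smooth_on_has_derivative_px_py[OF assms]]
  show ?thesis by (simp add: has_field_derivative_def mult_commute_abs)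
qed

lemma smooth_on_DERIV_y:
  assumes "smooth_on U h" "(x, y) \<in> U"
  shows "((\<lambda>y. h (x, y)) has_real_derivative py h (x, y)) (at y)"
proof -
  have "((\<lambda>y. (x, y)) has_derivative (\<lambda>v. (0, v))) (at y)"
    by (auto intro!: derivative_eq_intros)
  from has_derivative_compose[OF this smooth_on_has_derivative_px_py[OF assms]]
  show ?thesis by (simp add: has_field_derivative_def mult_commute_abs)
qed

lemma frechet_derivative_rules:
  fixes h k :: "'a::real_normed_vector \<Rightarrow> real"
  assumes "h differentiable (at p)" "k differentiable (at p)"
  shows "frechet_derivative (\<lambda>q. h q + k q) (at p) v
      = frechet_derivative h (at p) v + frechet_derivative k (at p) v" (is ?add)
    and "frechet_derivative (\<lambda>q. h q - k q) (at p) v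
      = frechet_derivative h (at p) v - frechet_derivative k (at p) v" (is ?diff)
    and "frechet_derivative (\<lambda>q. h q * k q) (at p) v
      = frechet_derivative h (at p) v * k p + h p * frechet_derivative k (at p) v" (is ?mult)
    and "k p \<noteq> 0 \<Longrightarrow> frechet_derivative (\<lambda>q. h q / k q) (at p) v
      = (frechet_derivative h (at p) v * k p - h p * frechet_derivative k (at p) v) / (k p)\<^sup>2"
proof -
  note D = assms[unfolded frechet_derivative_works]
  show ?add by (subst has_derivative_imp_frechet[OF has_derivative_add[OF D]]) simp
  show ?diff by (subst has_derivative_imp_frechet[OF has_derivative_diff[OF D]]) simp
  show ?mult by (subst has_derivative_imp_frechet[OF has_derivative_mult[OF D]]) simp
  show "frechet_derivative (\<lambda>q. h q / k q) (at p) v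
      = (frechet_derivative h (at p) v * k p - h p * frechet_derivative k (at p) v) / (k p)\<^sup>2"
    if "k p \<noteq> 0"
    by (subst has_derivative_imp_frechet[OF has_derivative_divide'[OF D that]])
      (simp add: power2_eq_square)
qed

lemma frechet_derivative_minus:
  fixes h :: "'a::real_normed_vector \<Rightarrow> real"
  assumes "h differentiable (at p)"
  shows "frechet_derivative (\<lambda>q. - h q) (at p) v = - frechet_derivative h (at p) v"
  by (subst has_derivative_imp_frechet[OF has_derivative_minus[OF
          assms[unfolded frechet_derivative_works]]]) simp

lemma frechet_derivative_ln_abs:
  fixes h :: "'a::real_normed_vector \<Rightarrow> real"
  assumes "h differentiable (at p)" "h p \<noteq> 0"
  shows "frechet_derivative (\<lambda>q. ln \<bar>h q\<bar>) (at p) v = frechet_derivative h (at p) v / h p"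
  by (subst has_derivative_imp_frechet[OF has_derivative_ln_abs[OF
          assms(1)[unfolded frechet_derivative_works] assms(2)]]) simp

lemma frechet_derivative_compose_real:
  fixes h :: "'a::real_normed_vector \<Rightarrow> real"
  assumes "h differentiable (at p)" "(w has_real_derivative w') (at (h p))"
  shows "frechet_derivative (\<lambda>q. w (h q)) (at p) v = w' * frechet_derivative h (at p) v"
  by (subst has_derivative_imp_frechet[OF has_derivative_compose[OF
          assms(1)[unfolded frechet_derivative_works] assms(2)[unfolded has_field_derivative_def]]]) simp

lemmas px_rules = frechet_derivative_rules[where v = "(1::real, 0::real)", folded px_def]
  frechet_derivative_minus[where v = "(1::real, 0::real)", folded px_def]
  frechet_derivative_ln_abs[where v = "(1::real, 0::real)", folded px_def]
lemmas py_rules = frechet_derivative_rules[where v = "(0::real, 1::real)", folded py_def]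
  frechet_derivative_minus[where v = "(0::real, 1::real)", folded py_def]
  frechet_derivative_ln_abs[where v = "(0::real, 1::real)", folded py_def]
lemmas px_compose = frechet_derivative_compose_real[where v = "(1::real, 0::real)", folded px_def]
lemmas py_compose = frechet_derivative_compose_real[where v = "(0::real, 1::real)", folded py_def]

lemma px_cong: "open U \<Longrightarrow> p \<in> U \<Longrightarrow> (\<And>q. q \<in> U \<Longrightarrow> h q = k q) \<Longrightarrow> px h p = px k p"
  unfolding px_def using frechet_derivative_cong_open by metis

lemma py_cong: "open U \<Longrightarrow> p \<in> U \<Longrightarrow> (\<And>q. q \<in> U \<Longrightarrow> h q = k q) \<Longrightarrow> py h p = py k p"
  unfolding py_def using frechet_derivative_cong_open by metis

lemma open_contains_square:
  fixes p :: "real \<times> real"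
  assumes "open U" "p \<in> U"
  obtains e where "e > 0"
    "{fst p - e<..<fst p + e} \<times> {snd p - e<..<snd p + e} \<subseteq> U"
proof -
  obtain A B where AB: "open A" "open B" "p \<in> A \<times> B" "A \<times> B \<subseteq> U"
    using assms open_prod_elim by blast
  obtain d1 where d1: "d1 > 0" "ball (fst p) d1 \<subseteq> A"
    using AB openE by (metis mem_Times_iff)
  obtain d2 where d2: "d2 > 0" "ball (snd p) d2 \<subseteq> B"
    using AB openE by (metis mem_Times_iff)
  have "{fst p - min d1 d2<..<fst p + min d1 d2} \<subseteq> ball (fst p) d1"
    "{snd p - min d1 d2<..<snd p + min d1 d2} \<subseteq> ball (snd p) d2"
    by (auto simp: ball_eq_greaterThanLessThan)
  then have "{fst p - min d1 d2<..<fst p + min d1 d2} \<times> {snd p - min d1 d2<..<snd p + min d1 d2} \<subseteq> U"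
    using AB d1 d2 by (meson Sigma_mono order_trans)
  then show ?thesis using that[of "min d1 d2"] d1 d2 by simp
qed

text \<open>The second difference of \<open>h\<close> over a square is, by the mean value theorem in each
  variable, the area times either mixed derivative at some point of the square; shrinking the
  square gives equality.\<close>
lemma px_py_commute:
  assumes "open U" "smooth_on U h" "p \<in> U"
  shows "px (py h) p = py (px h) p"
proof -
  define x y where "x = fst p" and "y = snd p"
  obtain e where e: "e > 0" "{x - e<..<x + e} \<times> {y - e<..<y + e} \<subseteq> U"
    using open_contains_square[OF assms(1,3)] unfolding x_def y_def by metis
  have near: "\<exists>q q'. q \<in> {x..x+t} \<times> {y..y+t} \<and> q' \<in> {x..x+t} \<times> {y..y+t}
      \<and> py (px h) q = px (py h) q'" if t: "0 < t" "t < e" for t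
  proof -
    have inU: "(a, c) \<in> U" if "x \<le> a" "a \<le> x + t" "y \<le> c" "c \<le> y + t" for a c
      using e t that by (auto intro!: subsetD[OF e(2)])
    have sx: "smooth_on U (px h)" and sy: "smooth_on U (py h)"
      using assms(2) by (auto intro: smooth_intros)
    let ?\<Delta> = "h (x+t, y+t) - h (x+t, y) - (h (x, y+t) - h (x, y))"
    have "\<exists>a. a > x \<and> a < x + t \<and> (h (x+t, y+t) - h (x+t, y)) - (h (x, y+t) - h (x, y))
        = (x + t - x) * (px h (a, y+t) - px h (a, y))"
      using t by (intro MVT2) (auto intro!: DERIV_diff smooth_on_DERIV_x[OF assms(2)] inU)
    then obtain a where a: "x < a" "a < x + t" "?\<Delta> = t * (px h (a, y+t) - px h (a, y))" by auto
    have "\<exists>c. c > y \<and> c < y + t \<and> px h (a, y+t) - px h (a, y) = (y + t - y) * py (px h) (a, c)"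
      using t a by (intro MVT2) (auto intro!: smooth_on_DERIV_y[OF sx] inU)
    then obtain c where c: "y < c" "c < y + t" "px h (a, y+t) - px h (a, y) = t * py (px h) (a, c)"
      by auto
    have "\<exists>c. c > y \<and> c < y + t \<and> (h (x+t, y+t) - h (x, y+t)) - (h (x+t, y) - h (x, y))
        = (y + t - y) * (py h (x+t, c) - py h (x, c))"
      using t by (intro MVT2) (auto intro!: DERIV_diff smooth_on_DERIV_y[OF assms(2)] inU)
    then obtain c' where c': "y < c'" "c' < y + t" "?\<Delta> = t * (py h (x+t, c') - py h (x, c'))"
      by (auto simp: algebra_simps)
    have "\<exists>a. a > x \<and> a < x + t \<and> py h (x+t, c') - py h (x, c') = (x + t - x) * px (py h) (a, c')"
      using t c' by (intro MVT2) (auto intro!: smooth_on_DERIV_x[OF sy] inU)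
    then obtain a' where a': "x < a'" "a' < x + t"
        "py h (x+t, c') - py h (x, c') = t * px (py h) (a', c')"
      by auto
    have "py (px h) (a, c) = px (py h) (a', c')"
      using a c a' c' t by simp
    moreover have "(a, c) \<in> {x..x+t} \<times> {y..y+t}" "(a', c') \<in> {x..x+t} \<times> {y..y+t}"
      using a c a' c' by auto
    ultimately show ?thesis by blast
  qed
  have "isCont (py (px h)) p" "isCont (px (py h)) p"
    using assms by (auto intro!: continuous_on_interior smooth_on_imp_continuous_on[of U] smooth_intros
        simp: interior_open)
  have "\<bar>px (py h) p - py (px h) p\<bar> \<le> 0 + \<epsilon>" if eps: "\<epsilon> > 0" for \<epsilon>
  proof -
    obtain d where d: "d > 0" "\<And>q. dist q p < d \<Longrightarrow> \<bar>py (px h) q - py (px h) p\<bar> < \<epsilon>/2"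
      using \<open>isCont (py (px h)) p\<close>[unfolded continuous_at_eps_delta, rule_format, OF half_gt_zero[OF eps]]
      unfolding dist_real_def by blast
    obtain d' where d': "d' > 0" "\<And>q. dist q p < d' \<Longrightarrow> \<bar>px (py h) q - px (py h) p\<bar> < \<epsilon>/2"
      using \<open>isCont (px (py h)) p\<close>[unfolded continuous_at_eps_delta, rule_format, OF half_gt_zero[OF eps]]
      unfolding dist_real_def by blast
    define t where "t = min (e/2) (min (d/3) (d'/3))"
    have t: "0 < t" "t < e" "2 * t < d" "2 * t < d'"
      using e d d' by (auto simp: t_def)
    obtain q q' where q: "q \<in> {x..x+t} \<times> {y..y+t}" "q' \<in> {x..x+t} \<times> {y..y+t}"
        "py (px h) q = px (py h) q'"
      using near[OF t(1,2)] by blast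
    have small: "dist r p \<le> 2 * t" if "r \<in> {x..x+t} \<times> {y..y+t}" for r
    proof -
      have "dist r p \<le> \<bar>fst r - x\<bar> + \<bar>snd r - y\<bar>"
        unfolding dist_prod_def x_def y_def dist_real_def
        by (rule order_trans[OF sqrt_sum_squares_le_sum_abs]) simp
      then show ?thesis using that by (auto simp: mem_Times_iff)
    qed
    have "dist q p < d" "dist q' p < d'" using small[of q] small[of q'] q(1,2) t by linarith+
    then show ?thesis using d(2) d'(2) q(3) by (smt (verit) field_sum_of_halves)
  qed
  then have "\<bar>px (py h) p - py (px h) p\<bar> \<le> 0" by (rule field_le_epsilon)
  then show ?thesis by simp
qed

section \<open>The frame of a web in canonical normalization\<close>

locale canonical_web =
  fixes U :: "pt set" and f g :: fn
  assumes open_U: "open U"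
    and smooth_f: "smooth_on U f" and smooth_g: "smooth_on U g"
    and px_f: "\<And>p. p \<in> U \<Longrightarrow> px f p \<noteq> 0" and py_f: "\<And>p. p \<in> U \<Longrightarrow> py f p \<noteq> 0"
    and px_g: "\<And>p. p \<in> U \<Longrightarrow> px g p \<noteq> 0" and py_g: "\<And>p. p \<in> U \<Longrightarrow> py g p \<noteq> 0"
    and b_neq_1: "\<And>p. p \<in> U \<Longrightarrow> bfun f g p \<noteq> 1"
begin

abbreviation "D1 \<equiv> d1 f"
abbreviation "D2 \<equiv> d2 f"
abbreviation "b \<equiv> bfun f g"
abbreviation "H \<equiv> Hfun f"
abbreviation "r \<equiv> rfun f g"

lemma restrict: "open V \<Longrightarrow> V \<subseteq> U \<Longrightarrow> canonical_web V f g"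
  using canonical_web_axioms by (auto simp: canonical_web_def intro: smooth_on_subset)

lemma D1_eq: "D1 h p = - px h p / px f p" and D2_eq: "D2 h p = - py h p / py f p"
  by (auto simp: d1_def d2_def)

lemma px_eq: "p \<in> U \<Longrightarrow> px h p = - px f p * D1 h p"
  and py_eq: "p \<in> U \<Longrightarrow> py h p = - py f p * D2 h p"
  by (auto simp: D1_eq D2_eq px_f py_f)

lemma differentiable: "smooth_on U h \<Longrightarrow> p \<in> U \<Longrightarrow> h differentiable (at p)"
  by (rule smooth_on_imp_differentiable)

lemma smooth_D1: "smooth_on U h \<Longrightarrow> smooth_on U (D1 h)"
  unfolding D1_eq[abs_def]
  by (intro smooth_intros) (auto intro: smooth_f open_U simp: px_f)

lemma smooth_D2: "smooth_on U h \<Longrightarrow> smooth_on U (D2 h)"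
  unfolding D2_eq[abs_def]
  by (intro smooth_intros) (auto intro: smooth_f open_U simp: py_f)

lemma smooth_b: "smooth_on U b"
  unfolding bfun_def[abs_def]
  by (intro smooth_intros) (auto intro: smooth_f smooth_g open_U simp: py_f px_g)

lemma b_nz: "p \<in> U \<Longrightarrow> b p \<noteq> 0"
  by (simp add: bfun_def px_f py_f px_g py_g)

lemma smooth_H: "smooth_on U H"
  unfolding Hfun_def[abs_def]
  by (intro smooth_intros) (auto intro: smooth_f open_U simp: px_f py_f)

lemma smooth_r: "smooth_on U r"
  unfolding rfun_def[abs_def]
  by (intro smooth_intros) (auto intro: smooth_D1 smooth_b smooth_H open_U simp: b_nz)

lemma smooth_Rof: "smooth_on U B \<Longrightarrow> smooth_on U (Rof f g B)"
  unfolding Rof_def[abs_def]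
  by (intro smooth_intros) (auto intro: smooth_D1 smooth_D2 smooth_b smooth_H open_U simp: b_nz)

lemma smooth_B0: "smooth_on U (B0fun f g)"
  unfolding B0fun_def[abs_def]
  by (intro smooth_intros) (auto intro: smooth_D1 smooth_b smooth_H open_U)

lemma smooth_c: "smooth_on U (cfun f g)"
  unfolding cfun_def[abs_def]
  by (intro smooth_intros) (auto intro: smooth_b open_U simp: b_nz)

lemma smooth_e: "smooth_on U (efun f g)"
  unfolding efun_def[abs_def]
  by (intro smooth_intros) (auto intro: smooth_D1 smooth_b smooth_H open_U simp: b_nz)

lemmas smooth = smooth_D1 smooth_D2 smooth_b smooth_H smooth_r smooth_Rof smooth_B0 smooth_c smooth_e
  smooth_f smooth_g open_U

lemma smooth_T: "smooth_on U (T3 f g)" "smooth_on U (T2 f g)" "smooth_on U (T1 f g)"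
  "smooth_on U (T0 f g)"
  unfolding T3_def[abs_def] T2_def[abs_def] T1_def[abs_def] T0_def[abs_def]
  by (intro smooth_intros smooth)+

lemma T3_nz: "p \<in> U \<Longrightarrow> T3 f g p \<noteq> 0"
  by (simp add: T3_def cfun_def b_nz b_neq_1)

lemma D1_cong: "p \<in> U \<Longrightarrow> (\<And>q. q \<in> U \<Longrightarrow> h q = k q) \<Longrightarrow> D1 h p = D1 k p"
  and D2_cong: "p \<in> U \<Longrightarrow> (\<And>q. q \<in> U \<Longrightarrow> h q = k q) \<Longrightarrow> D2 h p = D2 k p"
  using px_cong[OF open_U, of p h k] py_cong[OF open_U, of p h k] by (auto simp: D1_eq D2_eq)

lemma D1_const: "D1 (\<lambda>_. c) p = 0" and D2_const: "D2 (\<lambda>_. c) p = 0"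
  by (auto simp: D1_eq D2_eq px_def py_def has_derivative_imp_frechet)

context
  fixes h k :: fn and p :: pt
  assumes h: "smooth_on U h" and p: "p \<in> U"
begin

lemma D_minus: "D1 (\<lambda>q. - h q) p = - D1 h p" "D2 (\<lambda>q. - h q) p = - D2 h p"
  using differentiable[OF h p] by (auto simp: D1_eq D2_eq px_rules py_rules)

lemma D_ln_abs: "h p \<noteq> 0 \<Longrightarrow> D1 (\<lambda>q. ln \<bar>h q\<bar>) p = D1 h p / h p"
  "h p \<noteq> 0 \<Longrightarrow> D2 (\<lambda>q. ln \<bar>h q\<bar>) p = D2 h p / h p"
  using differentiable[OF h p] by (auto simp: D1_eq D2_eq px_rules py_rules)

context
  assumes k: "smooth_on U k"
begin

lemma D_add: "D1 (\<lambda>q. h q + k q) p = D1 h p + D1 k p" "D2 (\<lambda>q. h q + k q) p = D2 h p + D2 k p"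
  using differentiable[OF h p] differentiable[OF k p]
  by (auto simp: D1_eq D2_eq px_rules py_rules add_divide_distrib diff_divide_distrib)

lemma D_diff: "D1 (\<lambda>q. h q - k q) p = D1 h p - D1 k p" "D2 (\<lambda>q. h q - k q) p = D2 h p - D2 k p"
  using differentiable[OF h p] differentiable[OF k p]
  by (auto simp: D1_eq D2_eq px_rules py_rules add_divide_distrib diff_divide_distrib)

lemma D_mult: "D1 (\<lambda>q. h q * k q) p = D1 h p * k p + h p * D1 k p"
  "D2 (\<lambda>q. h q * k q) p = D2 h p * k p + h p * D2 k p"
  using differentiable[OF h p] differentiable[OF k p]
  by (auto simp: D1_eq D2_eq px_rules py_rules add_divide_distrib diff_divide_distrib)

lemma D_divide:
  assumes "k p \<noteq> 0"
  shows "D1 (\<lambda>q. h q / k q) p = (D1 h p * k p - h p * D1 k p) / (k p)\<^sup>2"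
    "D2 (\<lambda>q. h q / k q) p = (D2 h p * k p - h p * D2 k p) / (k p)\<^sup>2"
  using differentiable[OF h p] differentiable[OF k p] assms px_f[OF p] py_f[OF p]
  by (auto simp: D1_eq D2_eq px_rules py_rules field_simps)

end
end

lemma D_compose_f:
  assumes "smooth_on J w" "f ` U \<subseteq> J" "p \<in> U"
  shows "D1 (\<lambda>q. w (f q)) p = - deriv w (f p)" "D2 (\<lambda>q. w (f q)) p = - deriv w (f p)"
proof -
  have "(w has_real_derivative deriv w (f p)) (at (f p))"
    using assms by (intro smooth_on_has_deriv[of J]) auto
  with differentiable[OF smooth_f assms(3)]
  show "D1 (\<lambda>q. w (f q)) p = - deriv w (f p)" "D2 (\<lambda>q. w (f q)) p = - deriv w (f p)"
    by (auto simp: D1_eq D2_eq px_compose py_compose px_f py_f assms)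
qed

lemma py_px_f: "p \<in> U \<Longrightarrow> py (px f) p = H p * px f p * py f p"
  and px_py_f: "p \<in> U \<Longrightarrow> px (py f) p = H p * px f p * py f p"
  using px_py_commute[OF open_U smooth_f] by (auto simp: Hfun_def px_f py_f)

text \<open>The fields \<open>\<partial>\<^sub>1, \<partial>\<^sub>2\<close> are rescaled coordinate fields, and \<open>H\<close> measures how the scaling factors
  vary. All integrability conditions below are consequences of this identity.\<close>
lemma commutator:
  assumes "smooth_on U h" "p \<in> U"
  shows "D1 (D2 h) p - D2 (D1 h) p = H p * (D2 h p - D1 h p)"
proof -
  note d = differentiable[OF _ assms(2)]
  have D2: "D2 h = (\<lambda>q. - (py h q / py f q))" and D1: "D1 h = (\<lambda>q. - (px h q / px f q))"
    by (auto simp: D1_eq D2_eq)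
  have s: "px h differentiable at p" "py h differentiable at p" "px f differentiable at p"
    "py f differentiable at p"
    using assms smooth_f by (auto intro!: d smooth_intros)
  have s': "(\<lambda>q. py h q / py f q) differentiable at p" "(\<lambda>q. px h q / px f q) differentiable at p"
    using assms smooth_f open_U by (auto intro!: d smooth_intros simp: px_f py_f)
  have X: "px (D2 h) p = - ((px (py h) p * py f p - py h p * (H p * px f p * py f p)) / (py f p)\<^sup>2)"
    unfolding D2 using s s' assms by (simp add: px_rules px_py_f py_f)
  have Y: "py (D1 h) p = - ((px (py h) p * px f p - px h p * (H p * px f p * py f p)) / (px f p)\<^sup>2)"
    unfolding D1 using s s' assms by (simp add: py_rules py_px_f px_f px_py_commute[OF open_U assms])
  show ?thesis
    unfolding D1_eq[of "D2 h"] D2_eq[of "D1 h"] X Y unfolding D1_eq D2_eq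
    using assms by (simp add: px_f py_f field_simps power2_eq_square)
qed

text \<open>These two identities provide a particular solution \<open>(- log |f\<^sub>x|, - log |f\<^sub>y|)\<close> of the first two
  equations of the Samuelson system.\<close>
lemma D2_ln_px_f: "p \<in> U \<Longrightarrow> D2 (\<lambda>q. ln \<bar>px f q\<bar>) p = - H p"
  using D_ln_abs(2)[OF smooth_on_px[OF smooth_f], of p]
  by (simp add: px_f) (simp add: D2_eq py_px_f px_f py_f)

lemma D1_ln_py_f: "p \<in> U \<Longrightarrow> D1 (\<lambda>q. ln \<bar>py f q\<bar>) p = - H p"
  using D_ln_abs(1)[OF smooth_on_py[OF smooth_f], of p]
  by (simp add: py_f) (simp add: D1_eq px_py_f px_f py_f)

subsection \<open>The invariants\<close>

text \<open>Writing \<open>log |f\<^sub>x/f\<^sub>y|\<close> as a difference and exchanging the order of differentiation in the first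
  term, only the derivatives \<open>\<partial>\<^sub>y log |f\<^sub>x| = H f\<^sub>y\<close> and \<open>\<partial>\<^sub>x log |f\<^sub>y| = H f\<^sub>x\<close> are needed.\<close>
lemma Kfun_eq:
  assumes "p \<in> U"
  shows "Kfun f p = D1 H p - D2 H p"
proof -
  define A C where "A = (\<lambda>q. ln \<bar>px f q\<bar>)" and "C = (\<lambda>q. ln \<bar>py f q\<bar>)"
  have A: "smooth_on U A" and C: "smooth_on U C"
    unfolding A_def C_def by (auto intro!: smooth_intros smooth simp: px_f py_f)
  have "ln \<bar>px f q / py f q\<bar> = A q - C q" if "q \<in> U" for q
    using that by (simp add: A_def C_def ln_div px_f py_f)
  then have "px (\<lambda>q. ln \<bar>px f q / py f q\<bar>) q = px (\<lambda>q. A q - C q) q" if "q \<in> U" for q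
    using that by (intro px_cong[OF open_U])
  moreover have "px (\<lambda>q. A q - C q) q = px A q - px C q" if q: "q \<in> U" for q
    using differentiable[OF A q] differentiable[OF C q] by (simp add: px_rules)
  ultimately have "py (px (\<lambda>q. ln \<bar>px f q / py f q\<bar>)) p = py (\<lambda>q. px A q - px C q) p"
    using assms by (intro py_cong[OF open_U]) simp_all
  also have "\<dots> = py (px A) p - py (px C) p"
    using differentiable[OF smooth_on_px[OF A] assms] differentiable[OF smooth_on_px[OF C] assms]
    by (simp add: py_rules)
  also have "py (px A) p = px (py A) p"
    using px_py_commute[OF open_U A assms] by simp
  also have "px (py A) p = px (\<lambda>q. py f q * H q) p"
    by (intro px_cong[OF open_U assms]) (simp add: py_eq[of _ A] D2_ln_px_f[folded A_def])
  also have "\<dots> = px (py f) p * H p + py f p * px H p"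
    using differentiable[OF smooth_on_py[OF smooth_f] assms] differentiable[OF smooth_H assms]
    by (simp add: px_rules)
  also have "py (px C) p = py (\<lambda>q. px f q * H q) p"
    by (intro py_cong[OF open_U assms]) (simp add: px_eq[of _ C] D1_ln_py_f[folded C_def])
  also have "\<dots> = py (px f) p * H p + px f p * py H p"
    using differentiable[OF smooth_on_px[OF smooth_f] assms] differentiable[OF smooth_H assms]
    by (simp add: py_rules)
  finally show ?thesis
    using assms by (simp add: Kfun_def D1_eq D2_eq px_py_f py_px_f px_f py_f field_simps)
qed

lemma rfun_eq: "p \<in> U \<Longrightarrow> r p = H p - D1 (\<lambda>q. ln \<bar>b q\<bar>) p"
  by (simp add: rfun_def D_ln_abs(1)[OF smooth_b] b_nz)

lemma smooth_ln_b: "smooth_on U (\<lambda>q. ln \<bar>b q\<bar>)"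
  by (intro smooth_intros smooth) (simp add: b_nz)

text \<open>Since \<open>r = H - \<partial>\<^sub>1 log |b|\<close>, the quadratic terms in \<open>H\<close> cancel, and the curvature
  \<open>K = H\<^sub>1 - H\<^sub>2\<close> and the covariant second derivative of \<open>log b\<close> are left.\<close>
lemma integ2_eq:
  assumes "p \<in> U"
  shows "integ2 f g p = - (Kfun f p + dd_log_b f g p)"
proof -
  have "D2 r p = D2 (\<lambda>q. H q - D1 (\<lambda>q. ln \<bar>b q\<bar>) q) p"
    by (intro D2_cong assms rfun_eq)
  also have "\<dots> = D2 H p - D2 (D1 (\<lambda>q. ln \<bar>b q\<bar>)) p"
    by (intro D_diff smooth smooth_ln_b assms)
  finally show ?thesis
    using assms
    by (simp add: integ2_def Kfun_eq dd_log_b_def rfun_eq algebra_simps power2_eq_square)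
qed

lemma Bfun_eq: "Bfun f g w p = B0fun f g p + (b p - 1) * deriv w (f p)"
  by (simp add: Bfun_def B0fun_def)

context
  fixes w :: "real \<Rightarrow> real" and J :: "real set"
  assumes open_J: "open J" and f_J: "f ` U \<subseteq> J" and smooth_w: "smooth_on J w"
begin

lemma smooth_w_f: "smooth_on U (\<lambda>q. w (f q))"
  using open_J f_J smooth_w smooth_f open_U by (auto intro: smooth_on_compose_real)

lemma smooth_deriv_w_f: "smooth_on U (\<lambda>q. deriv w (f q))"
  using open_J f_J smooth_w smooth_f open_U
  by (auto intro: smooth_on_compose_real smooth_on_deriv)

lemma smooth_deriv2_w_f: "smooth_on U (\<lambda>q. deriv (deriv w) (f q))"
  using open_J f_J smooth_w smooth_f open_U
  by (auto intro: smooth_on_compose_real smooth_on_deriv)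

lemma D_w_f:
  assumes "p \<in> U"
  shows "D1 (\<lambda>q. w (f q)) p = - deriv w (f p)" "D2 (\<lambda>q. w (f q)) p = - deriv w (f p)"
    "D1 (\<lambda>q. deriv w (f q)) p = - deriv (deriv w) (f p)"
    "D2 (\<lambda>q. deriv w (f q)) p = - deriv (deriv w) (f p)"
    "D1 (\<lambda>q. deriv (deriv w) (f q)) p = - deriv (deriv (deriv w)) (f p)"
    "D2 (\<lambda>q. deriv (deriv w) (f q)) p = - deriv (deriv (deriv w)) (f p)"
  using open_J f_J smooth_w assms by (auto intro!: D_compose_f smooth_on_deriv)

lemma smooth_Bfun: "smooth_on U (Bfun f g w)"
  unfolding Bfun_eq[abs_def] using smooth_deriv_w_f by (intro smooth_intros smooth)

lemma D_b1_w: "p \<in> U \<Longrightarrow> D1 (\<lambda>q. (b q - 1) * deriv w (f q)) p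
    = D1 b p * deriv w (f p) - (b p - 1) * deriv (deriv w) (f p)"
  using smooth_deriv_w_f
  by (subst D_mult) (auto intro!: smooth_intros smooth simp: D_diff smooth_on_const smooth D1_const D_w_f)

lemma Rof_Bfun:
  assumes "p \<in> U"
  shows "Rof f g (Bfun f g w) p = Rof f g (B0fun f g) p
    + efun f g p * deriv w (f p) - cfun f g p * deriv (deriv w) (f p)"
proof -
  have "D1 (Bfun f g w) p = D1 (B0fun f g) p + D1 (\<lambda>q. (b q - 1) * deriv w (f q)) p"
    unfolding Bfun_eq[abs_def] using smooth_deriv_w_f assms
    by (intro D_add smooth_intros smooth)
  then have D1B: "D1 (Bfun f g w) p = D1 (B0fun f g) p
      + (D1 b p * deriv w (f p) - (b p - 1) * deriv (deriv w) (f p))"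
    unfolding D_b1_w[OF assms] .
  then show ?thesis
    unfolding Rof_def D1B Bfun_eq efun_def cfun_def
    using b_nz[OF assms] by (simp add: field_simps)
qed

text \<open>Both frame fields turn \<open>w\<^sup>(\<^sup>k\<^sup>) \<circ> f\<close> into \<open>- w\<^sup>(\<^sup>k\<^sup>+\<^sup>1\<^sup>) \<circ> f\<close>, so \<open>B\<close>, \<open>R\<close> and finally the first
  integrability condition contain \<open>w\<close> only through its first, second and third derivatives.\<close>
lemma integ1_Bfun:
  assumes "p \<in> U"
  shows "integ1 f g (Rof f g (Bfun f g w)) p =
    T3 f g p * deriv (deriv (deriv w)) (f p) + T2 f g p * deriv (deriv w) (f p)
    + T1 f g p * deriv w (f p) + T0 f g p"
proof -
  define w1 w2 where "w1 = (\<lambda>q. deriv w (f q))" and "w2 = (\<lambda>q. deriv (deriv w) (f q))"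
  have s: "smooth_on U w1" "smooth_on U w2"
    using smooth_deriv_w_f smooth_deriv2_w_f by (auto simp: w1_def w2_def)
  have d: "D2 w1 p = - w2 p" "D2 w2 p = - deriv (deriv (deriv w)) (f p)"
    using D_w_f[OF assms] by (auto simp: w1_def w2_def)
  have "D2 (Rof f g (Bfun f g w)) p
      = D2 (\<lambda>q. Rof f g (B0fun f g) q + efun f g q * w1 q - cfun f g q * w2 q) p"
    using assms by (intro D2_cong) (auto simp: Rof_Bfun w1_def w2_def)
  also have "\<dots> = D2 (Rof f g (B0fun f g)) p + (D2 (efun f g) p * w1 p + efun f g p * D2 w1 p)
      - (D2 (cfun f g) p * w2 p + cfun f g p * D2 w2 p)"
    using assms by (simp add: D_diff D_add D_mult smooth s smooth_intros)
  finally show ?thesis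
    unfolding integ1_def Rof_Bfun[OF assms] d T3_def T2_def T1_def T0_def
    by (simp add: w1_def w2_def algebra_simps)
qed

end

subsection \<open>Prolongation of the Samuelson system\<close>

text \<open>The system prescribes neither derivative of \<open>u = \<partial>\<^sub>1 s\<^sub>1\<close>. The commutation rule for \<open>s\<^sub>1\<close> gives
  \<open>\<partial>\<^sub>2 u\<close>; the one for \<open>s\<^sub>2\<close>, with \<open>\<partial>\<^sub>2 s\<^sub>2\<close> replaced by means of the third equation, gives
  \<open>\<partial>\<^sub>1 u\<close>.\<close>
lemma prolongation_homogeneous:
  assumes "smooth_on U s1" "smooth_on U s2" "smooth_on U \<beta>"
    and "\<And>q. q \<in> U \<Longrightarrow> D2 s1 q = 0" "\<And>q. q \<in> U \<Longrightarrow> D1 s2 q = 0"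
    and "\<And>q. q \<in> U \<Longrightarrow> b q * D1 s1 q + D2 s2 q = \<beta> q"
    and p: "p \<in> U"
  shows "D2 (D1 s1) p = H p * D1 s1 p"
    and "D1 (D1 s1) p = r p * D1 s1 p + (D1 \<beta> p - H p * \<beta> p) / b p"
proof -
  have "D1 (D2 s1) p = 0"
    using D1_cong[OF p, of "D2 s1" "\<lambda>_. 0"] assms by (simp add: D1_const)
  then show "D2 (D1 s1) p = H p * D1 s1 p"
    using commutator[OF assms(1) p] assms(4)[OF p] by simp
  have s: "smooth_on U (D1 s1)" "smooth_on U (\<lambda>q. b q * D1 s1 q)"
    using assms by (auto intro!: smooth_intros smooth)
  have "D1 (D2 s2) p = D1 (\<lambda>q. \<beta> q - b q * D1 s1 q) p"
    using assms(6) by (intro D1_cong p) (simp add: algebra_simps)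
  also have "\<dots> = D1 \<beta> p - (D1 b p * D1 s1 p + b p * D1 (D1 s1) p)"
    using p by (simp add: D_diff D_mult smooth assms s)
  finally have "D1 (D2 s2) p = D1 \<beta> p - (D1 b p * D1 s1 p + b p * D1 (D1 s1) p)" .
  moreover have "D2 (D1 s2) p = 0"
    using D2_cong[OF p, of "D1 s2" "\<lambda>_. 0"] assms by (simp add: D2_const)
  moreover have "D2 s2 p = \<beta> p - b p * D1 s1 p"
    using assms(6)[OF p] by simp
  ultimately have "D1 \<beta> p - (D1 b p * D1 s1 p + b p * D1 (D1 s1) p)
      = H p * (\<beta> p - b p * D1 s1 p)"
    using commutator[OF assms(2) p] assms(5)[OF p] by simp
  then have "b p * D1 (D1 s1) p = D1 \<beta> p - D1 b p * D1 s1 p - H p * (\<beta> p - b p * D1 s1 p)"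
    by (simp add: algebra_simps)
  then have D11: "D1 (D1 s1) p = (D1 \<beta> p - D1 b p * D1 s1 p - H p * (\<beta> p - b p * D1 s1 p)) / b p"
    using b_nz[OF p] by (simp add: nonzero_eq_divide_eq mult.commute)
  show "D1 (D1 s1) p = r p * D1 s1 p + (D1 \<beta> p - H p * \<beta> p) / b p"
    unfolding D11 rfun_def using b_nz[OF p] by (simp add: field_simps)
qed

text \<open>Functions \<open>s\<^sub>1, s\<^sub>2\<close> that solve only the first two equations violate the third by a defect \<open>Z\<close>,
  and \<open>Y\<close> is the resulting error in the equation \<open>\<partial>\<^sub>1 u = R + r u\<close> for \<open>u = \<partial>\<^sub>1 s\<^sub>1\<close>. In the
  commutation rule for \<open>u\<close> the two integrability conditions cancel every term except those in
  \<open>Y\<close>. The resulting equation for \<open>Y\<close> is what makes a correction of \<open>s\<^sub>1, s\<^sub>2\<close> by functions of \<open>x\<close>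
  and of \<open>y\<close> possible.\<close>
lemma defect_identity:
  assumes "smooth_on U s1" "smooth_on U s2" "smooth_on U B"
    and "\<And>q. q \<in> U \<Longrightarrow> D2 s1 q = H q" "\<And>q. q \<in> U \<Longrightarrow> D1 s2 q = H q"
    and Z: "Z = (\<lambda>q. B q - b q * D1 s1 q - D2 s2 q)"
    and Y: "Y = (\<lambda>q. (H q * Z q - D1 Z q) / b q)"
    and int: "\<And>q. q \<in> U \<Longrightarrow> integ1 f g (Rof f g B) q = 0" "\<And>q. q \<in> U \<Longrightarrow> integ2 f g q = 0"
    and p: "p \<in> U"
  shows "D2 Y p = 2 * H p * Y p"
proof -
  define u R where "u = D1 s1" and "R = Rof f g B"
  have s: "smooth_on U u" "smooth_on U Z" "smooth_on U Y" "smooth_on U R"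
    unfolding u_def Y Z R_def using assms(1-3)
    by (auto intro!: smooth_intros smooth simp: b_nz)
  have u2: "D2 u q = D1 H q - (H q)\<^sup>2 + H q * u q" if q: "q \<in> U" for q
  proof -
    have "D1 (D2 s1) q = D1 H q" using D1_cong[OF q] assms(4) by blast
    then show ?thesis
      using commutator[OF assms(1) q] assms(4)[OF q]
      by (simp add: u_def algebra_simps power2_eq_square)
  qed
  have u1: "D1 u q = R q + r q * u q + Y q" if q: "q \<in> U" for q
  proof -
    have "D2 (D1 s2) q = D2 H q" using D2_cong[OF q] assms(5) by blast
    moreover have "D1 (D2 s2) q = D1 (\<lambda>q. B q - b q * u q - Z q) q"
      by (intro D1_cong q) (simp add: Z u_def)
    moreover have "\<dots> = D1 B q - (D1 b q * u q + b q * D1 u q) - D1 Z q"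
      using q by (simp add: D_diff D_mult smooth smooth_intros assms(3) s)
    moreover have "D2 s2 q = B q - b q * u q - Z q" by (simp add: Z u_def)
    ultimately have "D1 B q - (D1 b q * u q + b q * D1 u q) - D1 Z q - D2 H q
        = H q * (B q - b q * u q - Z q - H q)"
      using commutator[OF assms(2) q] assms(5)[OF q] by simp
    then have "b q * D1 u q = D1 B q - D1 b q * u q - D1 Z q - D2 H q
        - H q * (B q - b q * u q - Z q - H q)"
      by (simp add: algebra_simps)
    then have D1u: "D1 u q = (D1 B q - D1 b q * u q - D1 Z q - D2 H q
        - H q * (B q - b q * u q - Z q - H q)) / b q"
      using b_nz[OF q] by (simp add: nonzero_eq_divide_eq mult.commute)
    show ?thesis
      unfolding D1u rfun_def R_def Rof_def Y
      using b_nz[OF q] by (simp add: field_simps power2_eq_square)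
  qed
  have "D1 (D2 u) p = D1 (\<lambda>q. D1 H q - H q ^ 2 + H q * u q) p"
    using u2 by (intro D1_cong p)
  also have "\<dots> = D1 (D1 H) p - (D1 H p * H p + H p * D1 H p) + (D1 H p * u p + H p * D1 u p)"
    using p by (simp add: power2_eq_square D_diff D_add D_mult smooth smooth_intros s)
  finally have L: "D1 (D2 u) p
      = D1 (D1 H) p - 2 * H p * D1 H p + D1 H p * u p + H p * D1 u p" by simp
  have "D2 (D1 u) p = D2 (\<lambda>q. R q + r q * u q + Y q) p"
    using u1 by (intro D2_cong p)
  also have "\<dots> = D2 R p + (D2 r p * u p + r p * D2 u p) + D2 Y p"
    using p by (simp add: D_add D_mult smooth smooth_intros s)
  finally have E: "D1 (D1 H) p - 2 * H p * D1 H p + D1 H p * u p + H p * (R p + r p * u p + Y p)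
      - (D2 R p + (D2 r p * u p + r p * (D1 H p - (H p)\<^sup>2 + H p * u p)) + D2 Y p)
      = H p * (D1 H p - (H p)\<^sup>2 + H p * u p - (R p + r p * u p + Y p))"
    using commutator[OF s(1) p] unfolding L u1[OF p] u2[OF p] by simp
  have I: "D2 R p = - (r p * D1 H p - r p * (H p)\<^sup>2 - D1 (D1 H) p + 3 * H p * D1 H p
      - H p ^ 3 - 2 * H p * R p)"
    using int(1)[OF p] unfolding integ1_def R_def[symmetric] by simp
  have II: "D2 r p = - (H p)\<^sup>2 + D1 H p + r p * H p"
    using int(2)[OF p] unfolding integ2_def by simp
  show ?thesis
    using E unfolding I II by (simp add: algebra_simps power2_eq_square power3_eq_cube)
qed

end

section \<open>Uniqueness for linear systems in the plane\<close>

text \<open>Gronwall's argument along the segment from \<open>p\<close> to \<open>q\<close>: the weight \<open>exp (- M s)\<close> makes \<open>E\<close>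
  nonincreasing, and \<open>E\<close> starts at zero.\<close>
lemma nonneg_zero_of_gradient_bound:
  fixes E :: "'a::real_normed_vector \<Rightarrow> real"
  assumes "convex S" "p \<in> S" "q \<in> S"
    and deriv: "\<And>x. x \<in> S \<Longrightarrow> (E has_derivative E' x) (at x)"
    and bound: "\<And>x v. x \<in> S \<Longrightarrow> \<bar>E' x v\<bar> \<le> C * norm v * E x"
    and "E p = 0" "E q \<ge> 0"
  shows "E q = 0"
proof -
  define M where "M = C * norm (q - p)"
  define \<gamma> where "\<gamma> s = p + s *\<^sub>R (q - p)" for s :: real
  define \<phi> where "\<phi> s = E (\<gamma> s) * exp (- M * s)" for s
  have in_S: "\<gamma> s \<in> S" if "0 \<le> s" "s \<le> 1" for s
    using convexD_alt[OF assms(1-3) that] by (simp add: \<gamma>_def algebra_simps)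
  have "\<exists>y. (\<phi> has_real_derivative y) (at s) \<and> y \<le> 0" if s: "0 \<le> s" "s \<le> 1" for s
  proof -
    have "(\<gamma> has_derivative (\<lambda>t. t *\<^sub>R (q - p))) (at s)"
      unfolding \<gamma>_def[abs_def] by (auto intro!: derivative_eq_intros)
    from has_derivative_compose[OF this deriv[OF in_S[OF s]]]
    have "((\<lambda>s. E (\<gamma> s)) has_derivative (\<lambda>t. E' (\<gamma> s) (t *\<^sub>R (q - p)))) (at s)" .
    moreover have "E' (\<gamma> s) (t *\<^sub>R (q - p)) = E' (\<gamma> s) (q - p) * t" for t
      using linear_cmul[OF has_derivative_linear[OF deriv[OF in_S[OF s]]]] by simp
    ultimately have "((\<lambda>s. E (\<gamma> s)) has_real_derivative E' (\<gamma> s) (q - p)) (at s)"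
      by (simp add: has_field_derivative_def)
    then have D: "(\<phi> has_real_derivative
        E' (\<gamma> s) (q - p) * exp (- M * s) + E (\<gamma> s) * (exp (- M * s) * - M)) (at s)"
      unfolding \<phi>_def[abs_def] by (auto intro!: derivative_eq_intros)
    have eq: "E' (\<gamma> s) (q - p) * exp (- M * s) + E (\<gamma> s) * (exp (- M * s) * - M)
        = (E' (\<gamma> s) (q - p) - M * E (\<gamma> s)) * exp (- M * s)"
      by (simp add: algebra_simps)
    have "E' (\<gamma> s) (q - p) - M * E (\<gamma> s) \<le> 0"
      using bound[OF in_S[OF s], of "q - p"] by (simp add: M_def)
    then have "(E' (\<gamma> s) (q - p) - M * E (\<gamma> s)) * exp (- M * s) \<le> 0"
      by (simp add: mult_nonpos_nonneg)
    then show ?thesis using D[unfolded eq] by (intro exI conjI)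
  qed
  then have "\<phi> 1 \<le> \<phi> 0"
    by (intro DERIV_nonpos_imp_nonincreasing[OF zero_le_one])
  then have "E q * exp (- M) \<le> 0"
    using assms by (simp add: \<phi>_def \<gamma>_def)
  then show ?thesis
    using assms(7) by (simp add: mult_le_0_iff)
qed

lemma nonneg_zero_near_of_gradient_bound:
  fixes E C :: fn
  assumes "open N" "p \<in> N" "smooth_on N E" "\<And>q. q \<in> N \<Longrightarrow> E q \<ge> 0"
    and C: "continuous_on N C"
    and bnd_x: "\<And>q. q \<in> N \<Longrightarrow> \<bar>px E q\<bar> \<le> C q * E q"
    and bnd_y: "\<And>q. q \<in> N \<Longrightarrow> \<bar>py E q\<bar> \<le> C q * E q"
    and "E p = 0"
  obtains \<rho> where "\<rho> > 0" "ball p \<rho> \<subseteq> N" "\<And>q. q \<in> ball p \<rho> \<Longrightarrow> E q = 0"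
proof -
  obtain \<rho> where \<rho>: "\<rho> > 0" "cball p \<rho> \<subseteq> N"
    using assms(1,2) open_contains_cball by blast
  have "compact (C ` cball p \<rho>)"
    using C \<rho> by (intro compact_continuous_image) (auto intro: continuous_on_subset)
  then obtain M where M: "\<And>q. q \<in> cball p \<rho> \<Longrightarrow> \<bar>C q\<bar> \<le> M"
    using compact_imp_bounded bounded_real by (metis (no_types, lifting) image_eqI)
  have "E q = 0" if q: "q \<in> ball p \<rho>" for q
  proof (rule nonneg_zero_of_gradient_bound[of "ball p \<rho>" p q E
        "\<lambda>x v. fst v * px E x + snd v * py E x" "2 * M"])
    have sub: "x \<in> N" "x \<in> cball p \<rho>" if "x \<in> ball p \<rho>" for x
      using that \<rho> by auto
    show "(E has_derivative (\<lambda>v. fst v * px E x + snd v * py E x)) (at x)"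
      if "x \<in> ball p \<rho>" for x
      using sub(1)[OF that] by (rule smooth_on_has_derivative_px_py[OF assms(3)])
    show "\<bar>fst v * px E x + snd v * py E x\<bar> \<le> 2 * M * norm v * E x"
      if x: "x \<in> ball p \<rho>" for x v
    proof -
      have E: "E x \<ge> 0" using assms(4) sub[OF x] by blast
      have CE: "C x * E x \<le> M * E x"
        using M[OF sub(2)[OF x]] E by (intro mult_right_mono) auto
      have "\<bar>fst v * px E x + snd v * py E x\<bar> \<le> \<bar>fst v\<bar> * \<bar>px E x\<bar> + \<bar>snd v\<bar> * \<bar>py E x\<bar>"
        by (metis abs_mult abs_triangle_ineq)
      also have "\<dots> \<le> norm v * (M * E x) + norm v * (M * E x)"
        using bnd_x[OF sub(1)[OF x]] bnd_y[OF sub(1)[OF x]] CE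
          norm_fst_le[of "fst v" "snd v"] norm_snd_le[of "snd v" "fst v"]
        by (intro add_mono mult_mono) auto
      finally show ?thesis by (simp add: mult_ac)
    qed
    show "E q \<ge> 0" using assms(4) sub[OF q] by blast
  qed (use \<rho> q assms in auto)
  moreover have "ball p \<rho> \<subseteq> N" using \<rho> by auto
  ultimately show ?thesis using that \<rho>(1) by blast
qed

text \<open>Apply the preceding lemma to \<open>h\<^sup>2\<close>, whose gradient is bounded by \<open>2 C h\<^sup>2\<close>.\<close>
lemma zero_near_of_gradient_bound:
  assumes "open N" "p \<in> N" "smooth_on N h" "continuous_on N C" "h p = 0"
    and "\<And>q. q \<in> N \<Longrightarrow> \<bar>px h q\<bar> \<le> C q * \<bar>h q\<bar>" "\<And>q. q \<in> N \<Longrightarrow> \<bar>py h q\<bar> \<le> C q * \<bar>h q\<bar>"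
  obtains \<rho> where "\<rho> > 0" "ball p \<rho> \<subseteq> N" "\<And>q. q \<in> ball p \<rho> \<Longrightarrow> h q = 0"
proof -
  define E where "E = (\<lambda>q. h q * h q)"
  have sq: "\<bar>z * h q + h q * z\<bar> \<le> 2 * C q * (h q * h q)" if "\<bar>z\<bar> \<le> C q * \<bar>h q\<bar>" for z q
  proof -
    have "\<bar>z * h q + h q * z\<bar> = 2 * (\<bar>z\<bar> * \<bar>h q\<bar>)" by (simp add: abs_mult)
    also have "\<dots> \<le> 2 * (C q * \<bar>h q\<bar> * \<bar>h q\<bar>)"
      using that by (intro mult_left_mono mult_right_mono) auto
    finally show ?thesis by (simp add: mult.assoc)
  qed
  have d: "h differentiable (at q)" if "q \<in> N" for q
    using assms(3) that by (rule smooth_on_imp_differentiable)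
  show ?thesis
  proof (rule nonneg_zero_near_of_gradient_bound[of N p E "\<lambda>q. 2 * C q"])
    show "smooth_on N E" unfolding E_def by (intro smooth_on_mult assms)
    show "\<bar>px E q\<bar> \<le> 2 * C q * E q" "\<bar>py E q\<bar> \<le> 2 * C q * E q" if "q \<in> N" for q
      using sq[OF assms(6)[OF that]] sq[OF assms(7)[OF that]] d[OF that]
      by (simp_all add: E_def px_rules py_rules)
    show thesis if "\<rho> > 0" "ball p \<rho> \<subseteq> N" "\<And>q. q \<in> ball p \<rho> \<Longrightarrow> E q = 0" for \<rho>
      using \<open>\<And>\<rho>. \<lbrakk>0 < \<rho>; ball p \<rho> \<subseteq> N; \<And>q. q \<in> ball p \<rho> \<Longrightarrow> h q = 0\<rbrakk> \<Longrightarrow> thesis\<close> that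
      by (simp add: E_def)
  qed (use assms in \<open>auto simp: E_def intro!: continuous_intros\<close>)
qed

section \<open>Existence for ordinary differential equations\<close>

text \<open>Picard iteration as a contraction of the space of bounded continuous functions on the line.
  Clamping the argument to a short interval around \<open>t0\<close> makes the integral operator act on
  functions defined everywhere.\<close>
lemma lipschitz_ode_local_solution:
  fixes F :: "real \<Rightarrow> 'a::banach \<Rightarrow> 'a"
  assumes "d > 0" "L > 0"
    and cont: "\<And>y. continuous_on {t0 - d..t0 + d} y \<Longrightarrow> continuous_on {t0 - d..t0 + d} (\<lambda>t. F t (y t))"
    and lip: "\<And>t y z. t \<in> {t0 - d..t0 + d} \<Longrightarrow> norm (F t y - F t z) \<le> L * norm (y - z)"
  obtains \<epsilon> y where "\<epsilon> > 0" "\<epsilon> \<le> d" "y t0 = y0"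
    "\<And>t. t \<in> {t0 - \<epsilon><..<t0 + \<epsilon>} \<Longrightarrow> (y has_vector_derivative F t (y t)) (at t)"
proof -
  \<comment> \<open>On an interval of length \<open>2 \<epsilon>\<close> each of the two integrals in the operator changes by at most
    \<open>2 \<epsilon> L\<close> times the distance, so \<open>\<epsilon> \<le> 1 / (8 L)\<close> yields the contraction constant \<open>1/2\<close>.\<close>
  define \<epsilon> where "\<epsilon> = min d (1 / (8 * L))"
  have \<epsilon>: "\<epsilon> > 0" "\<epsilon> \<le> d" "L * \<epsilon> \<le> 1 / 8"
    using assms(1,2) by (auto simp: \<epsilon>_def min_def field_simps)
  define a b where "a = t0 - \<epsilon>" and "b = t0 + \<epsilon>"
  have ab: "a \<le> b" "t0 \<in> {a..b}" "b - a = 2 * \<epsilon>" "{a..b} \<subseteq> {t0 - d..t0 + d}"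
    using \<epsilon> by (auto simp: a_def b_def)
  define I where "I y s = integral {a..s} (\<lambda>t. F t (y t))" for y s
  have contF: "continuous_on {a..b} (\<lambda>t. F t (y t))" if "continuous_on UNIV y" for y
    using cont[of y] that ab(4) by (metis continuous_on_subset top_greatest)
  have I_deriv: "(I y has_vector_derivative F t (y t)) (at t within {a..b})"
    if "continuous_on UNIV y" "t \<in> {a..b}" for y t
    unfolding I_def[abs_def] using contF that by (intro integral_has_vector_derivative)
  have "\<exists>z :: real \<Rightarrow>\<^sub>C 'a. \<forall>t. z t = y0 + (I y (clamp a b t) - I y t0)" for y :: "real \<Rightarrow>\<^sub>C 'a"
  proof -
    have "continuous_on {a..b} (I y)"
      unfolding continuous_on_eq_continuous_within
      by (intro ballI has_vector_derivative_continuous[OF I_deriv] continuous_on_apply_bcontfun)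
    then have "continuous_on (cbox a b) (\<lambda>t. y0 + (I y t - I y t0))"
      by (auto intro!: continuous_intros)
    from continuous_on_cbox_bcontfunE[OF this] obtain z :: "real \<Rightarrow>\<^sub>C 'a"
      where "\<And>t. z t = y0 + (I y (clamp a b t) - I y t0)" by metis
    then show ?thesis by (intro exI allI)
  qed
  then obtain T :: "(real \<Rightarrow>\<^sub>C 'a) \<Rightarrow> (real \<Rightarrow>\<^sub>C 'a)"
    where T: "\<And>y t. T y t = y0 + (I y (clamp a b t) - I y t0)"
    by metis
  have "dist (T y) (T z) \<le> 1/2 * dist y z" for y z
  proof (rule dist_bound)
    fix t
    have diff: "norm (I y s - I z s) \<le> 1/4 * dist y z" if s: "s \<in> {a..b}" for s
    proof -
      have sub: "{a..s} \<subseteq> {a..b}" using s by auto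
      have c: "continuous_on {a..s} (\<lambda>t. F t (y t))" "continuous_on {a..s} (\<lambda>t. F t (z t))"
        using contF[of y] contF[of z] sub by (auto intro: continuous_on_subset)
      then have "I y s - I z s = integral {a..s} (\<lambda>t. F t (y t) - F t (z t))"
        unfolding I_def by (simp add: integral_diff integrable_continuous_real)
      also have "norm \<dots> \<le> (L * dist y z) * (s - a)"
      proof (rule integral_bound)
        show "norm (F t (y t) - F t (z t)) \<le> L * dist y z" if "t \<in> {a..s}" for t
        proof -
          have "norm (F t (y t) - F t (z t)) \<le> L * norm (y t - z t)"
            using that sub ab by (intro lip) auto
          also have "\<dots> \<le> L * dist y z"
            using dist_bounded[of y t z] \<open>L > 0\<close> by (simp add: dist_norm)
          finally show ?thesis .
        qed
      qed (use s c in \<open>auto intro!: continuous_intros\<close>)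
      also have "\<dots> \<le> (L * dist y z) * (2 * \<epsilon>)"
        using s ab \<open>L > 0\<close> by (intro mult_left_mono) auto
      also have "\<dots> = (L * \<epsilon>) * (2 * dist y z)" by simp
      also have "\<dots> \<le> 1/8 * (2 * dist y z)"
        using \<epsilon> by (intro mult_right_mono) auto
      finally show ?thesis by simp
    qed
    have "T y t - T z t = (I y (clamp a b t) - I z (clamp a b t)) - (I y t0 - I z t0)"
      by (simp add: T)
    then have "dist (T y t) (T z t)
        \<le> norm (I y (clamp a b t) - I z (clamp a b t)) + norm (I y t0 - I z t0)"
      unfolding dist_norm by (metis norm_triangle_ineq4)
    also have "\<dots> \<le> 1/4 * dist y z + 1/4 * dist y z"
      using ab clamp_in_interval[of a b t] by (intro add_mono diff) auto
    finally show "dist (T y t) (T z t) \<le> 1/2 * dist y z" by simp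
  qed
  then obtain y where y: "T y = y"
    using banach_fix_type[of "1/2" T] by auto
  have y_eq: "y t = y0 + (I y t - I y t0)" if "t \<in> {a..b}" for t
    using T[of y t] that unfolding y by simp
  have "(y has_vector_derivative F t (y t)) (at t)" if t: "t \<in> {t0 - \<epsilon><..<t0 + \<epsilon>}" for t
  proof -
    have t': "t \<in> {a<..<b}" using t by (simp add: a_def b_def)
    have "(I y has_vector_derivative F t (y t)) (at t within {a..b})"
      using t' by (intro I_deriv) auto
    then have "(I y has_vector_derivative F t (y t)) (at t within {a<..<b})"
      by (rule has_vector_derivative_within_subset) auto
    then have "(I y has_vector_derivative F t (y t)) (at t)"
      by (simp add: at_within_open[OF t' open_greaterThanLessThan])
    then have "((\<lambda>t. y0 + (I y t - I y t0)) has_vector_derivative F t (y t)) (at t)"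
      by (auto intro!: derivative_eq_intros)
    then show ?thesis
      by (rule has_vector_derivative_transform_within_open[where S = "{a<..<b}"])
        (use t' y_eq in auto)
  qed
  then show ?thesis using that[of \<epsilon> y] \<epsilon> y_eq[of t0] ab by simp
qed

text \<open>The solution is obtained from the equivalent first order system for \<open>(w, w', w'')\<close>; its
  smoothness follows by raising the regularity of the three components simultaneously.\<close>
lemma linear_third_order_ode:
  fixes a0 a1 a2 :: "real \<Rightarrow> real"
  assumes "open J" "t0 \<in> J" and a: "smooth_on J a0" "smooth_on J a1" "smooth_on J a2"
  obtains J' w where "open J'" "t0 \<in> J'" "J' \<subseteq> J" "smooth_on J' w"
    "w t0 = c0" "deriv w t0 = c1" "deriv (deriv w) t0 = c2"
    "\<And>t. t \<in> J' \<Longrightarrow>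
      deriv (deriv (deriv w)) t + a2 t * deriv (deriv w) t + a1 t * deriv w t + a0 t = 0"
proof -
  obtain d where d: "d > 0" "cball t0 d \<subseteq> J"
    using assms(1,2) open_contains_cball by blast
  let ?I = "{t0 - d..t0 + d}"
  have I: "?I \<subseteq> J" using d by (simp add: cball_eq_atLeastAtMost)
  have cont: "continuous_on ?I a0" "continuous_on ?I a1" "continuous_on ?I a2"
    using a I smooth_on_imp_continuous_on continuous_on_subset by blast+
  have "bounded (a1 ` ?I)" "bounded (a2 ` ?I)"
    using cont by (auto intro!: compact_imp_bounded compact_continuous_image)
  then obtain M1 M2 where M: "\<And>t. t \<in> ?I \<Longrightarrow> \<bar>a1 t\<bar> \<le> M1" "\<And>t. t \<in> ?I \<Longrightarrow> \<bar>a2 t\<bar> \<le> M2"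
    unfolding bounded_real by blast
  define F :: "real \<Rightarrow> real \<times> real \<times> real \<Rightarrow> real \<times> real \<times> real" where
    "F t y = (fst (snd y), snd (snd y), - (a2 t * snd (snd y) + a1 t * fst (snd y) + a0 t))" for t y
  have norm3: "norm (x, y, z) \<le> \<bar>x\<bar> + (\<bar>y\<bar> + \<bar>z\<bar>)" for x y z :: real
    using norm_Pair_le[of x "(y, z)"] norm_Pair_le[of y z] by simp
  have lip: "norm (F t y - F t z) \<le> (2 + \<bar>M1\<bar> + \<bar>M2\<bar>) * norm (y - z)" if t: "t \<in> ?I" for t y z
  proof -
    define u where "u = y - z"
    have le: "\<bar>fst (snd u)\<bar> \<le> norm u" "\<bar>snd (snd u)\<bar> \<le> norm u"
      using norm_snd_le[of "snd u" "fst u"] norm_fst_le[of "fst (snd u)" "snd (snd u)"]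
        norm_snd_le[of "snd (snd u)" "fst (snd u)"] by auto
    have "F t y - F t z = (fst (snd u), snd (snd u), - (a2 t * snd (snd u) + a1 t * fst (snd u)))"
      by (simp add: F_def u_def algebra_simps)
    then have "norm (F t y - F t z) \<le> \<bar>fst (snd u)\<bar> + (\<bar>snd (snd u)\<bar>
        + \<bar>- (a2 t * snd (snd u) + a1 t * fst (snd u))\<bar>)"
      using norm3 by metis
    also have "\<bar>- (a2 t * snd (snd u) + a1 t * fst (snd u))\<bar>
        \<le> \<bar>a2 t\<bar> * \<bar>snd (snd u)\<bar> + \<bar>a1 t\<bar> * \<bar>fst (snd u)\<bar>"
      unfolding abs_minus_cancel by (rule order_trans[OF abs_triangle_ineq]) (simp add: abs_mult)
    also have "\<dots> \<le> \<bar>M2\<bar> * norm u + \<bar>M1\<bar> * norm u"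
      using le M[OF t] by (intro add_mono mult_mono) auto
    finally show ?thesis using le by (simp add: u_def algebra_simps)
  qed
  have contF: "continuous_on ?I (\<lambda>t. F t (y t))" if "continuous_on ?I y" for y
    unfolding F_def using cont that by (intro continuous_intros)
  have "0 < 2 + \<bar>M1\<bar> + \<bar>M2\<bar>" by simp
  then obtain \<epsilon> y where \<epsilon>: "\<epsilon> > 0" "\<epsilon> \<le> d" and y0: "y t0 = (c0, c1, c2)"
    and y: "\<And>t. t \<in> {t0 - \<epsilon><..<t0 + \<epsilon>} \<Longrightarrow> (y has_vector_derivative F t (y t)) (at t)"
    using lipschitz_ode_local_solution[OF d(1) _ contF lip, of "(c0, c1, c2)"] by blast
  define J' where "J' = {t0 - \<epsilon><..<t0 + \<epsilon>}"
  define w w1 w2 where "w t = fst (y t)" and "w1 t = fst (snd (y t))" and "w2 t = snd (snd (y t))" for t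
  have J': "open J'" "t0 \<in> J'" "J' \<subseteq> J"
    using \<epsilon> d by (auto simp: J'_def cball_eq_atLeastAtMost)
  have D: "(w has_real_derivative w1 t) (at t)" "(w1 has_real_derivative w2 t) (at t)"
    "(w2 has_real_derivative - (a2 t * w2 t + a1 t * w1 t + a0 t)) (at t)" if "t \<in> J'" for t
  proof -
    have "(y has_derivative (\<lambda>s. s *\<^sub>R F t (y t))) (at t)"
      using y that by (simp add: J'_def has_vector_derivative_def)
    note d1 = has_derivative_fst[OF this] and d2 = has_derivative_snd[OF this]
    show "(w has_real_derivative w1 t) (at t)"
      using d1 by (simp add: w_def[abs_def] w1_def F_def has_field_derivative_def mult_commute_abs)
    show "(w1 has_real_derivative w2 t) (at t)"
      using has_derivative_fst[OF d2]
      by (simp add: w2_def w1_def[abs_def] F_def has_field_derivative_def mult_commute_abs)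
    have "(w2 has_derivative (\<lambda>s. s * - (a2 t * w2 t + a1 t * w1 t + a0 t))) (at t)"
      using has_derivative_snd[OF d2] by (simp add: w2_def[abs_def] w1_def[abs_def] F_def)
    then show "(w2 has_real_derivative - (a2 t * w2 t + a1 t * w1 t + a0 t)) (at t)"
      unfolding has_field_derivative_def by (simp only: mult_commute_abs)
  qed
  have "Ck_on k J' w \<and> Ck_on k J' w1 \<and> Ck_on k J' w2" for k
  proof (induction k)
    case 0
    have "continuous_on J' v" if "\<And>t. t \<in> J' \<Longrightarrow> (v has_real_derivative v' t) (at t)" for v v'
      using that by (meson DERIV_isCont continuous_at_imp_continuous_on)
    from this[OF D(1)] this[OF D(2)] this[OF D(3)] show ?case by simp
  next
    case (Suc k)
    have "Ck_on k J' a0" "Ck_on k J' a1" "Ck_on k J' a2"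
      using a J'(3) smooth_on_subset unfolding smooth_on_def by blast+
    then have "Ck_on k J' (\<lambda>t. - 1 * (a2 t * w2 t + a1 t * w1 t + a0 t))"
      using Suc J' by (intro Ck_on_mult Ck_on_add Ck_on_const) auto
    then have "Ck_on k J' (\<lambda>t. - (a2 t * w2 t + a1 t * w1 t + a0 t))" by simp
    with Suc show ?case by (intro conjI Ck_on_Suc_deriv[OF J'(1) D(1)]
          Ck_on_Suc_deriv[OF J'(1) D(2)] Ck_on_Suc_deriv[OF J'(1) D(3)]) auto
  qed
  then have "smooth_on J' w" by (simp add: smooth_on_def)
  have e1: "deriv w t = w1 t" if "t \<in> J'" for t
    using D(1)[OF that] by (rule DERIV_imp_deriv)
  have e2: "deriv (deriv w) t = w2 t" if t: "t \<in> J'" for t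
  proof -
    have "deriv (deriv w) t = deriv w1 t"
      by (rule deriv_cong_ev) (use e1 t J'(1) in \<open>auto simp: eventually_nhds\<close>)
    then show ?thesis using D(2)[OF t] by (simp add: DERIV_imp_deriv)
  qed
  have e3: "deriv (deriv (deriv w)) t = - (a2 t * w2 t + a1 t * w1 t + a0 t)" if t: "t \<in> J'" for t
  proof -
    have "deriv (deriv (deriv w)) t = deriv w2 t"
      by (rule deriv_cong_ev) (use e2 t J'(1) in \<open>auto simp: eventually_nhds\<close>)
    then show ?thesis using D(3)[OF t] by (simp add: DERIV_imp_deriv)
  qed
  show ?thesis
    by (rule that[OF J' \<open>smooth_on J' w\<close>])
      (use e1 e2 e3 J' y0 in \<open>auto simp: w_def w1_def w2_def\<close>)
qed

lemma smooth_antiderivative: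
  fixes a :: "real \<Rightarrow> real"
  assumes "d > 0" "smooth_on {t0 - 2 * d<..<t0 + 2 * d} a"
  obtains A where "smooth_on {t0 - d<..<t0 + d} A" "A t0 = c"
    "\<And>t. t \<in> {t0 - d<..<t0 + d} \<Longrightarrow> (A has_real_derivative a t) (at t)"
proof -
  have "continuous_on {t0 - d..t0 + d} a"
    by (rule continuous_on_subset[OF smooth_on_imp_continuous_on[OF assms(2)]])
      (use assms(1) in auto)
  then obtain G where G: "\<And>x. x \<in> {t0 - d..t0 + d} \<Longrightarrow>
      (G has_vector_derivative a x) (at x within {t0 - d..t0 + d})"
    using antiderivative_continuous by blast
  have D: "((\<lambda>t. G t + (c - G t0)) has_real_derivative a t) (at t)"
    if t: "t \<in> {t0 - d<..<t0 + d}" for t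
  proof -
    have "(G has_vector_derivative a t) (at t within {t0 - d<..<t0 + d})"
      by (rule has_vector_derivative_within_subset[OF G]) (use t in auto)
    then have "(G has_real_derivative a t) (at t)"
      by (simp add: at_within_open[OF t open_greaterThanLessThan]
          has_real_derivative_iff_has_vector_derivative)
    then show ?thesis by (auto intro!: derivative_eq_intros)
  qed
  have "smooth_on {t0 - d<..<t0 + d} a"
    using assms(1) by (intro smooth_on_subset[OF assms(2)]) auto
  then have "smooth_on {t0 - d<..<t0 + d} (\<lambda>t. G t + (c - G t0))"
    by (intro smooth_onI_deriv[OF _ D]) (auto simp: smooth_on_def)
  then show ?thesis using that D by simp
qed

section \<open>Functions of \<open>f\<close>\<close>

text \<open>By the inverse function theorem \<open>(f, y)\<close> are local coordinates. The condition
  \<open>\<partial>\<^sub>1 k = \<partial>\<^sub>2 k\<close> says that the gradient of \<open>k\<close> is proportional to that of \<open>f\<close>, so in these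
  coordinates \<open>k\<close> does not depend on \<open>y\<close>. The point \<open>(h t, snd p)\<close> is where the level curve
  \<open>f = t\<close> meets the horizontal line through \<open>p\<close>, so \<open>k\<close> is recovered from its values on that
  line. The same \<open>h\<close> serves for all \<open>k\<close>.\<close>
lemma (in canonical_web) level_coordinate:
  assumes p: "p \<in> U"
  obtains J h N where "open J" "f p \<in> J" "smooth_on J h" "h (f p) = fst p"
    "\<And>t. t \<in> J \<Longrightarrow> (h t, snd p) \<in> U \<and> f (h t, snd p) = t"
    "open N" "p \<in> N" "N \<subseteq> U" "f ` N \<subseteq> J"
    "\<And>k q. smooth_on U k \<Longrightarrow> (\<And>q. q \<in> U \<Longrightarrow> D1 k q = D2 k q) \<Longrightarrow> q \<in> N \<Longrightarrow> k q = k (h (f q), snd p)"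
proof -
  define \<Psi> where "\<Psi> q = (f q, snd q)" for q
  define B1 B2 B3 :: "pt \<Rightarrow>\<^sub>L pt" where "B1 = Blinfun (\<lambda>v. (fst v, 0))"
    and "B2 = Blinfun (\<lambda>v. (snd v, 0))" and "B3 = Blinfun (\<lambda>v. (0, snd v))"
  have B: "blinfun_apply B1 v = (fst v, 0)" "blinfun_apply B2 v = (snd v, 0)"
    "blinfun_apply B3 v = (0, snd v)" for v
    unfolding B1_def B2_def B3_def
    by (subst bounded_linear_Blinfun_apply;
        auto intro!: bounded_linear_Pair bounded_linear_fst bounded_linear_snd bounded_linear_zero)+
  define \<Psi>' where "\<Psi>' q = px f q *\<^sub>R B1 + py f q *\<^sub>R B2 + B3" for q
  have \<Psi>'_apply: "blinfun_apply (\<Psi>' q) v = (fst v * px f q + snd v * py f q, snd v)" for q v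
    by (simp add: \<Psi>'_def blinfun.add_left blinfun.scaleR_left B mult.commute)
  \<comment> \<open>Inverse of the matrix with rows \<open>(f\<^sub>x, f\<^sub>y)\<close> and \<open>(0, 1)\<close>.\<close>
  define invf where "invf = (1 / px f p) *\<^sub>R B1 - (py f p / px f p) *\<^sub>R B2 + B3"
  have invf: "invf o\<^sub>L \<Psi>' p = id_blinfun"
    using px_f[OF p]
    by (intro blinfun_eqI) (auto simp: blinfun.add_left blinfun.diff_left invf_def blinfun.scaleR_left B
        \<Psi>'_apply prod_eq_iff field_simps)
  have \<Psi>_deriv: "(\<Psi> has_derivative blinfun_apply (\<Psi>' q)) (at q)" if "q \<in> U" for q
  proof -
    have "(\<Psi> has_derivative (\<lambda>v. (fst v * px f q + snd v * py f q, snd v))) (at q)"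
      unfolding \<Psi>_def[abs_def]
      by (intro has_derivative_Pair smooth_on_has_derivative_px_py[OF smooth_f that] derivative_intros)
    then show ?thesis by (simp add: \<Psi>'_apply[abs_def])
  qed
  have "continuous_on U \<Psi>'"
    unfolding \<Psi>'_def using smooth_f
    by (intro continuous_intros smooth_on_imp_continuous_on smooth_on_px smooth_on_py)
  then obtain U' V G G' where hom: "open U'" "U' \<subseteq> U" "p \<in> U'" "open V" "\<Psi> p \<in> V"
      "homeomorphism U' V \<Psi> G"
    and G: "\<And>z. z \<in> V \<Longrightarrow> (G has_derivative G' z) (at z)"
    using inverse_function_theorem[OF open_U \<Psi>_deriv _ p invf] by metis
  have inv: "G z \<in> U'" "f (G z) = fst z" "snd (G z) = snd z" if "z \<in> V" for z
    using that homeomorphism_apply2[OF hom(6) that] homeomorphism_image2[OF hom(6)]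
    by (auto simp: \<Psi>_def prod_eq_iff)
  have G'_eq: "fst (G' z v) * px f (G z) + snd (G' z v) * py f (G z) = fst v" "snd (G' z v) = snd v"
    if z: "z \<in> V" for z v
  proof -
    have "G z \<in> U" using inv(1)[OF z] hom(2) by blast
    from has_derivative_compose[OF G[OF z] \<Psi>_deriv[OF this]]
    have "((\<lambda>z. z) has_derivative (\<lambda>v. blinfun_apply (\<Psi>' (G z)) (G' z v))) (at z)"
      by (rule has_derivative_transform_within_open[OF _ hom(4) z])
        (simp add: homeomorphism_apply2[OF hom(6)])
    then have "(\<lambda>v. blinfun_apply (\<Psi>' (G z)) (G' z v)) = (\<lambda>v. v)"
      using has_derivative_unique has_derivative_ident by blast
    then have "blinfun_apply (\<Psi>' (G z)) (G' z v) = v" by meson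
    then show "fst (G' z v) * px f (G z) + snd (G' z v) * py f (G z) = fst v" "snd (G' z v) = snd v"
      by (auto simp: \<Psi>'_apply prod_eq_iff)
  qed
  obtain \<epsilon> where \<epsilon>: "\<epsilon> > 0" "{f p - \<epsilon><..<f p + \<epsilon>} \<times> {snd p - \<epsilon><..<snd p + \<epsilon>} \<subseteq> V"
    using open_contains_square[OF hom(4,5)] by (auto simp: \<Psi>_def)
  define J K where "J = {f p - \<epsilon><..<f p + \<epsilon>}" and "K = {snd p - \<epsilon><..<snd p + \<epsilon>}"
  have JK: "open J" "f p \<in> J" "open K" "snd p \<in> K" "convex K" "J \<times> K \<subseteq> V"
    using \<epsilon> by (auto simp: J_def K_def)
  define h where "h t = fst (G (t, snd p))" for t
  have h: "(h t, snd p) = G (t, snd p)" "(h t, snd p) \<in> U" "f (h t, snd p) = t" if "t \<in> J" for t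
  proof -
    have "(t, snd p) \<in> V" using that JK by auto
    note G = inv[OF this]
    show eq: "(h t, snd p) = G (t, snd p)" using G by (simp add: h_def prod_eq_iff)
    show "(h t, snd p) \<in> U" "f (h t, snd p) = t" unfolding eq using G hom(2) by auto
  qed
  have h_deriv: "(h has_real_derivative 1 / px f (h t, snd p)) (at t)" if t: "t \<in> J" for t
  proof -
    have V: "(t, snd p) \<in> V" using t JK by auto
    have "((\<lambda>t. (t, snd p)) has_derivative (\<lambda>s. (s, 0))) (at t)"
      by (auto intro!: derivative_eq_intros)
    from has_derivative_fst[OF has_derivative_compose[OF this G[OF V]]]
    have "(h has_derivative (\<lambda>s. fst (G' (t, snd p) (s, 0)))) (at t)"
      by (simp add: h_def[abs_def])
    moreover have "(\<lambda>s. fst (G' (t, snd p) (s, 0))) = (*) (1 / px f (h t, snd p))"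
    proof
      show "fst (G' (t, snd p) (s, 0)) = 1 / px f (h t, snd p) * s" for s
        using G'_eq[OF V, of "(s, 0)"] h[OF t] px_f[of "(h t, snd p)"] by (simp add: field_simps)
    qed
    ultimately show ?thesis by (simp only: has_field_derivative_def)
  qed
  have "smooth_on J h"
  proof (rule smooth_onI_deriv[OF JK(1) h_deriv])
    fix k assume k: "Ck_on k J h"
    have "smooth_on U (\<lambda>q. 1 / px f q)"
      using smooth_f open_U px_f by (intro smooth_intros)
    then have "Ck_on k U (\<lambda>q. 1 / px f q)" by (simp add: smooth_on_def)
    then show "Ck_on k J (\<lambda>t. 1 / px f (h t, snd p))"
    proof (rule Ck_on_compose[OF JK(1) open_U, rotated])
      show "(\<lambda>t. (h t, snd p)) ` J \<subseteq> U" using h(2) by blast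
      fix i :: pt assume "i \<in> Basis"
      then consider "i = (1, 0)" | "i = (0, 1)" by (auto simp: Basis_prod_def)
      then show "Ck_on k J (\<lambda>t. (h t, snd p) \<bullet> i)"
        by cases (simp_all add: k Ck_on_const)
    qed
  qed
  define N where "N = {q \<in> U'. \<Psi> q \<in> J \<times> K}"
  have "open N"
  proof -
    have "continuous_on U' \<Psi>" using hom(6) by (simp add: homeomorphism_def)
    then have "open (U' \<inter> \<Psi> -` (J \<times> K))"
      using hom(1) JK continuous_on_open_vimage[OF hom(1)] open_Times by (metis Int_commute)
    moreover have "N = U' \<inter> \<Psi> -` (J \<times> K)" by (auto simp: N_def)
    ultimately show ?thesis by simp
  qed
  have const: "k q = k (h (f q), snd p)"
    if k: "smooth_on U k" "\<And>q. q \<in> U \<Longrightarrow> D1 k q = D2 k q" and q: "q \<in> N" for k q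
  proof -
    have tJ: "f q \<in> J" "snd q \<in> K" using q by (auto simp: N_def \<Psi>_def)
    have "\<exists>c. \<forall>y\<in>K. k (G (f q, y)) = c"
    proof (rule has_field_derivative_zero_constant[OF JK(5)])
      fix y assume y: "y \<in> K"
      have V: "(f q, y) \<in> V" using y tJ JK by auto
      define z where "z = G (f q, y)"
      have zU: "z \<in> U" using inv(1)[OF V] hom(2) by (auto simp: z_def)
      have "((\<lambda>y. (f q, y)) has_derivative (\<lambda>s. (0, s))) (at y)"
        by (auto intro!: derivative_eq_intros)
      from has_derivative_compose[OF has_derivative_compose[OF this G[OF V]]
          smooth_on_has_derivative_px_py[OF k(1) zU[unfolded z_def]]]
      have "((\<lambda>y. k (G (f q, y))) has_derivative
          (\<lambda>s. fst (G' (f q, y) (0, s)) * px k z + snd (G' (f q, y) (0, s)) * py k z)) (at y)"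
        by (simp add: z_def)
      moreover have "fst (G' (f q, y) (0, s)) * px k z + snd (G' (f q, y) (0, s)) * py k z = 0" for s
      proof -
        have "fst (G' (f q, y) (0, s)) * px f z + s * py f z = 0"
          using G'_eq[OF V, of "(0, s)"] by (simp add: z_def)
        moreover have "px k z = - px f z * D1 k z" "py k z = - py f z * D1 k z"
          using px_eq[OF zU, of k] py_eq[OF zU, of k] k(2)[OF zU] by auto
        moreover have "snd (G' (f q, y) (0, s)) = s" using G'_eq[OF V, of "(0, s)"] by simp
        ultimately show ?thesis by algebra
      qed
      ultimately have "((\<lambda>y. k (G (f q, y))) has_real_derivative 0) (at y)"
        by (simp add: has_field_derivative_def lambda_zero)
      then show "((\<lambda>y. k (G (f q, y))) has_real_derivative 0) (at y within K)"
        by (rule has_field_derivative_at_within)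
    qed
    then have "k (G (f q, snd q)) = k (G (f q, snd p))" using tJ JK by auto
    moreover have "G (f q, snd q) = q"
      using homeomorphism_apply1[OF hom(6), of q] q by (simp add: N_def \<Psi>_def)
    ultimately show ?thesis using h(1)[OF tJ(1)] by simp
  qed
  show ?thesis
  proof (rule that[OF JK(1,2) \<open>smooth_on J h\<close> _ _ \<open>open N\<close> _ _ _ const])
    have "G (f p, snd p) = p"
      using homeomorphism_apply1[OF hom(6,3)] by (simp add: \<Psi>_def)
    then show "h (f p) = fst p" by (simp add: h_def)
  qed (use h hom JK in \<open>auto simp: N_def \<Psi>_def\<close>)
qed

section \<open>Solving the Samuelson system\<close>

lemma constant_in_y:
  assumes "smooth_on S h" "I \<times> K \<subseteq> S" "convex K" "\<And>q. q \<in> I \<times> K \<Longrightarrow> py h q = 0"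
    and "x \<in> I" "y \<in> K" "y' \<in> K"
  shows "h (x, y) = h (x, y')"
proof -
  have "\<exists>c. \<forall>y\<in>K. h (x, y) = c"
  proof (rule has_field_derivative_zero_constant[OF assms(3)])
    fix y assume "y \<in> K"
    then have "(x, y) \<in> I \<times> K" using assms(5) by simp
    then have "((\<lambda>y. h (x, y)) has_real_derivative 0) (at y)"
      using smooth_on_DERIV_y[OF assms(1), of x y] assms(2,4) by auto
    then show "((\<lambda>y. h (x, y)) has_real_derivative 0) (at y within K)"
      by (rule has_field_derivative_at_within)
  qed
  then show ?thesis using assms(6,7) by auto
qed

context canonical_web
begin

lemma smooth_slope: "smooth_on U (\<lambda>q. py g q / px g q)"
  using smooth_g open_U px_g by (intro smooth_intros)

lemma slope_nz: "p \<in> U \<Longrightarrow> py g p / px g p \<noteq> 0"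
  by (simp add: px_g py_g)

lemma b_eq_slope: "b q = px f q / py f q * (py g q / px g q)"
  by (simp add: bfun_def)

text \<open>Substituting \<open>b = \<rho> f\<^sub>x/f\<^sub>y\<close> into \<open>r = H - \<partial>\<^sub>1 log |b|\<close> gives \<open>r = - \<partial>\<^sub>1 log |\<rho> f\<^sub>x|\<close>, and the second
  integrability condition becomes \<open>(log |\<rho>|)\<^sub>x\<^sub>y = 0\<close>: the 3-web formed by the coordinate lines
  and the level curves of \<open>g\<close> is parallelizable.\<close>
lemma integ2_imp_slope:
  assumes int2: "\<And>q. q \<in> U \<Longrightarrow> integ2 f g q = 0" and p: "p \<in> U"
  defines "\<rho> \<equiv> \<lambda>q. py g q / px g q"
  shows "py (\<lambda>q. px \<rho> q / \<rho> q) p = 0"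
proof -
  define A C L where "A = (\<lambda>q. ln \<bar>px f q\<bar>)" and "C = (\<lambda>q. ln \<bar>py f q\<bar>)" and "L = (\<lambda>q. ln \<bar>\<rho> q\<bar>)"
  have s\<rho>: "smooth_on U \<rho>" unfolding \<rho>_def by (rule smooth_slope)
  have nz: "q \<in> U \<Longrightarrow> \<rho> q \<noteq> 0" for q unfolding \<rho>_def by (rule slope_nz)
  have s: "smooth_on U A" "smooth_on U C" "smooth_on U L"
    unfolding A_def C_def L_def by (auto intro!: smooth_intros smooth s\<rho> simp: px_f py_f nz)
  note s' = s[THEN smooth_D1] s[THEN smooth_D2]
  have "ln \<bar>b q\<bar> = L q + A q - C q" if "q \<in> U" for q
    using that by (simp add: b_eq_slope A_def C_def L_def \<rho>_def ln_mult ln_div abs_mult px_f py_f px_g py_g)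
  then have "D1 (\<lambda>q. ln \<bar>b q\<bar>) q = D1 (\<lambda>q. L q + A q - C q) q" if "q \<in> U" for q
    using that by (intro D1_cong) auto
  moreover have "D1 (\<lambda>q. L q + A q - C q) q = D1 L q + D1 A q - D1 C q" if "q \<in> U" for q
    using that by (simp add: D_diff D_add s smooth_intros open_U)
  moreover have D1C: "D1 C q = - H q" and D2A: "D2 A q = - H q" if "q \<in> U" for q
    using that by (simp_all add: A_def C_def D1_ln_py_f D2_ln_px_f)
  ultimately have r_eq: "r q = - D1 L q - D1 A q" if "q \<in> U" for q
    using that by (simp add: rfun_eq)
  have "D2 r p = D2 (\<lambda>q. - D1 L q - D1 A q) p"
    using r_eq by (intro D2_cong p)
  also have "\<dots> = - D2 (D1 L) p - D2 (D1 A) p"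
    using p by (simp add: D_diff D_minus s' smooth_intros open_U)
  finally have "- D2 (D1 L) p - D2 (D1 A) p = D1 H p - (H p)\<^sup>2 + r p * H p"
    using int2[OF p] by (simp add: integ2_def)
  moreover have "D1 (D2 A) p = - D1 H p"
  proof -
    have "D1 (D2 A) p = D1 (\<lambda>q. - H q) p" using D2A by (intro D1_cong p)
    then show ?thesis using p by (simp add: D_minus smooth)
  qed
  then have "D2 (D1 A) p = - D1 H p + (H p)\<^sup>2 + H p * D1 A p"
    using commutator[OF s(1) p] D2A[OF p] by (simp add: algebra_simps power2_eq_square)
  ultimately have DL: "D2 (D1 L) p = H p * D1 L p"
    using r_eq[OF p] by (simp add: algebra_simps)
  define \<kappa> where "\<kappa> = (\<lambda>q. px \<rho> q / \<rho> q)"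
  have s\<kappa>: "smooth_on U \<kappa>"
    unfolding \<kappa>_def using s\<rho> nz open_U by (intro smooth_intros)
  have D1L: "D1 L q = - (\<kappa> q / px f q)" if "q \<in> U" for q
    using that nz[OF that] s\<rho> unfolding L_def by (simp add: D_ln_abs) (simp add: D1_eq \<kappa>_def)
  have "D2 (D1 L) p = D2 (\<lambda>q. - (\<kappa> q / px f q)) p"
    using D1L by (intro D2_cong p)
  also have "\<dots> = - ((D2 \<kappa> p * px f p - \<kappa> p * D2 (px f) p) / (px f p)\<^sup>2)"
    using p smooth_f s\<kappa> by (simp add: D_minus D_divide smooth_intros open_U px_f)
  also have "D2 (px f) p = - H p * px f p"
    using p by (simp add: D2_eq py_px_f py_f)
  finally have "D2 \<kappa> p = 0"
    unfolding DL D1L[OF p] using px_f[OF p] by (simp add: field_simps power2_eq_square)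
  then show ?thesis
    using py_eq[OF p, of \<kappa>] by (simp add: \<kappa>_def)
qed

text \<open>Here \<open>m = - f\<^sub>y Z\<close> for the defect \<open>Z\<close> of the particular solution \<open>(- log |f\<^sub>x|, - log |f\<^sub>y|)\<close>. Then
  \<open>m\<^sub>x/\<rho> = - f\<^sub>x\<^sup>2 Y\<close>, and the equation \<open>\<partial>\<^sub>2 Y = 2 H Y\<close> of \<open>defect_identity\<close> says that this does
  not depend on \<open>y\<close>, because \<open>\<partial>\<^sub>2 log |f\<^sub>x| = - H\<close>.\<close>
lemma integrable_imp_defect:
  assumes int: "\<And>q. q \<in> U \<Longrightarrow> integ1 f g (Rof f g B) q = 0" "\<And>q. q \<in> U \<Longrightarrow> integ2 f g q = 0"
    and sB: "smooth_on U B" and p: "p \<in> U"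
  defines "\<rho> \<equiv> \<lambda>q. py g q / px g q"
    and "m \<equiv> \<lambda>q. - py f q * (B q - b q * D1 (\<lambda>q. - ln \<bar>px f q\<bar>) q - D2 (\<lambda>q. - ln \<bar>py f q\<bar>) q)"
  shows "py (\<lambda>q. px m q / \<rho> q) p = 0"
proof -
  define A C where "A = (\<lambda>q. - ln \<bar>px f q\<bar>)" and "C = (\<lambda>q. - ln \<bar>py f q\<bar>)"
  define Z where "Z = (\<lambda>q. B q - b q * D1 A q - D2 C q)"
  define Y where "Y = (\<lambda>q. (H q * Z q - D1 Z q) / b q)"
  have s: "smooth_on U A" "smooth_on U C"
    unfolding A_def C_def by (auto intro!: smooth_intros smooth simp: px_f py_f)
  have sZ: "smooth_on U Z" and sY: "smooth_on U Y"
    unfolding Y_def Z_def using s sB by (auto intro!: smooth_intros smooth simp: b_nz)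
  have "D2 A q = H q" "D1 C q = H q" if "q \<in> U" for q
  proof -
    have "smooth_on U (\<lambda>q. ln \<bar>px f q\<bar>)" "smooth_on U (\<lambda>q. ln \<bar>py f q\<bar>)"
      by (auto intro!: smooth_intros smooth simp: px_f py_f)
    then show "D2 A q = H q" "D1 C q = H q"
      using that by (simp_all add: A_def C_def D_minus D1_ln_py_f D2_ln_px_f)
  qed
  then have D2Y: "D2 Y p = 2 * H p * Y p"
    using defect_identity[OF s sB _ _ Z_def Y_def int p] by blast
  have m: "m = (\<lambda>q. - py f q * Z q)" by (simp add: m_def Z_def A_def C_def)
  have "px m q / \<rho> q = - (px f q * px f q * Y q)" if q: "q \<in> U" for q
  proof -
    have "px m q = - (px (py f) q * Z q + py f q * px Z q)"
      unfolding m using differentiable[OF sZ q] differentiable[OF smooth_on_py[OF smooth_f] q]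
        differentiable[OF smooth_on_minus[OF open_U smooth_on_py[OF smooth_f]] q]
      by (simp add: px_rules)
    also have "\<dots> = - px f q * py f q * (H q * Z q - D1 Z q)"
      using px_eq[OF q, of Z] px_py_f[OF q] by (simp add: algebra_simps)
    also have "H q * Z q - D1 Z q = b q * Y q"
      using b_nz[OF q] by (simp add: Y_def)
    finally show ?thesis
      using q by (simp add: b_eq_slope \<rho>_def px_f py_f px_g py_g)
  qed
  then have "py (\<lambda>q. px m q / \<rho> q) p = py (\<lambda>q. - (px f q * px f q * Y q)) p"
    by (intro py_cong[OF open_U p])
  also have "\<dots> = - py f p * D2 (\<lambda>q. - (px f q * px f q * Y q)) p"
    by (rule py_eq[OF p])
  also have "D2 (\<lambda>q. - (px f q * px f q * Y q)) p
      = - (2 * px f p * D2 (px f) p * Y p + px f p * px f p * D2 Y p)"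
    using p smooth_f sY by (simp add: D_minus D_mult smooth_intros open_U algebra_simps)
  also have "D2 (px f) p = - H p * px f p"
    using p by (simp add: D2_eq py_px_f py_f)
  finally show ?thesis by (simp add: D2Y)
qed

text \<open>Correct the particular solution \<open>A = - log |f\<^sub>x|\<close>, \<open>C = - log |f\<^sub>y|\<close> by \<open>\<alpha>(x)\<close> and \<open>\<gamma>(y)\<close>. The
  third equation becomes \<open>\<rho> \<alpha>' + \<gamma>' = m\<close>. Its \<open>x\<close>-derivative, divided by \<open>\<rho>\<close>, is an equation for
  \<open>\<alpha>'\<close> whose coefficients \<open>\<rho>\<^sub>x/\<rho>\<close> and \<open>m\<^sub>x/\<rho>\<close> depend on \<open>x\<close> only, so it suffices to satisfy it on
  the line \<open>y = y0\<close>, where it integrates to \<open>\<rho> \<alpha>' = m + k\<close>. The three free constants are \<open>k\<close> and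
  the initial values of \<open>\<alpha>\<close> and \<open>\<gamma>\<close>.\<close>
lemma samuelson_system_solvable:
  assumes int: "\<And>q. q \<in> U \<Longrightarrow> integ1 f g (Rof f g B) q = 0" "\<And>q. q \<in> U \<Longrightarrow> integ2 f g q = 0"
    and sB: "smooth_on U B" and p: "p \<in> U"
  obtains N s1 s2 where "open N" "p \<in> N" "N \<subseteq> U" "smooth_on N s1" "smooth_on N s2"
    "\<And>q. q \<in> N \<Longrightarrow> D2 s1 q = H q" "\<And>q. q \<in> N \<Longrightarrow> D1 s2 q = H q"
    "\<And>q. q \<in> N \<Longrightarrow> b q * D1 s1 q + D2 s2 q = B q"
    "s1 p = c1" "s2 p = c2" "D1 s1 p = c3"
proof -
  define x0 y0 where "x0 = fst p" and "y0 = snd p"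
  have p_eq: "p = (x0, y0)" by (simp add: x0_def y0_def)
  obtain e where e: "e > 0" "{x0 - e<..<x0 + e} \<times> {y0 - e<..<y0 + e} \<subseteq> U"
    using open_contains_square[OF open_U p] unfolding x0_def y0_def by metis
  define d where "d = e / 2"
  have d: "d > 0" using e by (simp add: d_def)
  define I K where "I = {x0 - 2 * d<..<x0 + 2 * d}" and "K = {y0 - 2 * d<..<y0 + 2 * d}"
  have IK: "open I" "open K" "convex I" "convex K" "x0 \<in> I" "y0 \<in> K" "I \<times> K \<subseteq> U"
    using e d by (auto simp: I_def K_def d_def)
  define A C where "A = (\<lambda>q. - ln \<bar>px f q\<bar>)" and "C = (\<lambda>q. - ln \<bar>py f q\<bar>)"
  define \<rho> where "\<rho> = (\<lambda>q. py g q / px g q)"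
  define m where "m = (\<lambda>q. - py f q * (B q - b q * D1 A q - D2 C q))"
  have sA: "smooth_on U A" and sC: "smooth_on U C"
    unfolding A_def C_def by (auto intro!: smooth_intros smooth simp: px_f py_f)
  have D2A: "D2 A q = H q" and D1C: "D1 C q = H q" if "q \<in> U" for q
  proof -
    have "smooth_on U (\<lambda>q. ln \<bar>px f q\<bar>)" "smooth_on U (\<lambda>q. ln \<bar>py f q\<bar>)"
      by (auto intro!: smooth_intros smooth simp: px_f py_f)
    then show "D2 A q = H q" "D1 C q = H q"
      using that by (simp_all add: A_def C_def D_minus D1_ln_py_f D2_ln_px_f)
  qed
  have s\<rho>: "smooth_on U \<rho>" and \<rho>_nz: "\<And>q. q \<in> U \<Longrightarrow> \<rho> q \<noteq> 0"
    unfolding \<rho>_def by (rule smooth_slope, rule slope_nz)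
  have sm: "smooth_on U m"
    unfolding m_def using sA sC sB by (auto intro!: smooth_intros smooth)
  have slope0: "py (\<lambda>q. px \<rho> q / \<rho> q) q = 0" if "q \<in> U" for q
    using integ2_imp_slope[OF int(2) that] by (simp add: \<rho>_def)
  have defect0: "py (\<lambda>q. px m q / \<rho> q) q = 0" if "q \<in> U" for q
    using integrable_imp_defect[OF int sB that] by (simp add: \<rho>_def m_def A_def C_def)
  have s_ratio: "smooth_on U (\<lambda>q. px \<rho> q / \<rho> q)" "smooth_on U (\<lambda>q. px m q / \<rho> q)"
    using s\<rho> sm \<rho>_nz open_U by (auto intro!: smooth_intros)
  have slope_x: "px \<rho> (x, y) / \<rho> (x, y) = px \<rho> (x, y0) / \<rho> (x, y0)"
    and defect_x: "px m (x, y) / \<rho> (x, y) = px m (x, y0) / \<rho> (x, y0)" if "x \<in> I" "y \<in> K" for x y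
    using constant_in_y[OF s_ratio(1) IK(7,4) _ that IK(6)] constant_in_y[OF s_ratio(2) IK(7,4) _ that IK(6)]
      slope0 defect0 IK(7) by blast+

  \<comment> \<open>The value of \<open>\<alpha>'\<close> at \<open>x0\<close> that produces \<open>\<partial>\<^sub>1 s\<^sub>1 = c3\<close> at \<open>p\<close>.\<close>
  define \<kappa> where "\<kappa> = (D1 A p - c3) * px f p"
  define k where "k = \<kappa> * \<rho> p - m p"
  define \<alpha>' where "\<alpha>' x = (m (x, y0) + k) / \<rho> (x, y0)" for x
  define \<gamma>' where "\<gamma>' y = m (x0, y) - \<rho> (x0, y) * \<kappa>" for y
  have \<alpha>'_x0: "\<alpha>' x0 = \<kappa>"
    using \<rho>_nz[OF p] by (simp add: \<alpha>'_def k_def p_eq)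
  have split: "\<rho> (x, y) * \<alpha>' x + \<gamma>' y = m (x, y)" if x: "x \<in> I" and y: "y \<in> K" for x y
  proof -
    have "\<exists>c. \<forall>x\<in>I. m (x, y) - \<rho> (x, y) * \<alpha>' x = c"
    proof (rule has_field_derivative_zero_constant[OF IK(3)])
      fix x assume x: "x \<in> I"
      have q: "(x, y) \<in> U" "(x, y0) \<in> U" using x y IK by auto
      note nz = \<rho>_nz[OF q(1)] \<rho>_nz[OF q(2)]
      have "((\<lambda>x. m (x, y) - \<rho> (x, y) * \<alpha>' x) has_real_derivative
          px m (x, y) - (px \<rho> (x, y) * \<alpha>' x + (px m (x, y0) * \<rho> (x, y0)
            - (m (x, y0) + k) * px \<rho> (x, y0)) / (\<rho> (x, y0) * \<rho> (x, y0)) * \<rho> (x, y))) (at x)"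
        unfolding \<alpha>'_def
        using smooth_on_DERIV_x[OF sm q(1)] smooth_on_DERIV_x[OF sm q(2)]
          smooth_on_DERIV_x[OF s\<rho> q(1)] smooth_on_DERIV_x[OF s\<rho> q(2)] nz
        by (auto intro!: derivative_eq_intros) (simp add: field_simps)
      moreover have "px m (x, y) = px m (x, y0) / \<rho> (x, y0) * \<rho> (x, y)"
        using defect_x[OF x y] nz by (simp add: field_simps)
      moreover have "px \<rho> (x, y) = px \<rho> (x, y0) / \<rho> (x, y0) * \<rho> (x, y)"
        using slope_x[OF x y] nz by (simp add: field_simps)
      moreover have "px m (x, y0) / \<rho> (x, y0) * \<rho> (x, y)
          - (px \<rho> (x, y0) / \<rho> (x, y0) * \<rho> (x, y) * \<alpha>' x + (px m (x, y0) * \<rho> (x, y0)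
            - (m (x, y0) + k) * px \<rho> (x, y0)) / (\<rho> (x, y0) * \<rho> (x, y0)) * \<rho> (x, y)) = 0"
        unfolding \<alpha>'_def using nz by (simp add: field_simps)
      ultimately have "((\<lambda>x. m (x, y) - \<rho> (x, y) * \<alpha>' x) has_real_derivative 0) (at x)" by simp
      then show "((\<lambda>x. m (x, y) - \<rho> (x, y) * \<alpha>' x) has_real_derivative 0) (at x within I)"
        by (rule has_field_derivative_at_within)
    qed
    then have "m (x, y) - \<rho> (x, y) * \<alpha>' x = m (x0, y) - \<rho> (x0, y) * \<alpha>' x0"
      using x IK(5) by auto
    then show ?thesis by (simp add: \<gamma>'_def \<alpha>'_x0)
  qed

  have sect: "smooth_on I (\<lambda>x. h (x, y0))" "smooth_on K (\<lambda>y. h (x0, y))" if "smooth_on U h" for h :: fn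
    using that IK by (auto intro!: smooth_on_compose_pair[OF _ open_U that] smooth_on_const
        smooth_on_bounded_linear[of _ "\<lambda>x. x"] bounded_linear_ident)
  have "smooth_on I \<alpha>'"
    unfolding \<alpha>'_def using sect(1)[OF sm] sect(1)[OF s\<rho>] IK \<rho>_nz
    by (auto intro!: smooth_intros)
  then obtain \<alpha> where \<alpha>: "smooth_on {x0 - d<..<x0 + d} \<alpha>" "\<alpha> x0 = c1 - A p"
    "\<And>t. t \<in> {x0 - d<..<x0 + d} \<Longrightarrow> (\<alpha> has_real_derivative \<alpha>' t) (at t)"
    using smooth_antiderivative[OF d, of x0 \<alpha>' "c1 - A p"] by (auto simp: I_def)
  have "smooth_on K \<gamma>'"
    unfolding \<gamma>'_def using sect(2)[OF sm] sect(2)[OF s\<rho>] IK by (auto intro!: smooth_intros)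
  then obtain \<gamma> where \<gamma>: "smooth_on {y0 - d<..<y0 + d} \<gamma>" "\<gamma> y0 = c2 - C p"
    "\<And>t. t \<in> {y0 - d<..<y0 + d} \<Longrightarrow> (\<gamma> has_real_derivative \<gamma>' t) (at t)"
    using smooth_antiderivative[OF d, of y0 \<gamma>' "c2 - C p"] by (auto simp: K_def)

  define N where "N = {x0 - d<..<x0 + d} \<times> {y0 - d<..<y0 + d}"
  have N: "open N" "p \<in> N" "N \<subseteq> I \<times> K"
    using d by (auto simp: N_def p_eq I_def K_def open_Times)
  then have NU: "N \<subseteq> U" using IK by auto
  interpret N: canonical_web N f g by (rule restrict[OF N(1) NU])
  define s1 s2 where "s1 = (\<lambda>q. A q + \<alpha> (fst q))" and "s2 = (\<lambda>q. C q + \<gamma> (snd q))"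
  have s: "smooth_on N A" "smooth_on N C" "smooth_on N (\<lambda>q. \<alpha> (fst q))" "smooth_on N (\<lambda>q. \<gamma> (snd q))"
  proof -
    show "smooth_on N (\<lambda>q. \<alpha> (fst q))"
      by (rule smooth_on_compose_real[OF N(1) _ \<alpha>(1) _ smooth_on_bounded_linear[OF N(1) bounded_linear_fst]])
        (auto simp: N_def)
    show "smooth_on N (\<lambda>q. \<gamma> (snd q))"
      by (rule smooth_on_compose_real[OF N(1) _ \<gamma>(1) _ smooth_on_bounded_linear[OF N(1) bounded_linear_snd]])
        (auto simp: N_def)
  qed (use smooth_on_subset[OF sA NU] smooth_on_subset[OF sC NU] in auto)
  have D: "D1 s1 q = D1 A q - \<alpha>' (fst q) / px f q" "D2 s1 q = H q"
    "D1 s2 q = H q" "D2 s2 q = D2 C q - \<gamma>' (snd q) / py f q" if q: "q \<in> N" for q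
  proof -
    have proj: "px fst q = 1" "py fst q = 0" "px snd q = 0" "py snd q = (1::real)"
      using has_derivative_px_py[OF bounded_linear_imp_has_derivative[OF bounded_linear_fst], of q]
        has_derivative_px_py[OF bounded_linear_imp_has_derivative[OF bounded_linear_snd], of q]
      by simp_all
    have "(\<alpha> has_real_derivative \<alpha>' (fst q)) (at (fst q))" "(\<gamma> has_real_derivative \<gamma>' (snd q)) (at (snd q))"
      using q \<alpha>(3) \<gamma>(3) by (auto simp: N_def)
    moreover have "fst differentiable (at q)" "snd differentiable (at q)"
      by (auto intro: bounded_linear_imp_differentiable bounded_linear_fst bounded_linear_snd)
    ultimately have "px (\<lambda>q. \<alpha> (fst q)) q = \<alpha>' (fst q)" "py (\<lambda>q. \<alpha> (fst q)) q = 0"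
      "px (\<lambda>q. \<gamma> (snd q)) q = 0" "py (\<lambda>q. \<gamma> (snd q)) q = \<gamma>' (snd q)"
      by (simp_all add: px_compose py_compose proj)
    then have "D1 (\<lambda>q. \<alpha> (fst q)) q = - \<alpha>' (fst q) / px f q" "D2 (\<lambda>q. \<alpha> (fst q)) q = 0"
      "D1 (\<lambda>q. \<gamma> (snd q)) q = 0" "D2 (\<lambda>q. \<gamma> (snd q)) q = - \<gamma>' (snd q) / py f q"
      by (simp_all add: D1_eq D2_eq)
    moreover have "q \<in> U" using q NU by auto
    ultimately show "D1 s1 q = D1 A q - \<alpha>' (fst q) / px f q" "D2 s1 q = H q"
      "D1 s2 q = H q" "D2 s2 q = D2 C q - \<gamma>' (snd q) / py f q"
      unfolding s1_def s2_def using D2A D1C by (simp_all add: N.D_add s q)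
  qed
  show ?thesis
  proof (rule that[OF N(1,2) NU])
    show "smooth_on N s1" "smooth_on N s2"
      unfolding s1_def s2_def using s N(1) by (auto intro!: smooth_on_add)
    show "D2 s1 q = H q" "D1 s2 q = H q" if "q \<in> N" for q using D[OF that] by auto
    show "b q * D1 s1 q + D2 s2 q = B q" if q: "q \<in> N" for q
    proof -
      have qU: "q \<in> U" using q NU by auto
      have "\<rho> q * \<alpha>' (fst q) + \<gamma>' (snd q) = m q"
        using split[of "fst q" "snd q"] q N(3) by auto
      then have "\<gamma>' (snd q) = - py f q * (B q - b q * D1 A q - D2 C q) - \<rho> q * \<alpha>' (fst q)"
        by (simp add: m_def)
      moreover have "b q / px f q = \<rho> q / py f q"
        using px_f[OF qU] by (simp add: b_eq_slope \<rho>_def)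
      then have "b q * (\<alpha>' (fst q) / px f q) = \<rho> q * \<alpha>' (fst q) / py f q"
        by (metis times_divide_eq_left times_divide_eq_right)
      ultimately show ?thesis
        using D(1,4)[OF q] py_f[OF qU] by (simp add: right_diff_distrib) (simp add: field_simps)
    qed
    show "s1 p = c1" "s2 p = c2" using \<alpha>(2) \<gamma>(2) by (simp_all add: s1_def s2_def p_eq)
    show "D1 s1 p = c3"
      using D(1)[OF N(2)] \<alpha>'_x0 px_f[OF p] by (simp add: \<kappa>_def x0_def[symmetric])
  qed
qed

text \<open>On a neighbourhood where each \<open>T\<^sub>i/T\<^sub>3\<close> is a function of \<open>f\<close>, solve the equation for \<open>w\<close> first;
  then both integrability conditions hold and the system for \<open>\<sigma>\<^sub>1, \<sigma>\<^sub>2\<close> can be solved.\<close>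
lemma solution_with_jet:
  assumes K: "\<And>q. q \<in> U \<Longrightarrow> Kfun f q = - dd_log_b f g q"
    and \<delta>2: "\<And>q. q \<in> U \<Longrightarrow> delta f (\<lambda>q. T2 f g q / T3 f g q) q = 0"
    and \<delta>1: "\<And>q. q \<in> U \<Longrightarrow> delta f (\<lambda>q. T1 f g q / T3 f g q) q = 0"
    and \<delta>0: "\<And>q. q \<in> U \<Longrightarrow> delta f (\<lambda>q. T0 f g q / T3 f g q) q = 0"
    and p: "p \<in> U"
  obtains N J s1 s2 w where "p \<in> N" "N \<subseteq> U" "samuelson_solution f g N J s1 s2 w"
    "s1 p = c1" "s2 p = c2" "D1 s1 p = c3"
    "w (f p) = k0" "deriv w (f p) = k1" "deriv (deriv w) (f p) = k2"
proof -
  obtain J h N0 where J: "open J" "f p \<in> J" "smooth_on J h" "h (f p) = fst p"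
      "\<And>t. t \<in> J \<Longrightarrow> (h t, snd p) \<in> U \<and> f (h t, snd p) = t"
    and N0: "open N0" "p \<in> N0" "N0 \<subseteq> U" "f ` N0 \<subseteq> J"
    and level: "\<And>k q. smooth_on U k \<Longrightarrow> (\<And>q. q \<in> U \<Longrightarrow> D1 k q = D2 k q) \<Longrightarrow> q \<in> N0
      \<Longrightarrow> k q = k (h (f q), snd p)"
    using level_coordinate[OF p] by metis
  define t0 t1 t2 where "t0 = (\<lambda>q. T0 f g q / T3 f g q)" and "t1 = (\<lambda>q. T1 f g q / T3 f g q)"
    and "t2 = (\<lambda>q. T2 f g q / T3 f g q)"
  have st: "smooth_on U t0" "smooth_on U t1" "smooth_on U t2"
    unfolding t0_def t1_def t2_def by (auto intro!: smooth_intros smooth_T open_U simp: T3_nz)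
  have level_t: "t0 q = t0 (h (f q), snd p)" "t1 q = t1 (h (f q), snd p)" "t2 q = t2 (h (f q), snd p)"
    if "q \<in> N0" for q
  proof -
    have "D1 t0 q = D2 t0 q" "D1 t1 q = D2 t1 q" "D1 t2 q = D2 t2 q" if "q \<in> U" for q
      using \<delta>0[OF that] \<delta>1[OF that] \<delta>2[OF that] by (simp_all add: delta_def t0_def t1_def t2_def)
    then show "t0 q = t0 (h (f q), snd p)" "t1 q = t1 (h (f q), snd p)" "t2 q = t2 (h (f q), snd p)"
      using level[OF st(1) _ that] level[OF st(2) _ that] level[OF st(3) _ that] by blast+
  qed
  have "smooth_on J (\<lambda>t. k (h t, snd p))" if "smooth_on U k" for k :: fn
    by (rule smooth_on_compose_pair[OF J(1) open_U that]) (use J in \<open>auto intro: smooth_on_const\<close>)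
  note sa = this[OF st(1)] this[OF st(2)] this[OF st(3)]
  obtain J' w where J': "open J'" "f p \<in> J'" "J' \<subseteq> J" and w: "smooth_on J' w"
    and w0: "w (f p) = k0" "deriv w (f p) = k1" "deriv (deriv w) (f p) = k2"
    and ode: "\<And>t. t \<in> J' \<Longrightarrow> deriv (deriv (deriv w)) t + t2 (h t, snd p) * deriv (deriv w) t
      + t1 (h t, snd p) * deriv w t + t0 (h t, snd p) = 0"
    using linear_third_order_ode[OF J(1,2) sa, of k0 k1 k2] by metis
  define N1 where "N1 = N0 \<inter> (f -` J' \<inter> U)"
  have "open (f -` J' \<inter> U)"
    using smooth_on_imp_continuous_on[OF smooth_f] open_U J'(1) continuous_on_open_vimage by blast
  then have N1: "open N1" "p \<in> N1" "N1 \<subseteq> U" "N1 \<subseteq> N0" "f ` N1 \<subseteq> J'"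
    using N0 J' p by (auto simp: N1_def)
  interpret N1: canonical_web N1 f g by (rule restrict[OF N1(1,3)])
  have i1: "integ1 f g (Rof f g (Bfun f g w)) q = 0" if q: "q \<in> N1" for q
  proof -
    have fq: "f q \<in> J'" "q \<in> N0" "q \<in> U" using q N1 by auto
    have "T3 f g q * (deriv (deriv (deriv w)) (f q) + t2 q * deriv (deriv w) (f q)
        + t1 q * deriv w (f q) + t0 q) = 0"
      using ode[OF fq(1)] level_t[OF fq(2)] by simp
    moreover have "T3 f g q * t2 q = T2 f g q" "T3 f g q * t1 q = T1 f g q" "T3 f g q * t0 q = T0 f g q"
      using T3_nz[OF fq(3)] by (simp_all add: t0_def t1_def t2_def)
    ultimately show ?thesis
      unfolding N1.integ1_Bfun[OF J'(1) N1(5) w q] by (simp add: distrib_left flip: mult.assoc)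
  qed
  have i2: "integ2 f g q = 0" if "q \<in> N1" for q
    using integ2_eq[of q] K[of q] that N1(3) by auto
  obtain N s1 s2 where N: "open N" "p \<in> N" "N \<subseteq> N1" "smooth_on N s1" "smooth_on N s2"
    and eqs: "\<And>q. q \<in> N \<Longrightarrow> D2 s1 q = H q" "\<And>q. q \<in> N \<Longrightarrow> D1 s2 q = H q"
      "\<And>q. q \<in> N \<Longrightarrow> b q * D1 s1 q + D2 s2 q = Bfun f g w q"
    and init: "s1 p = c1" "s2 p = c2" "D1 s1 p = c3"
    using N1.samuelson_system_solvable[OF i1 i2 N1.smooth_Bfun[OF J'(1) N1(5) w] N1(2), of c1 c2 c3]
    by metis
  have "samuelson_solution f g N J' s1 s2 w"
    unfolding samuelson_solution_def
    using N J'(1) N1(5) w eqs i1 i2 by (auto dest: subsetD)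
  moreover have "N \<subseteq> U" using N N1 by auto
  ultimately show ?thesis using that N(2) init w0 by blast
qed

end

section \<open>Germs of solutions and their jets\<close>

text \<open>The inhomogeneous terms are multiplied by \<open>\<kappa>\<close>: for \<open>\<kappa> = 1\<close> these are the equations of the
  Samuelson system with its first integrability condition, for \<open>\<kappa> = 0\<close> the homogeneous
  equations. A single superposition principle then covers sums of homogeneous solutions,
  differences of solutions, and solutions plus homogeneous ones.\<close>
definition scaled_solution ::
  "fn \<Rightarrow> fn \<Rightarrow> real \<Rightarrow> pt set \<Rightarrow> real set \<Rightarrow> fn \<Rightarrow> fn \<Rightarrow> (real \<Rightarrow> real) \<Rightarrow> bool" where
  "scaled_solution f g \<kappa> N J s1 s2 w \<longleftrightarrow>
     open N \<and> open J \<and> f ` N \<subseteq> J \<and> smooth_on N s1 \<and> smooth_on N s2 \<and> smooth_on J w \<and>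
     (\<forall>q\<in>N.
        d2 f s1 q = \<kappa> * Hfun f q \<and>
        d1 f s2 q = \<kappa> * Hfun f q \<and>
        bfun f g q * d1 f s1 q + d2 f s2 q
          = \<kappa> * B0fun f g q + (bfun f g q - 1) * deriv w (f q) \<and>
        T3 f g q * deriv (deriv (deriv w)) (f q) + T2 f g q * deriv (deriv w) (f q)
          + T1 f g q * deriv w (f q) + \<kappa> * T0 f g q = 0)"

type_synonym solution_germ = "pt germ \<times> pt germ \<times> real germ"
type_synonym solution_jet = "real \<times> real \<times> real \<times> real \<times> real \<times> real"

definition germs_at :: "fn \<Rightarrow> pt \<Rightarrow> fn \<Rightarrow> fn \<Rightarrow> (real \<Rightarrow> real) \<Rightarrow> solution_germ" where
  "germs_at f p s1 s2 w = (germ_at p s1, germ_at p s2, germ_at (f p) w)"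

definition jet_at :: "fn \<Rightarrow> pt \<Rightarrow> fn \<Rightarrow> fn \<Rightarrow> (real \<Rightarrow> real) \<Rightarrow> solution_jet" where
  "jet_at f p s1 s2 w
     = (s1 p, s2 p, d1 f s1 p, w (f p), deriv w (f p), deriv (deriv w) (f p))"

text \<open>The jet map on germs of homogeneous solutions, encoded as its graph. The graph is a linear
  subspace of a product, so both the map and its inverse are handled by the linear
  projections, and no jet of an abstract germ has to be chosen.\<close>
definition jet_graph :: "pt set \<Rightarrow> fn \<Rightarrow> fn \<Rightarrow> pt \<Rightarrow> (solution_germ \<times> solution_jet) set" where
  "jet_graph U f g p = {(germs_at f p s1 s2 w, jet_at f p s1 s2 w) | s1 s2 w.
     \<exists>N J. p \<in> N \<and> N \<subseteq> U \<and> scaled_solution f g 0 N J s1 s2 w}"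

lemma jet_graphI:
  "p \<in> N \<Longrightarrow> N \<subseteq> U \<Longrightarrow> scaled_solution f g 0 N J s1 s2 w
    \<Longrightarrow> (germs_at f p s1 s2 w, jet_at f p s1 s2 w) \<in> jet_graph U f g p"
  unfolding jet_graph_def by blast

lemma jet_graphE:
  assumes "x \<in> jet_graph U f g p"
  obtains N J s1 s2 w where "p \<in> N" "N \<subseteq> U" "scaled_solution f g 0 N J s1 s2 w"
    "x = (germs_at f p s1 s2 w, jet_at f p s1 s2 w)"
proof -
  have "\<exists>s1 s2 w. x = (germs_at f p s1 s2 w, jet_at f p s1 s2 w) \<and>
      (\<exists>N J. p \<in> N \<and> N \<subseteq> U \<and> scaled_solution f g 0 N J s1 s2 w)"
    using assms unfolding jet_graph_def by (rule CollectD)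
  then show thesis by (elim exE conjE) (rule that)
qed

lemma germ_at_add_scaleR:
  "germ_at p (\<lambda>q. h q + c * k q) = germ_at p h + c *\<^sub>R germ_at p k"
  by (simp add: germ_at_def plus_germ.abs_eq scaleR_germ.abs_eq)

lemma germ_at_zero_iff: "germ_at p h = 0 \<longleftrightarrow> (\<forall>\<^sub>F q in nhds p. h q = 0)"
proof -
  have "0 = germ_at p (\<lambda>_. 0)" by (simp add: germ_at_def zero_germ_def)
  then show ?thesis unfolding germ_at_eq_iff[symmetric] by simp
qed

lemma germs_at_add_scaleR:
  "germs_at f p (\<lambda>q. s1 q + c * s1' q) (\<lambda>q. s2 q + c * s2' q) (\<lambda>t. w t + c * w' t)
    = germs_at f p s1 s2 w + c *\<^sub>R germs_at f p s1' s2' w'"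
  by (simp add: germs_at_def germ_at_add_scaleR)

lemma deriv_add_scaleR:
  fixes w w' :: "real \<Rightarrow> real"
  assumes "open J" "smooth_on J w" "smooth_on J w'" "t \<in> J"
  shows "deriv (\<lambda>t. w t + c * w' t) t = deriv w t + c * deriv w' t"
  using smooth_on_has_deriv[OF assms(2,4)] smooth_on_has_deriv[OF assms(3,4)]
  by (intro DERIV_imp_deriv) (auto intro!: derivative_eq_intros)

lemma deriv_cong_open:
  fixes w w' :: "real \<Rightarrow> real"
  assumes "open J" "\<And>t. t \<in> J \<Longrightarrow> w t = w' t" "t \<in> J"
  shows "deriv w t = deriv w' t"
  using assms by (intro deriv_cong_ev refl) (auto simp: eventually_nhds)

lemma deriv2_deriv3_add_scaleR:
  fixes w w' :: "real \<Rightarrow> real"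
  assumes "open J" "smooth_on J w" "smooth_on J w'" "t \<in> J"
  shows "deriv (deriv (\<lambda>t. w t + c * w' t)) t = deriv (deriv w) t + c * deriv (deriv w') t"
    and "deriv (deriv (deriv (\<lambda>t. w t + c * w' t))) t
      = deriv (deriv (deriv w)) t + c * deriv (deriv (deriv w')) t"
proof -
  note s1 = smooth_on_deriv[OF assms(1,2)] smooth_on_deriv[OF assms(1,3)]
  note s2 = smooth_on_deriv[OF assms(1) s1(1)] smooth_on_deriv[OF assms(1) s1(2)]
  have e2: "deriv (deriv (\<lambda>t. w t + c * w' t)) t = deriv (deriv w) t + c * deriv (deriv w') t"
    if t: "t \<in> J" for t
    using deriv_cong_open[OF assms(1) _ t, of "deriv (\<lambda>t. w t + c * w' t)" "\<lambda>t. deriv w t + c * deriv w' t"]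
      deriv_add_scaleR[OF assms(1-3), of _ c] deriv_add_scaleR[OF assms(1) s1 t, of c] by simp
  then show "deriv (deriv (\<lambda>t. w t + c * w' t)) t = deriv (deriv w) t + c * deriv (deriv w') t"
    using assms(4) by blast
  show "deriv (deriv (deriv (\<lambda>t. w t + c * w' t))) t
      = deriv (deriv (deriv w)) t + c * deriv (deriv (deriv w')) t"
    using deriv_cong_open[OF assms(1) e2 assms(4)] deriv_add_scaleR[OF assms(1) s2 assms(4), of c]
    by simp
qed

context canonical_web
begin

lemma D_add_scaleR:
  assumes "smooth_on U h" "smooth_on U k" "p \<in> U"
  shows "D1 (\<lambda>q. h q + c * k q) p = D1 h p + c * D1 k p"
    "D2 (\<lambda>q. h q + c * k q) p = D2 h p + c * D2 k p"
  using assms by (simp_all add: D_add D_mult smooth_intros open_U D1_const D2_const)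

lemma scaled_solution_add_scaleR:
  assumes s: "scaled_solution f g \<kappa> N J s1 s2 w" and s': "scaled_solution f g \<kappa>' N' J' s1' s2' w'"
    and "N \<subseteq> U"
  shows "scaled_solution f g (\<kappa> + c * \<kappa>') (N \<inter> N') (J \<inter> J')
    (\<lambda>q. s1 q + c * s1' q) (\<lambda>q. s2 q + c * s2' q) (\<lambda>t. w t + c * w' t)"
proof -
  let ?N = "N \<inter> N'" and ?J = "J \<inter> J'"
  have N: "open ?N" and J: "open ?J" and fN: "f ` ?N \<subseteq> ?J" and NU: "?N \<subseteq> U"
    using s s' assms(3) unfolding scaled_solution_def by auto
  have sm: "smooth_on ?N s1" "smooth_on ?N s2" "smooth_on ?J w"
    "smooth_on ?N s1'" "smooth_on ?N s2'" "smooth_on ?J w'"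
    using s s' unfolding scaled_solution_def by (meson smooth_on_subset inf_le1 inf_le2)+
  interpret N: canonical_web ?N f g by (rule restrict[OF N NU])
  show ?thesis
    unfolding scaled_solution_def
  proof (intro conjI ballI N J fN smooth_on_add smooth_on_mult smooth_on_const sm)
    fix q assume q: "q \<in> ?N"
    then have t: "f q \<in> ?J" using fN by blast
    note D = N.D_add_scaleR[OF sm(1,4) q] N.D_add_scaleR[OF sm(2,5) q]
      deriv_add_scaleR[OF J sm(3,6) t] deriv2_deriv3_add_scaleR[OF J sm(3,6) t]
    have e: "D2 s1 q = \<kappa> * H q" "D1 s2 q = \<kappa> * H q"
      "b q * D1 s1 q + D2 s2 q = \<kappa> * B0fun f g q + (b q - 1) * deriv w (f q)"
      "T3 f g q * deriv (deriv (deriv w)) (f q) + T2 f g q * deriv (deriv w) (f q)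
          + T1 f g q * deriv w (f q) + \<kappa> * T0 f g q = 0"
      using s q unfolding scaled_solution_def by auto
    have e': "D2 s1' q = \<kappa>' * H q" "D1 s2' q = \<kappa>' * H q"
      "b q * D1 s1' q + D2 s2' q = \<kappa>' * B0fun f g q + (b q - 1) * deriv w' (f q)"
      "T3 f g q * deriv (deriv (deriv w')) (f q) + T2 f g q * deriv (deriv w') (f q)
          + T1 f g q * deriv w' (f q) + \<kappa>' * T0 f g q = 0"
      using s' q unfolding scaled_solution_def by auto
    show "D2 (\<lambda>q. s1 q + c * s1' q) q = (\<kappa> + c * \<kappa>') * H q"
      "D1 (\<lambda>q. s2 q + c * s2' q) q = (\<kappa> + c * \<kappa>') * H q"
      unfolding D e e' by (simp_all add: algebra_simps)
    have "b q * (D1 s1 q + c * D1 s1' q) + (D2 s2 q + c * D2 s2' q)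
        = (b q * D1 s1 q + D2 s2 q) + c * (b q * D1 s1' q + D2 s2' q)"
      by (simp add: algebra_simps)
    then show "b q * D1 (\<lambda>q. s1 q + c * s1' q) q + D2 (\<lambda>q. s2 q + c * s2' q) q
        = (\<kappa> + c * \<kappa>') * B0fun f g q + (b q - 1) * deriv (\<lambda>t. w t + c * w' t) (f q)"
      unfolding D e(3) e'(3) by (simp add: algebra_simps)
    have "T3 f g q * (deriv (deriv (deriv w)) (f q) + c * deriv (deriv (deriv w')) (f q))
        + T2 f g q * (deriv (deriv w) (f q) + c * deriv (deriv w') (f q))
        + T1 f g q * (deriv w (f q) + c * deriv w' (f q)) + (\<kappa> + c * \<kappa>') * T0 f g q
      = (T3 f g q * deriv (deriv (deriv w)) (f q) + T2 f g q * deriv (deriv w) (f q)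
          + T1 f g q * deriv w (f q) + \<kappa> * T0 f g q)
        + c * (T3 f g q * deriv (deriv (deriv w')) (f q) + T2 f g q * deriv (deriv w') (f q)
          + T1 f g q * deriv w' (f q) + \<kappa>' * T0 f g q)"
      by (simp add: algebra_simps)
    then show "T3 f g q * deriv (deriv (deriv (\<lambda>t. w t + c * w' t))) (f q)
        + T2 f g q * deriv (deriv (\<lambda>t. w t + c * w' t)) (f q)
        + T1 f g q * deriv (\<lambda>t. w t + c * w' t) (f q) + (\<kappa> + c * \<kappa>') * T0 f g q = 0"
      unfolding D e(4) e'(4) by simp
  qed
qed

lemma jet_at_add_scaleR:
  assumes s: "scaled_solution f g \<kappa> N J s1 s2 w" and s': "scaled_solution f g \<kappa>' N' J' s1' s2' w'"
    and "N \<subseteq> U" and p: "p \<in> N" "p \<in> N'"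
  shows "jet_at f p (\<lambda>q. s1 q + c * s1' q) (\<lambda>q. s2 q + c * s2' q) (\<lambda>t. w t + c * w' t)
    = jet_at f p s1 s2 w + c *\<^sub>R jet_at f p s1' s2' w'"
proof -
  let ?N = "N \<inter> N'" and ?J = "J \<inter> J'"
  have N: "open ?N" and J: "open ?J" and fN: "f ` ?N \<subseteq> ?J" and NU: "?N \<subseteq> U"
    using s s' assms(3) unfolding scaled_solution_def by auto
  have sm: "smooth_on ?N s1" "smooth_on ?J w" "smooth_on ?N s1'" "smooth_on ?J w'"
    using s s' unfolding scaled_solution_def by (meson smooth_on_subset inf_le1 inf_le2)+
  interpret N: canonical_web ?N f g by (rule restrict[OF N NU])
  have pN: "p \<in> ?N" and t: "f p \<in> ?J" using p fN by auto
  show ?thesis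
    unfolding jet_at_def N.D_add_scaleR[OF sm(1,3) pN] deriv_add_scaleR[OF J sm(2,4) t]
      deriv2_deriv3_add_scaleR[OF J sm(2,4) t] by simp
qed

lemma samuelson_solution_iff:
  assumes "N \<subseteq> U"
  shows "samuelson_solution f g N J s1 s2 w \<longleftrightarrow>
    scaled_solution f g 1 N J s1 s2 w \<and> (\<forall>q\<in>N. integ2 f g q = 0)"
proof -
  have "integ1 f g (Rof f g (Bfun f g w)) q
      = T3 f g q * deriv (deriv (deriv w)) (f q) + T2 f g q * deriv (deriv w) (f q)
        + T1 f g q * deriv w (f q) + T0 f g q"
    if "open N" "open J" "f ` N \<subseteq> J" "smooth_on J w" "q \<in> N" for q
  proof -
    interpret N: canonical_web N f g by (rule restrict[OF that(1) assms])
    show ?thesis by (rule N.integ1_Bfun[OF that(2-5)])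
  qed
  then show ?thesis
    unfolding samuelson_solution_def scaled_solution_def Bfun_eq
    by (auto simp del: split_paired_All)
qed

lemma subspace_jet_graph:
  assumes p: "p \<in> U"
  shows "subspace (jet_graph U f g p)"
proof -
  let ?G = "jet_graph U f g p"
  have zero: "scaled_solution f g 0 U UNIV (\<lambda>_. 0) (\<lambda>_. 0) (\<lambda>_. 0)"
    by (simp add: scaled_solution_def open_U smooth_on_const D1_const D2_const)
  have "(germs_at f p (\<lambda>_. 0) (\<lambda>_. 0) (\<lambda>_. 0), jet_at f p (\<lambda>_. 0) (\<lambda>_. 0) (\<lambda>_. 0)) = 0"
    by (simp add: germs_at_def jet_at_def D1_const germ_at_zero_iff zero_prod_def)
  with jet_graphI[OF p subset_refl zero] have 0: "0 \<in> ?G" by simp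
  have add: "x + c *\<^sub>R y \<in> ?G" if xy: "x \<in> ?G" "y \<in> ?G" for x y c
  proof -
    obtain N J s1 s2 w where x: "p \<in> N" "N \<subseteq> U" "scaled_solution f g 0 N J s1 s2 w"
      "x = (germs_at f p s1 s2 w, jet_at f p s1 s2 w)"
      by (rule jet_graphE[OF xy(1)])
    obtain N' J' s1' s2' w' where y: "p \<in> N'" "N' \<subseteq> U" "scaled_solution f g 0 N' J' s1' s2' w'"
      "y = (germs_at f p s1' s2' w', jet_at f p s1' s2' w')"
      by (rule jet_graphE[OF xy(2)])
    have "scaled_solution f g 0 (N \<inter> N') (J \<inter> J')
      (\<lambda>q. s1 q + c * s1' q) (\<lambda>q. s2 q + c * s2' q) (\<lambda>t. w t + c * w' t)"
      using scaled_solution_add_scaleR[OF x(3) y(3) x(2), of c] by simp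
    from jet_graphI[OF _ _ this, of p U] x(1,2) y(1)
    have "(germs_at f p s1 s2 w + c *\<^sub>R germs_at f p s1' s2' w',
        jet_at f p s1 s2 w + c *\<^sub>R jet_at f p s1' s2' w') \<in> ?G"
      unfolding germs_at_add_scaleR jet_at_add_scaleR[OF x(3) y(3) x(2,1) y(1)] by blast
    then show ?thesis unfolding x(4) y(4) by simp
  qed
  show ?thesis
    unfolding subspace_def
  proof (intro conjI ballI allI)
    show "0 \<in> ?G" by (rule 0)
    show "x + y \<in> ?G" if "x \<in> ?G" "y \<in> ?G" for x y using add[OF that, of 1] by simp
    show "c *\<^sub>R x \<in> ?G" if "x \<in> ?G" for c x using add[OF 0 that, of c] by simp
  qed
qed

text \<open>Every value \<open>t\<close> near \<open>f p\<close> is attained by \<open>f\<close> near \<open>p\<close>, namely at \<open>(h t, snd p)\<close>.\<close>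
lemma function_of_f_zero_near:
  assumes p: "p \<in> U" and ev: "\<forall>\<^sub>F q in nhds p. w (f q) = 0"
  shows "\<forall>\<^sub>F t in nhds (f p). w t = (0::real)"
proof -
  obtain J h where J: "open J" "f p \<in> J" "smooth_on J h" "h (f p) = fst p"
    and fh: "\<And>t. t \<in> J \<Longrightarrow> f (h t, snd p) = t"
    using level_coordinate[OF p] by metis
  have "isCont (\<lambda>t. (h t, snd p)) (f p)"
    using smooth_on_imp_continuous_on[OF J(3)] J(1,2)
    by (auto intro!: continuous_intros simp: continuous_on_eq_continuous_at)
  then have "filterlim (\<lambda>t. (h t, snd p)) (nhds (h (f p), snd p)) (nhds (f p))"
    using tendsto_at_iff_tendsto_nhds[of "\<lambda>t. (h t, snd p)" "f p"] by (simp add: isCont_def)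
  then have "filterlim (\<lambda>t. (h t, snd p)) (nhds p) (nhds (f p))"
    using J(4) by simp
  then have "\<forall>\<^sub>F t in nhds (f p). w (f (h t, snd p)) = 0"
    using ev filterlim_iff by fastforce
  moreover have "\<forall>\<^sub>F t in nhds (f p). t \<in> J"
    using J(1,2) by (rule eventually_nhds_in_open)
  ultimately show ?thesis
    by eventually_elim (use fh in auto)
qed

text \<open>The components vanish one after the other. The pair \<open>(w', w'') \<circ> f\<close> satisfies a closed linear
  system with continuous coefficients, so it vanishes near \<open>p\<close>, and then so does \<open>w\<close>. The third
  equation becomes homogeneous in \<open>s\<^sub>1, s\<^sub>2\<close>, whence \<open>u = \<partial>\<^sub>1 s\<^sub>1\<close> satisfies a closed linear system
  and vanishes. This leaves \<open>s\<^sub>1\<close> and \<open>s\<^sub>2\<close> with zero gradient.\<close>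
lemma homogeneous_solution_zero_of_jet_zero:
  assumes sol: "scaled_solution f g 0 U J s1 s2 w" and p: "p \<in> U"
    and jet: "jet_at f p s1 s2 w = 0"
  shows "germs_at f p s1 s2 w = 0"
proof -
  have J: "open J" "f ` U \<subseteq> J" "smooth_on J w" and s: "smooth_on U s1" "smooth_on U s2"
    and e: "\<And>q. q \<in> U \<Longrightarrow> D2 s1 q = 0" "\<And>q. q \<in> U \<Longrightarrow> D1 s2 q = 0"
      "\<And>q. q \<in> U \<Longrightarrow> b q * D1 s1 q + D2 s2 q = (b q - 1) * deriv w (f q)"
      "\<And>q. q \<in> U \<Longrightarrow> T3 f g q * deriv (deriv (deriv w)) (f q) + T2 f g q * deriv (deriv w) (f q)
        + T1 f g q * deriv w (f q) = 0"
    using sol unfolding scaled_solution_def by auto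
  have jet0: "s1 p = 0" "s2 p = 0" "D1 s1 p = 0" "w (f p) = 0" "deriv w (f p) = 0"
      "deriv (deriv w) (f p) = 0"
    using jet by (auto simp: jet_at_def zero_prod_def)
  note sw = smooth_w_f[OF J] smooth_deriv_w_f[OF J] smooth_deriv2_w_f[OF J]
  define w1 w2 where "w1 = (\<lambda>q. deriv w (f q))" and "w2 = (\<lambda>q. deriv (deriv w) (f q))"
  have sw12: "smooth_on U w1" "smooth_on U w2" using sw by (simp_all add: w1_def w2_def)
  define t1 t2 where "t1 = (\<lambda>q. T1 f g q / T3 f g q)" and "t2 = (\<lambda>q. T2 f g q / T3 f g q)"
  have st: "smooth_on U t1" "smooth_on U t2"
    unfolding t1_def t2_def by (auto intro!: smooth_intros smooth_T open_U simp: T3_nz)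
  have pw: "px w1 q = px f q * w2 q" "py w1 q = py f q * w2 q"
    "px w2 q = px f q * - (t2 q * w2 q + t1 q * w1 q)"
    "py w2 q = py f q * - (t2 q * w2 q + t1 q * w1 q)" if q: "q \<in> U" for q
  proof -
    have "T3 f g q * (deriv (deriv (deriv w)) (f q) + (t2 q * w2 q + t1 q * w1 q)) = 0"
      using e(4)[OF q] T3_nz[OF q]
      by (simp add: t1_def t2_def w1_def w2_def distrib_left add_ac)
    then have w3: "deriv (deriv (deriv w)) (f q) = - (t2 q * w2 q + t1 q * w1 q)"
      using T3_nz[OF q] by (simp add: eq_neg_iff_add_eq_0)
    show "px w1 q = px f q * w2 q" "py w1 q = py f q * w2 q"
      "px w2 q = px f q * - (t2 q * w2 q + t1 q * w1 q)"
      "py w2 q = py f q * - (t2 q * w2 q + t1 q * w1 q)"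
      unfolding px_eq[OF q, of w1] px_eq[OF q, of w2] py_eq[OF q, of w1] py_eq[OF q, of w2]
        w3[symmetric]
      unfolding w1_def w2_def D_w_f[OF J q] by simp_all
  qed

  \<comment> \<open>Energy of the system for \<open>(w', w'') \<circ> f\<close>; the bound on its gradient rests on \<open>2 |u v| \<le> u\<^sup>2 + v\<^sup>2\<close>.\<close>
  define E where "E = (\<lambda>q. w1 q * w1 q + w2 q * w2 q)"
  define C where "C = (\<lambda>q. (\<bar>px f q\<bar> + \<bar>py f q\<bar>) * (1 + \<bar>t1 q\<bar> + 2 * \<bar>t2 q\<bar>))"
  have bound: "\<bar>2 * (z * (u * v - v * (c2 * v + c1 * u)))\<bar>
      \<le> (\<bar>z\<bar> + \<bar>z'\<bar>) * (1 + \<bar>c1\<bar> + 2 * \<bar>c2\<bar>) * (u * u + v * v)" for z z' u v c1 c2 :: real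
  proof -
    have uv: "2 * (\<bar>u\<bar> * \<bar>v\<bar>) \<le> u * u + v * v"
      using sum_squares_bound[of "\<bar>u\<bar>" "\<bar>v\<bar>"] by (simp add: power2_eq_square mult.assoc)
    have vv: "\<bar>v\<bar> * \<bar>v\<bar> \<le> u * u + v * v" by simp
    have "\<bar>2 * (u * v - v * (c2 * v + c1 * u))\<bar>
        = \<bar>2 * (u * v) + - (2 * c2 * (v * v)) + - (c1 * (2 * (u * v)))\<bar>"
      by (simp add: algebra_simps)
    also have "\<dots> \<le> 2 * (\<bar>u\<bar> * \<bar>v\<bar>) + 2 * \<bar>c2\<bar> * (\<bar>v\<bar> * \<bar>v\<bar>) + \<bar>c1\<bar> * (2 * (\<bar>u\<bar> * \<bar>v\<bar>))"
      by (intro abs_triangle_ineq[THEN order_trans] add_mono) (simp_all add: abs_mult)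
    also have "\<dots> \<le> (u * u + v * v) + 2 * \<bar>c2\<bar> * (u * u + v * v) + \<bar>c1\<bar> * (u * u + v * v)"
      using uv vv by (intro add_mono mult_left_mono) auto
    also have "\<dots> = (1 + \<bar>c1\<bar> + 2 * \<bar>c2\<bar>) * (u * u + v * v)" by (simp add: algebra_simps)
    finally have "\<bar>2 * (u * v - v * (c2 * v + c1 * u))\<bar> \<le> (1 + \<bar>c1\<bar> + 2 * \<bar>c2\<bar>) * (u * u + v * v)" .
    then have "\<bar>z\<bar> * \<bar>2 * (u * v - v * (c2 * v + c1 * u))\<bar>
        \<le> (\<bar>z\<bar> + \<bar>z'\<bar>) * ((1 + \<bar>c1\<bar> + 2 * \<bar>c2\<bar>) * (u * u + v * v))"
      by (intro mult_mono) auto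
    then show ?thesis by (simp add: abs_mult mult_ac)
  qed
  have contC: "continuous_on U C"
    unfolding C_def using st smooth_f
    by (intro continuous_intros smooth_on_imp_continuous_on smooth_on_px smooth_on_py)
  obtain \<rho>1 where \<rho>1: "\<rho>1 > 0" "ball p \<rho>1 \<subseteq> U" "\<And>q. q \<in> ball p \<rho>1 \<Longrightarrow> E q = 0"
  proof (rule nonneg_zero_near_of_gradient_bound[OF open_U p _ _ contC])
    show "smooth_on U E" unfolding E_def by (intro smooth_intros sw12 open_U)
    show "E p = 0" using jet0 by (simp add: E_def w1_def w2_def)
    show "E q \<ge> 0" for q by (simp add: E_def)
    have E': "px E q = 2 * (px f q * (w1 q * w2 q - w2 q * (t2 q * w2 q + t1 q * w1 q)))"
      "py E q = 2 * (py f q * (w1 q * w2 q - w2 q * (t2 q * w2 q + t1 q * w1 q)))"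
      if q: "q \<in> U" for q
    proof -
      have d: "w1 differentiable (at q)" "w2 differentiable (at q)"
        "(\<lambda>q. w1 q * w1 q) differentiable (at q)" "(\<lambda>q. w2 q * w2 q) differentiable (at q)"
        by (intro differentiable[OF _ q] smooth_intros sw12 open_U)+
      show "px E q = 2 * (px f q * (w1 q * w2 q - w2 q * (t2 q * w2 q + t1 q * w1 q)))"
        "py E q = 2 * (py f q * (w1 q * w2 q - w2 q * (t2 q * w2 q + t1 q * w1 q)))"
        using d by (simp_all add: E_def px_rules py_rules pw[OF q] algebra_simps)
    qed
    show "\<bar>px E q\<bar> \<le> C q * E q" "\<bar>py E q\<bar> \<le> C q * E q" if "q \<in> U" for q
      using bound[of "px f q" "w1 q" "w2 q" "t2 q" "t1 q" "py f q"]
        bound[of "py f q" "w1 q" "w2 q" "t2 q" "t1 q" "px f q"]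
      unfolding E'[OF that] unfolding C_def E_def by (simp_all add: add.commute)
  qed blast
  have w12_0: "w1 q = 0" "w2 q = 0" if "q \<in> ball p \<rho>1" for q
    using \<rho>1(3)[OF that] by (auto simp: E_def sum_squares_eq_zero_iff)

  obtain \<rho>2 where \<rho>2: "\<rho>2 > 0" "ball p \<rho>2 \<subseteq> ball p \<rho>1" "\<And>q. q \<in> ball p \<rho>2 \<Longrightarrow> w (f q) = 0"
  proof (rule zero_near_of_gradient_bound[of "ball p \<rho>1" p "\<lambda>q. w (f q)" "\<lambda>_. 0"])
    show "smooth_on (ball p \<rho>1) (\<lambda>q. w (f q))" using sw(1) \<rho>1(2) by (rule smooth_on_subset)
    show "\<bar>px (\<lambda>q. w (f q)) q\<bar> \<le> 0 * \<bar>w (f q)\<bar>" "\<bar>py (\<lambda>q. w (f q)) q\<bar> \<le> 0 * \<bar>w (f q)\<bar>"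
      if "q \<in> ball p \<rho>1" for q
    proof -
      have q: "q \<in> U" using that \<rho>1(2) by auto
      show "\<bar>px (\<lambda>q. w (f q)) q\<bar> \<le> 0 * \<bar>w (f q)\<bar>" "\<bar>py (\<lambda>q. w (f q)) q\<bar> \<le> 0 * \<bar>w (f q)\<bar>"
        using w12_0(1)[OF that]
        by (simp_all add: px_eq[OF q, of "\<lambda>q. w (f q)"] py_eq[OF q, of "\<lambda>q. w (f q)"] D_w_f[OF J q] w1_def)
    qed
  qed (use \<rho>1 jet0 in auto)
  have "\<forall>\<^sub>F q in nhds p. w (f q) = 0"
    using \<rho>2 by (auto simp: eventually_nhds intro!: exI[of _ "ball p \<rho>2"])
  then have gw: "\<forall>\<^sub>F t in nhds (f p). w t = 0"
    by (rule function_of_f_zero_near[OF p])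

  define \<beta> where "\<beta> = (\<lambda>q. (b q - 1) * w1 q)"
  have s\<beta>: "smooth_on U \<beta>" unfolding \<beta>_def by (intro smooth_intros smooth sw12)
  have D1\<beta>: "D1 \<beta> q = 0" "\<beta> q = 0" if q: "q \<in> ball p \<rho>1" for q
  proof -
    have "q \<in> U" using q \<rho>1(2) by auto
    then show "D1 \<beta> q = 0" "\<beta> q = 0"
      using D_b1_w[OF J, of q] w12_0[OF q] by (simp_all add: \<beta>_def w1_def w2_def)
  qed
  have e3: "b q * D1 s1 q + D2 s2 q = \<beta> q" if "q \<in> U" for q
    using e(3)[OF that] by (simp add: \<beta>_def w1_def)
  define u where "u = D1 s1"
  have su: "smooth_on U u" unfolding u_def by (rule smooth_D1[OF s(1)])
  obtain \<rho>3 where \<rho>3: "\<rho>3 > 0" "ball p \<rho>3 \<subseteq> ball p \<rho>1" "\<And>q. q \<in> ball p \<rho>3 \<Longrightarrow> u q = 0"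
  proof (rule zero_near_of_gradient_bound[of "ball p \<rho>1" p u
        "\<lambda>q. \<bar>px f q * r q\<bar> + \<bar>py f q * H q\<bar>"])
    show "continuous_on (ball p \<rho>1) (\<lambda>q. \<bar>px f q * r q\<bar> + \<bar>py f q * H q\<bar>)"
      by (intro continuous_intros smooth_on_imp_continuous_on smooth_on_subset[OF _ \<rho>1(2)]
          smooth_on_px smooth_on_py smooth)
    show "smooth_on (ball p \<rho>1) u" using su \<rho>1(2) by (rule smooth_on_subset)
    fix q assume q: "q \<in> ball p \<rho>1"
    then have qU: "q \<in> U" using \<rho>1(2) by auto
    have "D2 u q = H q * u q" "D1 u q = r q * u q"
      using prolongation_homogeneous[OF s s\<beta> e(1,2) e3 qU] D1\<beta>[OF q] by (auto simp: u_def)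
    then have "px u q = - (px f q * r q) * u q" "py u q = - (py f q * H q) * u q"
      using px_eq[OF qU, of u] py_eq[OF qU, of u] by simp_all
    then have "\<bar>px u q\<bar> = \<bar>px f q * r q\<bar> * \<bar>u q\<bar>" "\<bar>py u q\<bar> = \<bar>py f q * H q\<bar> * \<bar>u q\<bar>"
      by (simp_all add: abs_mult)
    then show "\<bar>px u q\<bar> \<le> (\<bar>px f q * r q\<bar> + \<bar>py f q * H q\<bar>) * \<bar>u q\<bar>"
      "\<bar>py u q\<bar> \<le> (\<bar>px f q * r q\<bar> + \<bar>py f q * H q\<bar>) * \<bar>u q\<bar>"
      by (simp_all add: mult_right_mono)
  qed (use \<rho>1 jet0 in \<open>auto simp: u_def\<close>)
  have flat: "\<forall>\<^sub>F q in nhds p. h q = 0"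
    if h: "smooth_on U h" "h p = 0" "\<And>q. q \<in> ball p \<rho>3 \<Longrightarrow> D1 h q = 0"
      "\<And>q. q \<in> ball p \<rho>3 \<Longrightarrow> D2 h q = 0" for h
  proof -
    have sub: "ball p \<rho>3 \<subseteq> U" using \<rho>3(2) \<rho>1(2) by auto
    obtain \<rho> where \<rho>: "\<rho> > 0" "\<And>q. q \<in> ball p \<rho> \<Longrightarrow> h q = 0"
    proof (rule zero_near_of_gradient_bound[of "ball p \<rho>3" p h "\<lambda>_. 0"])
      show "smooth_on (ball p \<rho>3) h" using h(1) sub by (rule smooth_on_subset)
      show "\<bar>px h q\<bar> \<le> 0 * \<bar>h q\<bar>" "\<bar>py h q\<bar> \<le> 0 * \<bar>h q\<bar>" if "q \<in> ball p \<rho>3" for q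
        using px_eq[of q h] py_eq[of q h] h(3,4)[OF that] sub that by auto
    qed (use \<rho>3 h in auto)
    then show ?thesis by (auto simp: eventually_nhds intro!: exI[of _ "ball p \<rho>"])
  qed
  have U3: "q \<in> U" "q \<in> ball p \<rho>1" if "q \<in> ball p \<rho>3" for q
    using that \<rho>3(2) \<rho>1(2) by auto
  have "D1 s1 q = 0" "D2 s2 q = 0" if q: "q \<in> ball p \<rho>3" for q
    using \<rho>3(3)[OF q] e3[OF U3(1)[OF q]] D1\<beta>(2)[OF U3(2)[OF q]] by (simp_all add: u_def)
  then have "\<forall>\<^sub>F q in nhds p. s1 q = 0" "\<forall>\<^sub>F q in nhds p. s2 q = 0"
    using flat[OF s(1) jet0(1)] flat[OF s(2) jet0(2)] e(1,2) U3(1) by blast+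
  with gw show ?thesis
    by (simp add: germs_at_def germ_at_zero_iff zero_prod_def)
qed

lemma jet_at_zero_of_germs_zero:
  assumes "germs_at f p s1 s2 w = 0"
  shows "jet_at f p s1 s2 w = 0"
proof -
  have ev: "\<forall>\<^sub>F q in nhds p. s1 q = 0" "\<forall>\<^sub>F q in nhds p. s2 q = 0" "\<forall>\<^sub>F t in nhds (f p). w t = 0"
    using assms by (auto simp: germs_at_def germ_at_zero_iff zero_prod_def)
  obtain S where S: "open S" "p \<in> S" "\<And>q. q \<in> S \<Longrightarrow> s1 q = 0"
    using ev(1) unfolding eventually_nhds by blast
  have "px s1 p = px (\<lambda>_. 0) p" by (rule px_cong[OF S])
  then have "D1 s1 p = D1 (\<lambda>_. 0) p" by (simp add: D1_eq)
  moreover obtain I where I: "open I" "f p \<in> I" "\<And>t. t \<in> I \<Longrightarrow> w t = 0"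
    using ev(3) unfolding eventually_nhds by blast
  have 1: "deriv w t = 0" if "t \<in> I" for t
    using deriv_cong_open[OF I(1,3) that, of "\<lambda>t. t"] by simp
  have "deriv (deriv w) (f p) = 0"
    using deriv_cong_open[OF I(1) 1 I(2), of "\<lambda>t. t"] by simp
  ultimately show ?thesis
    using 1[OF I(2)] eventually_nhds_x_imp_x[OF ev(1)] eventually_nhds_x_imp_x[OF ev(2)]
      eventually_nhds_x_imp_x[OF ev(3)]
    by (simp add: jet_at_def D1_const zero_prod_def)
qed

end

section \<open>The rank\<close>

lemma dim_linear_image_inj:
  fixes L :: "'a::real_vector \<Rightarrow> 'b::real_vector"
  assumes "linear L" "subspace G" "\<And>x. x \<in> G \<Longrightarrow> L x = 0 \<Longrightarrow> x = 0"
  shows "dim (L ` G) = dim G"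
proof -
  obtain B where B: "B \<subseteq> G" "independent B" "G \<subseteq> span B"
    using real_vector.maximal_independent_subset by blast
  have span_B: "span B = G"
    using B assms(2) real_vector.span_minimal by blast
  have inj: "inj_on L G"
    using assms(1,3) linear_inj_on_iff_eq_0[OF assms(1,2)] by blast
  have "independent (L ` B)"
    using real_vector.linear_independent_injective_image[OF assms(1) B(2)] inj span_B by simp
  moreover have "L ` G \<subseteq> span (L ` B)"
    using linear_span_image[OF assms(1), of B] span_B by simp
  ultimately have "card (L ` B) = dim (L ` G)"
    using B(1) by (intro real_vector.basis_card_eq_dim) auto
  moreover have "card (L ` B) = card B"
    using inj B(1) by (intro card_image) (rule inj_on_subset)
  moreover have "card B = dim G"
    using B by (intro real_vector.basis_card_eq_dim)
  ultimately show ?thesis by simp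
qed

context canonical_web
begin

lemma scaled_solution_restrict:
  assumes "scaled_solution f g \<kappa> N J s1 s2 w" "N \<subseteq> U"
  shows "canonical_web N f g"
  using assms restrict unfolding scaled_solution_def by blast

lemma jet_graph_zero_iff:
  assumes x: "x \<in> jet_graph U f g p"
  shows "fst x = 0 \<longleftrightarrow> x = 0" and "snd x = 0 \<longleftrightarrow> x = 0"
proof -
  obtain N J s1 s2 w where N: "p \<in> N" "N \<subseteq> U" "scaled_solution f g 0 N J s1 s2 w"
    and x: "x = (germs_at f p s1 s2 w, jet_at f p s1 s2 w)"
    by (rule jet_graphE[OF x])
  interpret N: canonical_web N f g by (rule scaled_solution_restrict[OF N(3,2)])
  have "germs_at f p s1 s2 w = 0 \<longleftrightarrow> jet_at f p s1 s2 w = 0"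
    using N.homogeneous_solution_zero_of_jet_zero[OF N(3,1)] jet_at_zero_of_germs_zero by blast
  then show "fst x = 0 \<longleftrightarrow> x = 0" "snd x = 0 \<longleftrightarrow> x = 0"
    unfolding x by (auto simp: zero_prod_def)
qed

lemma dim_germs_eq_dim_jets:
  assumes "p \<in> U"
  shows "dim (fst ` jet_graph U f g p) = dim (snd ` jet_graph U f g p)"
  using dim_linear_image_inj[OF linear_fst subspace_jet_graph[OF assms]]
    dim_linear_image_inj[OF linear_snd subspace_jet_graph[OF assms]]
    jet_graph_zero_iff by simp

lemma solution_germsE:
  assumes "x \<in> solution_germs U f g p"
  obtains N J s1 s2 w where "p \<in> N" "N \<subseteq> U" "samuelson_solution f g N J s1 s2 w"
    "x = germs_at f p s1 s2 w"
proof -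
  have "\<exists>s1 s2 w. x = (germ_at p s1, germ_at p s2, germ_at (f p) w) \<and>
      (\<exists>N J. p \<in> N \<and> N \<subseteq> U \<and> samuelson_solution f g N J s1 s2 w)"
    using assms unfolding solution_germs_def by (rule CollectD)
  then show thesis by (elim exE conjE) (rule that[unfolded germs_at_def])
qed

lemma solution_germsI:
  assumes "p \<in> N" "N \<subseteq> U" "samuelson_solution f g N J s1 s2 w"
  shows "germs_at f p s1 s2 w \<in> solution_germs U f g p"
  unfolding solution_germs_def germs_at_def
  by (rule CollectI, rule exI[of _ s1], rule exI[of _ s2], rule exI[of _ w], rule conjI[OF refl],
      rule exI[of _ N], rule exI[of _ J]) (use assms in simp)

text \<open>The solutions form an affine space over the homogeneous solutions; the second integrability
  condition does not involve the unknowns and is inherited from any one solution.\<close>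
lemma solution_germs_differences:
  assumes ne: "solution_germs U f g p \<noteq> {}"
  shows "{s - t | s t. s \<in> solution_germs U f g p \<and> t \<in> solution_germs U f g p}
    = fst ` jet_graph U f g p" (is "?D = _")
proof (intro equalityI subsetI)
  fix x assume "x \<in> ?D"
  then obtain s t where st: "s \<in> solution_germs U f g p" "t \<in> solution_germs U f g p" "x = s - t"
    by (elim CollectE exE conjE)
  obtain N J s1 s2 w where s: "p \<in> N" "N \<subseteq> U" "samuelson_solution f g N J s1 s2 w"
    "s = germs_at f p s1 s2 w" by (rule solution_germsE[OF st(1)])
  obtain N' J' s1' s2' w' where t: "p \<in> N'" "N' \<subseteq> U" "samuelson_solution f g N' J' s1' s2' w'"
    "t = germs_at f p s1' s2' w'" by (rule solution_germsE[OF st(2)])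
  have ss: "scaled_solution f g 1 N J s1 s2 w" "scaled_solution f g 1 N' J' s1' s2' w'"
    using s(3) t(3) samuelson_solution_iff[OF s(2)] samuelson_solution_iff[OF t(2)] by auto
  have "scaled_solution f g 0 (N \<inter> N') (J \<inter> J')
      (\<lambda>q. s1 q + -1 * s1' q) (\<lambda>q. s2 q + -1 * s2' q) (\<lambda>t. w t + -1 * w' t)"
    using scaled_solution_add_scaleR[OF ss s(2), of "-1"] by simp
  then have "(germs_at f p (\<lambda>q. s1 q + -1 * s1' q) (\<lambda>q. s2 q + -1 * s2' q) (\<lambda>t. w t + -1 * w' t),
      jet_at f p (\<lambda>q. s1 q + -1 * s1' q) (\<lambda>q. s2 q + -1 * s2' q) (\<lambda>t. w t + -1 * w' t))
      \<in> jet_graph U f g p"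
    using s(1,2) t(1) by (intro jet_graphI[of p "N \<inter> N'" U]) blast+
  from imageI[OF this, of fst]
  have "germs_at f p (\<lambda>q. s1 q + -1 * s1' q) (\<lambda>q. s2 q + -1 * s2' q) (\<lambda>t. w t + -1 * w' t)
      \<in> fst ` jet_graph U f g p"
    unfolding fst_conv .
  moreover have "germs_at f p (\<lambda>q. s1 q + -1 * s1' q) (\<lambda>q. s2 q + -1 * s2' q) (\<lambda>t. w t + -1 * w' t) = x"
    unfolding germs_at_add_scaleR st(3) s(4) t(4) by simp
  ultimately show "x \<in> fst ` jet_graph U f g p" by simp
next
  fix x assume "x \<in> fst ` jet_graph U f g p"
  then obtain z where z: "z \<in> jet_graph U f g p" "x = fst z" by (elim imageE)
  obtain N' J' s1' s2' w' where h: "p \<in> N'" "N' \<subseteq> U" "scaled_solution f g 0 N' J' s1' s2' w'"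
    "z = (germs_at f p s1' s2' w', jet_at f p s1' s2' w')"
    by (rule jet_graphE[OF z(1)])
  obtain s where s0: "s \<in> solution_germs U f g p" using ne by (meson ex_in_conv)
  obtain N J s1 s2 w where s: "p \<in> N" "N \<subseteq> U" "samuelson_solution f g N J s1 s2 w"
    "s = germs_at f p s1 s2 w" by (rule solution_germsE[OF s0])
  have ss: "scaled_solution f g 1 N J s1 s2 w" and i2: "\<forall>q\<in>N. integ2 f g q = 0"
    using s(3) samuelson_solution_iff[OF s(2)] by auto
  have NU: "N \<inter> N' \<subseteq> U" using s(2) by auto
  have "scaled_solution f g 1 (N \<inter> N') (J \<inter> J')
      (\<lambda>q. s1 q + 1 * s1' q) (\<lambda>q. s2 q + 1 * s2' q) (\<lambda>t. w t + 1 * w' t)"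
    using scaled_solution_add_scaleR[OF ss h(3) s(2), of 1] by simp
  then have "samuelson_solution f g (N \<inter> N') (J \<inter> J')
      (\<lambda>q. s1 q + 1 * s1' q) (\<lambda>q. s2 q + 1 * s2' q) (\<lambda>t. w t + 1 * w' t)"
    unfolding samuelson_solution_iff[OF NU] using i2 by auto
  from solution_germsI[OF _ NU this] s(1) h(1)
  have "s + x \<in> solution_germs U f g p"
    unfolding germs_at_add_scaleR s(4) z(2) h(4) by simp
  then have "\<exists>s' t. x = s' - t \<and> s' \<in> solution_germs U f g p \<and> t \<in> solution_germs U f g p"
    using s0 by (intro exI[of _ "s + x"] exI[of _ s]) simp
  then show "x \<in> ?D" by (rule CollectI)
qed

text \<open>The projections of the graph are injective, so the germs of homogeneous solutions have the
  same dimension as their jets, which form a subspace of \<open>\<real>\<^sup>6\<close>.\<close>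
lemma web_rank_eq_6_iff:
  assumes p: "p \<in> U"
  shows "web_rank U f g p = 6 \<longleftrightarrow>
    solution_germs U f g p \<noteq> {} \<and> snd ` jet_graph U f g p = UNIV"
proof (cases "solution_germs U f g p = {}")
  case True
  then show ?thesis by (simp add: web_rank_def affine_dim_def)
next
  case False
  have sub: "subspace (snd ` jet_graph U f g p)"
    using subspace_jet_graph[OF p] by (intro linear_subspace_image linear_snd)
  have "web_rank U f g p = int (dim (snd ` jet_graph U f g p))"
    using False solution_germs_differences[OF False] dim_germs_eq_dim_jets[OF p]
    by (simp add: web_rank_def affine_dim_def)
  moreover have "dim (snd ` jet_graph U f g p) = 6 \<longleftrightarrow> snd ` jet_graph U f g p = UNIV"
  proof -
    have span: "span (snd ` jet_graph U f g p) = snd ` jet_graph U f g p"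
      using sub by (simp only: span_eq_iff)
    then show ?thesis
      using dim_eq_full[of "snd ` jet_graph U f g p", unfolded span] by (simp add: eval_nat_numeral)
  qed
  ultimately show ?thesis using False by auto
qed

text \<open>Divide the third order equation by \<open>T\<^sub>3\<close> and apply \<open>\<delta>\<close>, which annihilates all derivatives of
  \<open>w\<close> composed with \<open>f\<close>.\<close>
lemma delta_ratio_relation:
  assumes sol: "scaled_solution f g \<kappa> N J s1 s2 w" and N: "N \<subseteq> U" and p: "p \<in> N"
  shows "delta f (\<lambda>q. T2 f g q / T3 f g q) p * deriv (deriv w) (f p)
    + delta f (\<lambda>q. T1 f g q / T3 f g q) p * deriv w (f p)
    + \<kappa> * delta f (\<lambda>q. T0 f g q / T3 f g q) p = 0"
proof -
  interpret N: canonical_web N f g by (rule scaled_solution_restrict[OF sol N])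
  have J: "open J" "f ` N \<subseteq> J" "smooth_on J w"
    and e: "\<And>q. q \<in> N \<Longrightarrow> T3 f g q * deriv (deriv (deriv w)) (f q) + T2 f g q * deriv (deriv w) (f q)
        + T1 f g q * deriv w (f q) + \<kappa> * T0 f g q = 0"
    using sol unfolding scaled_solution_def by auto
  define t0 t1 t2 where "t0 = (\<lambda>q. T0 f g q / T3 f g q)" and "t1 = (\<lambda>q. T1 f g q / T3 f g q)"
    and "t2 = (\<lambda>q. T2 f g q / T3 f g q)"
  have st: "smooth_on N t0" "smooth_on N t1" "smooth_on N t2"
    unfolding t0_def t1_def t2_def by (auto intro!: smooth_intros N.smooth_T N.open_U simp: N.T3_nz)
  define w1 w2 w3 where "w1 = (\<lambda>q. deriv w (f q))" and "w2 = (\<lambda>q. deriv (deriv w) (f q))"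
    and "w3 = (\<lambda>q. deriv (deriv (deriv w)) (f q))"
  have Jw: "smooth_on J (deriv w)" "smooth_on J (deriv (deriv w))" "smooth_on J (deriv (deriv (deriv w)))"
    using J by (auto intro!: smooth_on_deriv)
  have sw: "smooth_on N w1" "smooth_on N w2" "smooth_on N w3"
    unfolding w1_def w2_def w3_def
    using N.smooth_w_f[OF J(1,2)] Jw by blast+
  have dw: "D1 w1 p = D2 w1 p" "D1 w2 p = D2 w2 p" "D1 w3 p = D2 w3 p"
    unfolding w1_def w2_def w3_def
    using N.D_compose_f[OF Jw(1) J(2) p] N.D_compose_f[OF Jw(2) J(2) p] N.D_compose_f[OF Jw(3) J(2) p]
    by simp_all
  have eq: "w3 q + t2 q * w2 q + t1 q * w1 q + \<kappa> * t0 q = 0" if q: "q \<in> N" for q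
  proof -
    have nz: "T3 f g q \<noteq> 0" by (rule N.T3_nz[OF q])
    have "w3 q + t2 q * w2 q + t1 q * w1 q + \<kappa> * t0 q
        = (T3 f g q * w3 q + T2 f g q * w2 q + T1 f g q * w1 q + \<kappa> * T0 f g q) / T3 f g q"
      using nz by (simp add: t0_def t1_def t2_def add_divide_distrib)
    then show ?thesis using e[OF q] by (simp add: w1_def w2_def w3_def)
  qed
  let ?h = "\<lambda>q. w3 q + t2 q * w2 q + t1 q * w1 q + \<kappa> * t0 q"
  have "D1 ?h p = 0" "D2 ?h p = 0"
    using N.D1_cong[OF p, of ?h "\<lambda>_. 0"] N.D2_cong[OF p, of ?h "\<lambda>_. 0"] eq
    by (simp_all add: D1_const D2_const)
  moreover have "D1 ?h p = D1 w3 p + (D1 t2 p * w2 p + t2 p * D1 w2 p)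
      + (D1 t1 p * w1 p + t1 p * D1 w1 p) + \<kappa> * D1 t0 p"
    "D2 ?h p = D2 w3 p + (D2 t2 p * w2 p + t2 p * D2 w2 p)
      + (D2 t1 p * w1 p + t1 p * D2 w1 p) + \<kappa> * D2 t0 p"
    using p by (simp_all add: N.D_add N.D_mult st sw smooth_intros N.open_U D1_const D2_const)
  ultimately have "(D1 t2 p - D2 t2 p) * w2 p + (D1 t1 p - D2 t1 p) * w1 p
      + \<kappa> * (D1 t0 p - D2 t0 p) = 0"
    unfolding dw by (simp add: algebra_simps)
  then show ?thesis by (simp add: delta_def t0_def t1_def t2_def w1_def w2_def)
qed

text \<open>Homogeneous solutions with \<open>(w', w'') = (0, 1)\<close> and \<open>(1, 0)\<close> at \<open>f p\<close> isolate the first two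
  coefficients of \<open>delta_ratio_relation\<close>; any solution of the full system then gives the third.\<close>
lemma rank_6_imp_conditions:
  assumes p: "p \<in> U" and rank: "web_rank U f g p = 6"
  shows "Kfun f p = - dd_log_b f g p" "delta f (\<lambda>q. T2 f g q / T3 f g q) p = 0"
    "delta f (\<lambda>q. T1 f g q / T3 f g q) p = 0" "delta f (\<lambda>q. T0 f g q / T3 f g q) p = 0"
proof -
  have ne: "solution_germs U f g p \<noteq> {}" and full: "snd ` jet_graph U f g p = UNIV"
    using rank web_rank_eq_6_iff[OF p] by auto
  have jets: "\<exists>N J s1 s2 w. p \<in> N \<and> N \<subseteq> U \<and> scaled_solution f g 0 N J s1 s2 w
      \<and> deriv w (f p) = k1 \<and> deriv (deriv w) (f p) = k2" for k1 k2
  proof -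
    have "(0, 0, 0, 0, k1, k2) \<in> snd ` jet_graph U f g p" by (simp add: full)
    then obtain z where z: "z \<in> jet_graph U f g p" "(0, 0, 0, 0, k1, k2) = snd z"
      by (elim imageE)
    obtain N J s1 s2 w where N: "p \<in> N" "N \<subseteq> U" "scaled_solution f g 0 N J s1 s2 w"
      and z_eq: "z = (germs_at f p s1 s2 w, jet_at f p s1 s2 w)"
      by (rule jet_graphE[OF z(1)])
    have "deriv w (f p) = k1" "deriv (deriv w) (f p) = k2"
      using z(2) unfolding z_eq jet_at_def by simp_all
    with N show ?thesis by (intro exI conjI)
  qed
  obtain N J s1 s2 w where "p \<in> N" "N \<subseteq> U" "scaled_solution f g 0 N J s1 s2 w"
    "deriv w (f p) = 0" "deriv (deriv w) (f p) = 1"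
    using jets[of 0 1] by (elim exE conjE)
  then show \<delta>2: "delta f (\<lambda>q. T2 f g q / T3 f g q) p = 0"
    using delta_ratio_relation[of 0 N J s1 s2 w p] by simp
  obtain N J s1 s2 w where "p \<in> N" "N \<subseteq> U" "scaled_solution f g 0 N J s1 s2 w"
    "deriv w (f p) = 1" "deriv (deriv w) (f p) = 0"
    using jets[of 1 0] by (elim exE conjE)
  then show \<delta>1: "delta f (\<lambda>q. T1 f g q / T3 f g q) p = 0"
    using delta_ratio_relation[of 0 N J s1 s2 w p] by simp
  obtain s where s0: "s \<in> solution_germs U f g p" using ne by (meson ex_in_conv)
  obtain N J s1 s2 w where s: "p \<in> N" "N \<subseteq> U" "samuelson_solution f g N J s1 s2 w"
    by (rule solution_germsE[OF s0])
  have "scaled_solution f g 1 N J s1 s2 w" and i2: "\<forall>q\<in>N. integ2 f g q = 0"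
    using s(3) samuelson_solution_iff[OF s(2)] by auto
  then show "delta f (\<lambda>q. T0 f g q / T3 f g q) p = 0"
    using delta_ratio_relation[of 1 N J s1 s2 w p] s \<delta>1 \<delta>2 by simp
  show "Kfun f p = - dd_log_b f g p"
    using integ2_eq[OF p] i2 s(1) by auto
qed

text \<open>Subtracting the solution with zero jet from the one with jet \<open>v\<close> gives a homogeneous solution
  with jet \<open>v\<close>.\<close>
lemma conditions_imp_rank_6:
  assumes K: "\<And>q. q \<in> U \<Longrightarrow> Kfun f q = - dd_log_b f g q"
    and \<delta>2: "\<And>q. q \<in> U \<Longrightarrow> delta f (\<lambda>q. T2 f g q / T3 f g q) q = 0"
    and \<delta>1: "\<And>q. q \<in> U \<Longrightarrow> delta f (\<lambda>q. T1 f g q / T3 f g q) q = 0"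
    and \<delta>0: "\<And>q. q \<in> U \<Longrightarrow> delta f (\<lambda>q. T0 f g q / T3 f g q) q = 0"
    and p: "p \<in> U"
  shows "web_rank U f g p = 6"
proof -
  have ex: "\<exists>N J s1 s2 w. p \<in> N \<and> N \<subseteq> U \<and> samuelson_solution f g N J s1 s2 w \<and> jet_at f p s1 s2 w = v"
    for v
  proof -
    obtain c1 c2 c3 k0 k1 k2 where v: "v = (c1, c2, c3, k0, k1, k2)" by (metis prod.exhaust)
    obtain N J s1 s2 w where "p \<in> N" "N \<subseteq> U" "samuelson_solution f g N J s1 s2 w"
      "s1 p = c1" "s2 p = c2" "D1 s1 p = c3" "w (f p) = k0" "deriv w (f p) = k1" "deriv (deriv w) (f p) = k2"
      by (rule solution_with_jet[OF K \<delta>2 \<delta>1 \<delta>0 p])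
    moreover from this have "jet_at f p s1 s2 w = v" unfolding v jet_at_def by simp
    ultimately show ?thesis by (intro exI conjI)
  qed
  obtain N0 J0 a1 a2 w0 where base: "p \<in> N0" "N0 \<subseteq> U" "samuelson_solution f g N0 J0 a1 a2 w0"
    "jet_at f p a1 a2 w0 = 0"
    using ex[of 0] by (elim exE conjE)
  have "v \<in> snd ` jet_graph U f g p" for v
  proof -
    obtain N J s1 s2 w where s: "p \<in> N" "N \<subseteq> U" "samuelson_solution f g N J s1 s2 w"
      "jet_at f p s1 s2 w = v"
      using ex[of v] by (elim exE conjE)
    have ss: "scaled_solution f g 1 N J s1 s2 w" "scaled_solution f g 1 N0 J0 a1 a2 w0"
      using s(3) base(3) samuelson_solution_iff[OF s(2)] samuelson_solution_iff[OF base(2)] by auto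
    have "scaled_solution f g 0 (N \<inter> N0) (J \<inter> J0)
        (\<lambda>q. s1 q + -1 * a1 q) (\<lambda>q. s2 q + -1 * a2 q) (\<lambda>t. w t + -1 * w0 t)"
      using scaled_solution_add_scaleR[OF ss s(2), of "-1"] by simp
    then have "(germs_at f p (\<lambda>q. s1 q + -1 * a1 q) (\<lambda>q. s2 q + -1 * a2 q) (\<lambda>t. w t + -1 * w0 t),
        jet_at f p (\<lambda>q. s1 q + -1 * a1 q) (\<lambda>q. s2 q + -1 * a2 q) (\<lambda>t. w t + -1 * w0 t))
        \<in> jet_graph U f g p"
      using s(1,2) base(1) by (intro jet_graphI[of p "N \<inter> N0" U]) blast+
    from imageI[OF this, of snd]
    have "jet_at f p (\<lambda>q. s1 q + -1 * a1 q) (\<lambda>q. s2 q + -1 * a2 q) (\<lambda>t. w t + -1 * w0 t)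
        \<in> snd ` jet_graph U f g p"
      unfolding snd_conv .
    then show ?thesis
      unfolding jet_at_add_scaleR[OF ss s(2,1) base(1)] s(4) base(4) by simp
  qed
  moreover have "solution_germs U f g p \<noteq> {}"
    using solution_germsI[OF base(1-3)] by auto
  ultimately show ?thesis
    using web_rank_eq_6_iff[OF p] by blast
qed

end

theorem theorem3:
  fixes U :: "(real \<times> real) set" and \<omega> :: "nat \<Rightarrow> real \<times> real \<Rightarrow> real \<times> real"
    and f g :: "real \<times> real \<Rightarrow> real"
  assumes "open U"
    and "samuelson_web U \<omega>"
    and "canonical_normalization U \<omega> f g"
  shows "(\<forall>p\<in>U. web_rank U f g p = 6) \<longleftrightarrow>
    (\<forall>p\<in>U. Kfun f p = - dd_log_b f g p \<and>
       delta f (\<lambda>q. T2 f g q / T3 f g q) p = 0 \<and>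
       delta f (\<lambda>q. T1 f g q / T3 f g q) p = 0 \<and>
       delta f (\<lambda>q. T0 f g q / T3 f g q) p = 0)"
proof -
  have "wedge (\<omega> 3) (\<omega> 4) p \<noteq> 0" if "p \<in> U" for p
    using assms(2) that unfolding samuelson_web_def planar_4_web_def by force
  then have "bfun f g p \<noteq> 1" if "p \<in> U" for p
    using assms(3) that unfolding canonical_normalization_def wedge_def by fastforce
  then interpret canonical_web U f g
    using assms(1,3) unfolding canonical_web_def canonical_normalization_def by blast
  show ?thesis
    using rank_6_imp_conditions conditions_imp_rank_6 by blast
qed

end
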